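(* In the setting described in the context, let $\Phi\in C^\infty(\mathbb{R}^m)$. (i) For $u_1,\dots,u_m,v,w\in C^\infty(U)$, $d\mu^c_{\langle\Phi(u_1,\dots,u_m),v\rangle}=\sum_{i=1}^m\Phi_{x_i}(u_1,\dots,u_m)\,d\mu^c_{\langle u_i,v\rangle}$. (ii) For $u_1,\dots,u_m,v,w\in C^\infty(U^\delta)$ and $f\in C_0^\infty(U^\delta)$, $\langle L^\delta(\Phi(u_1,\dots,u_m),vw),f\rangle=\sum_{i=1}^m\langle L^\delta(u_i,v),\Phi_{x_i}(u_1,\dots,u_m)wf\rangle$.
   Context: Let $U\subset\mathbb{R}^n$ be open, $m$ a positive Radon measure on $U$ with $\mathrm{supp}[m]=U$, $(\cdot,\cdot)$ the inner product of $L^2(U;m)$, $d$ the diagonal of $U\times U$. One of the following holds. Case 1: $(A,D(A))$ is the generator of a strongly continuous contraction sub-Markovian semigroup on $L^2(U;m)$, its co-generator (adjoint) $(\hat A,D(\hat A))$ satisfies $C_0^\infty(U)\subset D(A)\cap D(\hat A)$, and $\mathcal{E}(u,v):=(-Au,v)$ for $u,v\in C_0^\infty(U)$. Case 2: $(\mathcal{E},D(\mathcal{E}))$ is a semi-Dirichlet form on $L^2(U;m)$ with $C_0^\infty(U)\subset D(\mathcal{E})$ such that for every relatively compact open $O\subset U$, whenever $f_n,f\in C_0^\infty(O)$ with $f_n$ and all partial derivatives converging uniformly to $f$ and its partial derivatives, $\mathcal{E}(f,g)=\lim_n\mathcal{E}(f_n,g)$ and $\mathcal{E}(g,f)=\lim_n\mathcal{E}(g,f_n)$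 for all $g\in C_0^\infty(U)$. Let $(G_\beta)$, $(\hat G_\beta)$ be the resolvent and co-resolvent, and $\sigma_\beta,\hat\sigma_\beta$ the positive Radon measures on $U\times U$ with $(\beta G_\beta u,v)=\int u(x)v(y)\sigma_\beta(dxdy)$, $(\beta\hat G_\beta u,v)=\int u(x)v(y)\hat\sigma_\beta(dxdy)$. $J$ is the jumping measure: the unique positive Radon measure on $U\times U\setminus d$ such that, with a unique positive Radon measure $K$ on $U$, $\mathcal{E}(u,v)=\int_{U\times U\setminus d}2(u(y)-u(x))v(y)J(dxdy)+\int_U uv\,dK$ for $v\in C_0^\infty(U)$ and $u\in C_0^\infty(U)$ constant near $\mathrm{supp}[v]$. $U^\delta:=\{x\in U:\inf_{y\in\partial U}|x-y|>\delta\}$, $\delta>0$ fixed with $U^\delta\ne\emptyset$. Fix relatively compact open $\Omega_l\uparrow U$ and $\varsigma_l\downarrow0$ such that $\Gamma_l:=\{(x,y)\in\Omega_l^2:|x-y|\ge\varsigma_l\}$ is a $J$-continuity set, and $\Lambda_l:=\{(x,y)\in\Omega_l^2:|x-y|<\varsigma_l\}$. Let $\delta_k\ge\delta$, $\delta_k\to\delta$ with $J(\{|x-y|=\delta_k\})=0$. For $u,v\in C_0^\infty(U^\delta)$, $\mathcal{E}^{c,\delta}(u,v):=\lim_{k}\lim_{l}\lim_{\beta\to\infty}\beta\{\int_{\Lambda_l}(u(y)-u(x))v(y)\sigma_\beta(dxdy)+\int_{\Gamma_l}\sum_{i=1}^n(y_i-x_i)\frac{\partial u}{\partial y_i}(y)I_{\{|x-y|\le\delta_k\}}(x,y)v(y)\sigma_\beta(dxdy)\}$,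 and $\hat{\mathcal{E}}^{c,\delta}(u,v)$ is the same with $\hat\sigma_\beta$ in place of $\sigma_\beta$ (the limits exist and do not depend on the choices). For $\varphi,\phi\in C_0^\infty(U)$, $\mu^c_{\langle\varphi,\phi\rangle}$ is the signed Radon measure on $U$ with $\int_U g\,d\mu^c_{\langle\varphi,\phi\rangle}=\lim_{l}\lim_{\beta\to\infty}\beta\int_{\Lambda_l}(\varphi(y)-\varphi(x))(\phi(y)-\phi(x))g(y)\sigma_\beta(dxdy)$ for $g\in C_0^\infty(U)$. For $u,v\in C^\infty(U)$, $\mu^c_{\langle u,v\rangle}$ is the (well-defined) signed Radon measure on $U$ whose restriction to $\Omega_l$ equals $\mu^c_{\langle u_l,v_l\rangle}$ for any $u_l,v_l\in C_0^\infty(U)$ with $u_l=u$, $v_l=v$ on $\Omega_l$. For $u,v\in C_0^\infty(U^\delta)$, $\langle L^\delta(u,v),f\rangle:=\frac12(\mathcal{E}^{c,\delta}(u,vf)-\hat{\mathcal{E}}^{c,\delta}(u,vf))$, $f\in C_0^\infty(U^\delta)$; for $u,v\in C^\infty(U^\delta)$, $\langle L^\delta(u,v),f\rangle:=\lim_l\langle L^\delta(u_l,v_l),f\rangle$, where $V_l\uparrow U^\delta$ are relatively compact open sets and $u_l,v_l\in C_0^\infty(U^\delta)$ with $u_l=u$, $v_l=v$ on $V_l$ (well-defined, independent of choices). $\Phi_{x_i}$ denotes the $i$-th partial derivative of $\Phi$. *)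

theory Defs
  imports "HOL-Analysis.Analysis"
begin

definition tsupp :: "('a::topological_space \<Rightarrow> real) \<Rightarrow> 'a set" where
  "tsupp f = closure {x. f x \<noteq> 0}"

definition pd :: "'a::euclidean_space \<Rightarrow> ('a \<Rightarrow> real) \<Rightarrow> 'a \<Rightarrow> real" where
  "pd b f x = frechet_derivative f (at x) b"

fun hpd :: "'a::euclidean_space list \<Rightarrow> ('a \<Rightarrow> real) \<Rightarrow> 'a \<Rightarrow> real" where
  "hpd [] f = f"
| "hpd (b # bs) f = pd b (hpd bs f)"

definition smooth_on :: "'a::euclidean_space set \<Rightarrow> ('a \<Rightarrow> real) \<Rightarrow> bool" where
  "smooth_on S f \<longleftrightarrow> (\<forall>bs. set bs \<subseteq> Basis \<longrightarrow> (\<forall>x\<in>S. hpd bs f differentiable (at x)))"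

definition test_fun :: "'a::euclidean_space set \<Rightarrow> ('a \<Rightarrow> real) \<Rightarrow> bool" where
  "test_fun S f \<longleftrightarrow> smooth_on S f \<and> compact (tsupp f) \<and> tsupp f \<subseteq> S"

definition cc_fun :: "'a::euclidean_space set \<Rightarrow> ('a \<Rightarrow> real) \<Rightarrow> bool" where
  "cc_fun S f \<longleftrightarrow> continuous_on UNIV f \<and> compact (tsupp f) \<and> tsupp f \<subseteq> S"

definition L2 :: "'a measure \<Rightarrow> ('a \<Rightarrow> real) \<Rightarrow> bool" where
  "L2 M f \<longleftrightarrow> f \<in> borel_measurable M \<and> integrable M (\<lambda>x. (f x)\<^sup>2)"

definition ip :: "'a measure \<Rightarrow> ('a \<Rightarrow> real) \<Rightarrow> ('a \<Rightarrow> real) \<Rightarrow> real" where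
  "ip M f g = (\<integral>x. f x * g x \<partial>M)"

definition l2norm :: "'a measure \<Rightarrow> ('a \<Rightarrow> real) \<Rightarrow> real" where
  "l2norm M f = sqrt (ip M f f)"

definition radon_full_support :: "'a::euclidean_space set \<Rightarrow> 'a measure \<Rightarrow> bool" where
  "radon_full_support U M \<longleftrightarrow>
     sets M = sets borel \<and> emeasure M (- U) = 0 \<and>
     (\<forall>K. compact K \<and> K \<subseteq> U \<longrightarrow> emeasure M K < \<infinity>) \<and>
     (\<forall>x\<in>U. \<forall>e>0. emeasure M (ball x e) > 0)"

definition radon_on :: "'b::euclidean_space set \<Rightarrow> 'b measure \<Rightarrow> bool" where
  "radon_on S N \<longleftrightarrow> sets N = sets borel \<and> emeasure N (- S) = 0 \<and>
     (\<forall>K. compact K \<and> K \<subseteq> S \<longrightarrow> emeasure N K < \<infinity>)"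

definition sc_contr_subMarkov_sg ::
  "'a measure \<Rightarrow> (real \<Rightarrow> ('a \<Rightarrow> real) \<Rightarrow> ('a \<Rightarrow> real)) \<Rightarrow> bool" where
  "sc_contr_subMarkov_sg M T \<longleftrightarrow>
    (\<forall>t\<ge>0. \<forall>f. L2 M f \<longrightarrow> L2 M (T t f)) \<and>
    (\<forall>t\<ge>0. \<forall>f g. L2 M f \<longrightarrow> L2 M g \<longrightarrow> (AE x in M. f x = g x) \<longrightarrow>
        (AE x in M. T t f x = T t g x)) \<and>
    (\<forall>t\<ge>0. \<forall>f g a b. L2 M f \<longrightarrow> L2 M g \<longrightarrow>
        (AE x in M. T t (\<lambda>y. a * f y + b * g y) x = a * T t f x + b * T t g x)) \<and>
    (\<forall>f. L2 M f \<longrightarrow> (AE x in M. T 0 f x = f x)) \<and>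
    (\<forall>s\<ge>0. \<forall>t\<ge>0. \<forall>f. L2 M f \<longrightarrow> (AE x in M. T (s + t) f x = T s (T t f) x)) \<and>
    (\<forall>t\<ge>0. \<forall>f. L2 M f \<longrightarrow> l2norm M (T t f) \<le> l2norm M f) \<and>
    (\<forall>f. L2 M f \<longrightarrow> ((\<lambda>t. l2norm M (\<lambda>x. T t f x - f x)) \<longlongrightarrow> 0) (at_right 0)) \<and>
    (\<forall>t\<ge>0. \<forall>f. L2 M f \<longrightarrow> (AE x in M. 0 \<le> f x \<and> f x \<le> 1) \<longrightarrow>
        (AE x in M. 0 \<le> T t f x \<and> T t f x \<le> 1))"

definition is_generator ::
  "'a measure \<Rightarrow> (real \<Rightarrow> ('a \<Rightarrow> real) \<Rightarrow> ('a \<Rightarrow> real)) \<Rightarrow> ('a \<Rightarrow> real) set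
     \<Rightarrow> (('a \<Rightarrow> real) \<Rightarrow> ('a \<Rightarrow> real)) \<Rightarrow> bool" where
  "is_generator M T DA A \<longleftrightarrow>
    (\<forall>f. f \<in> DA \<longleftrightarrow> L2 M f \<and> (\<exists>g. L2 M g \<and>
        ((\<lambda>t. l2norm M (\<lambda>x. (T t f x - f x) / t - g x)) \<longlongrightarrow> 0) (at_right 0))) \<and>
    (\<forall>f\<in>DA. L2 M (A f) \<and>
        ((\<lambda>t. l2norm M (\<lambda>x. (T t f x - f x) / t - A f x)) \<longlongrightarrow> 0) (at_right 0))"

definition is_adjoint ::
  "'a measure \<Rightarrow> ('a \<Rightarrow> real) set \<Rightarrow> (('a \<Rightarrow> real) \<Rightarrow> ('a \<Rightarrow> real))
     \<Rightarrow> ('a \<Rightarrow> real) set \<Rightarrow> (('a \<Rightarrow> real) \<Rightarrow> ('a \<Rightarrow> real)) \<Rightarrow> bool" where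
  "is_adjoint M DA A DAh Ah \<longleftrightarrow>
    (\<forall>v. v \<in> DAh \<longleftrightarrow> L2 M v \<and> (\<exists>w. L2 M w \<and> (\<forall>u\<in>DA. ip M (A u) v = ip M u w))) \<and>
    (\<forall>v\<in>DAh. L2 M (Ah v) \<and> (\<forall>u\<in>DA. ip M (A u) v = ip M u (Ah v)))"

definition case1 ::
  "'a::euclidean_space set \<Rightarrow> 'a measure \<Rightarrow> (('a \<Rightarrow> real) \<Rightarrow> ('a \<Rightarrow> real) \<Rightarrow> real)
    \<Rightarrow> (real \<Rightarrow> ('a \<Rightarrow> real) \<Rightarrow> ('a \<Rightarrow> real)) \<Rightarrow> (real \<Rightarrow> ('a \<Rightarrow> real) \<Rightarrow> ('a \<Rightarrow> real)) \<Rightarrow> bool"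
  where
  "case1 U M E G Gh \<longleftrightarrow> (\<exists>T DA A DAh Ah.
     sc_contr_subMarkov_sg M T \<and> is_generator M T DA A \<and> is_adjoint M DA A DAh Ah \<and>
     (\<forall>f. test_fun U f \<longrightarrow> f \<in> DA \<and> f \<in> DAh) \<and>
     (\<forall>u v. test_fun U u \<longrightarrow> test_fun U v \<longrightarrow> E u v = ip M (\<lambda>x. - A u x) v) \<and>
     (\<forall>\<beta>>0. \<forall>f. L2 M f \<longrightarrow> G \<beta> f \<in> DA \<and>
        (AE x in M. \<beta> * G \<beta> f x - A (G \<beta> f) x = f x)) \<and>
     (\<forall>\<beta>>0. \<forall>g. L2 M g \<longrightarrow> L2 M (Gh \<beta> g) \<and>
        (\<forall>f. L2 M f \<longrightarrow> ip M (G \<beta> f) g = ip M f (Gh \<beta> g))))"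

definition E1 :: "'a measure \<Rightarrow> (('a \<Rightarrow> real) \<Rightarrow> ('a \<Rightarrow> real) \<Rightarrow> real) \<Rightarrow> ('a \<Rightarrow> real) \<Rightarrow> real" where
  "E1 M E w = E w w + ip M w w"

definition semi_dirichlet_form ::
  "'a measure \<Rightarrow> ('a \<Rightarrow> real) set \<Rightarrow> (('a \<Rightarrow> real) \<Rightarrow> ('a \<Rightarrow> real) \<Rightarrow> real) \<Rightarrow> bool" where
  "semi_dirichlet_form M D E \<longleftrightarrow>
    D \<subseteq> {f. L2 M f} \<and>
    (\<forall>u\<in>D. \<forall>v\<in>D. \<forall>a b. (\<lambda>x. a * u x + b * v x) \<in> D) \<and>
    (\<forall>u\<in>D. \<forall>u'. L2 M u' \<longrightarrow> (AE x in M. u x = u' x) \<longrightarrow> u' \<in> D) \<and>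
    (\<forall>u\<in>D. \<forall>u'\<in>D. \<forall>v\<in>D. (AE x in M. u x = u' x) \<longrightarrow> E u v = E u' v \<and> E v u = E v u') \<and>
    (\<forall>u\<in>D. \<forall>v\<in>D. \<forall>w\<in>D. \<forall>a b.
        E (\<lambda>x. a * u x + b * v x) w = a * E u w + b * E v w \<and>
        E w (\<lambda>x. a * u x + b * v x) = a * E w u + b * E w v) \<and>
    (\<forall>f. L2 M f \<longrightarrow> (\<forall>\<epsilon>>0. \<exists>u\<in>D. l2norm M (\<lambda>x. u x - f x) < \<epsilon>)) \<and>
    (\<forall>u\<in>D. E u u \<ge> 0) \<and>
    (\<exists>K>0. \<forall>u\<in>D. \<forall>v\<in>D.
        \<bar>E u v + ip M u v\<bar> \<le> K * sqrt (E1 M E u) * sqrt (E1 M E v)) \<and>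
    (\<forall>s. (\<forall>n. s n \<in> D) \<longrightarrow>
        (\<forall>\<epsilon>>0. \<exists>N. \<forall>i\<ge>N. \<forall>j\<ge>N. E1 M E (\<lambda>x. s i x - s j x) < \<epsilon>) \<longrightarrow>
        (\<exists>u\<in>D. (\<lambda>n. E1 M E (\<lambda>x. s n x - u x)) \<longlonglongrightarrow> 0)) \<and>
    (\<forall>u\<in>D. (\<lambda>x. min (max (u x) 0) 1) \<in> D \<and>
        E (\<lambda>x. u x + min (max (u x) 0) 1) (\<lambda>x. u x - min (max (u x) 0) 1) \<ge> 0)"

definition case2 ::
  "'a::euclidean_space set \<Rightarrow> 'a measure \<Rightarrow> (('a \<Rightarrow> real) \<Rightarrow> ('a \<Rightarrow> real) \<Rightarrow> real)
    \<Rightarrow> (real \<Rightarrow> ('a \<Rightarrow> real) \<Rightarrow> ('a \<Rightarrow> real)) \<Rightarrow> (real \<Rightarrow> ('a \<Rightarrow> real) \<Rightarrow> ('a \<Rightarrow> real)) \<Rightarrow> bool"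
  where
  "case2 U M E G Gh \<longleftrightarrow> (\<exists>D.
     semi_dirichlet_form M D E \<and>
     (\<forall>f. test_fun U f \<longrightarrow> f \<in> D) \<and>
     (\<forall>Ob. open Ob \<and> compact (closure Ob) \<and> closure Ob \<subseteq> U \<longrightarrow>
        (\<forall>fs f. (\<forall>n. test_fun Ob (fs n)) \<longrightarrow> test_fun Ob f \<longrightarrow>
           (\<forall>bs. set bs \<subseteq> Basis \<longrightarrow> uniform_limit Ob (\<lambda>n. hpd bs (fs n)) (hpd bs f) sequentially) \<longrightarrow>
           (\<forall>g. test_fun U g \<longrightarrow>
              (\<lambda>n. E (fs n) g) \<longlonglongrightarrow> E f g \<and> (\<lambda>n. E g (fs n)) \<longlonglongrightarrow> E g f))) \<and>
     (\<forall>\<beta>>0. \<forall>f. L2 M f \<longrightarrow> G \<beta> f \<in> D \<and>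
        (\<forall>v\<in>D. E (G \<beta> f) v + \<beta> * ip M (G \<beta> f) v = ip M f v)) \<and>
     (\<forall>\<beta>>0. \<forall>f. L2 M f \<longrightarrow> Gh \<beta> f \<in> D \<and>
        (\<forall>v\<in>D. E v (Gh \<beta> f) + \<beta> * ip M v (Gh \<beta> f) = ip M v f)))"

definition resolvent_kernels ::
  "'a::euclidean_space set \<Rightarrow> 'a measure \<Rightarrow> (real \<Rightarrow> ('a \<Rightarrow> real) \<Rightarrow> ('a \<Rightarrow> real))
     \<Rightarrow> (real \<Rightarrow> ('a \<times> 'a) measure) \<Rightarrow> bool" where
  "resolvent_kernels U M G sig \<longleftrightarrow> (\<forall>\<beta>>0. radon_on (U \<times> U) (sig \<beta>) \<and>
     (\<forall>u v. cc_fun U u \<longrightarrow> cc_fun U v \<longrightarrow>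
        ip M (\<lambda>x. \<beta> * G \<beta> u x) v = (\<integral>z. u (fst z) * v (snd z) \<partial>sig \<beta>)))"

definition diag :: "'a set \<Rightarrow> ('a \<times> 'a) set" where
  "diag U = {(x, x) | x. x \<in> U}"

definition const_near :: "('a::topological_space \<Rightarrow> real) \<Rightarrow> 'a set \<Rightarrow> bool" where
  "const_near u S \<longleftrightarrow> (\<exists>W c. open W \<and> S \<subseteq> W \<and> (\<forall>x\<in>W. u x = c))"

definition jumping_measure ::
  "'a::euclidean_space set \<Rightarrow> (('a \<Rightarrow> real) \<Rightarrow> ('a \<Rightarrow> real) \<Rightarrow> real) \<Rightarrow> ('a \<times> 'a) measure \<Rightarrow> bool" where
  "jumping_measure U E J \<longleftrightarrow> radon_on (U \<times> U - diag U) J \<and>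
     (\<exists>K. radon_on U K \<and>
        (\<forall>u v. test_fun U u \<longrightarrow> test_fun U v \<longrightarrow> const_near u (tsupp v) \<longrightarrow>
           E u v = (\<integral>z. 2 * (u (snd z) - u (fst z)) * v (snd z) \<partial>J) + (\<integral>x. u x * v x \<partial>K)))"

definition Lam :: "'a::euclidean_space set \<Rightarrow> real \<Rightarrow> ('a \<times> 'a) set" where
  "Lam Om s = {(x, y). x \<in> Om \<and> y \<in> Om \<and> norm (x - y) < s}"

definition Gam :: "'a::euclidean_space set \<Rightarrow> real \<Rightarrow> ('a \<times> 'a) set" where
  "Gam Om s = {(x, y). x \<in> Om \<and> y \<in> Om \<and> norm (x - y) \<ge> s}"

definition Udelta :: "'a::euclidean_space set \<Rightarrow> real \<Rightarrow> 'a set" where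
  "Udelta U \<delta> = {x \<in> U. ereal \<delta> < (INF y\<in>frontier U. ereal (dist x y))}"

definition admissible_cutoffs ::
  "'a::euclidean_space set \<Rightarrow> ('a \<times> 'a) measure \<Rightarrow> real \<Rightarrow> (nat \<Rightarrow> 'a set) \<Rightarrow> (nat \<Rightarrow> real)
     \<Rightarrow> (nat \<Rightarrow> real) \<Rightarrow> bool" where
  "admissible_cutoffs U J \<delta> Om vs ds \<longleftrightarrow>
     (\<forall>l. open (Om l) \<and> compact (closure (Om l)) \<and> closure (Om l) \<subseteq> U) \<and>
     incseq Om \<and> (\<Union>l. Om l) = U \<and>
     (\<forall>l. vs l > 0) \<and> decseq vs \<and> vs \<longlonglongrightarrow> 0 \<and>
     (\<forall>l. emeasure J (frontier (Gam (Om l) (vs l))) = 0) \<and>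
     (\<forall>k. ds k \<ge> \<delta>) \<and> ds \<longlonglongrightarrow> \<delta> \<and>
     (\<forall>k. emeasure J {z. norm (fst z - snd z) = ds k} = 0)"

text \<open>int g d mu^c_<phi,psi> for phi, psi in C_0^infinity(U).\<close>
definition muc0 ::
  "(real \<Rightarrow> ('a::euclidean_space \<times> 'a) measure) \<Rightarrow> (nat \<Rightarrow> 'a set) \<Rightarrow> (nat \<Rightarrow> real)
     \<Rightarrow> ('a \<Rightarrow> real) \<Rightarrow> ('a \<Rightarrow> real) \<Rightarrow> ('a \<Rightarrow> real) \<Rightarrow> real" where
  "muc0 sig Om vs phi psi g = lim (\<lambda>l. Lim at_top (\<lambda>\<beta>::real. \<beta> *
     (\<integral>z. indicator (Lam (Om l) (vs l)) z *
         ((phi (snd z) - phi (fst z)) * (psi (snd z) - psi (fst z)) * g (snd z)) \<partial>sig \<beta>)))"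

text \<open>int g d mu^c_<u,v> for u, v in C^infinity(U), g in C_0^infinity(U): localisation.\<close>
definition muc ::
  "'a::euclidean_space set \<Rightarrow> (real \<Rightarrow> ('a \<times> 'a) measure) \<Rightarrow> (nat \<Rightarrow> 'a set) \<Rightarrow> (nat \<Rightarrow> real)
     \<Rightarrow> ('a \<Rightarrow> real) \<Rightarrow> ('a \<Rightarrow> real) \<Rightarrow> ('a \<Rightarrow> real) \<Rightarrow> real" where
  "muc U sig Om vs u v g =
     (let (l, ul, vl) = (SOME (l, ul, vl). test_fun U ul \<and> test_fun U vl \<and>
              (\<forall>x\<in>Om l. ul x = u x \<and> vl x = v x) \<and> tsupp g \<subseteq> Om l)
      in muc0 sig Om vs ul vl g)"

definition Ecd ::
  "(real \<Rightarrow> ('a::euclidean_space \<times> 'a) measure) \<Rightarrow> (nat \<Rightarrow> 'a set) \<Rightarrow> (nat \<Rightarrow> real) \<Rightarrow> (nat \<Rightarrow> real)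
     \<Rightarrow> ('a \<Rightarrow> real) \<Rightarrow> ('a \<Rightarrow> real) \<Rightarrow> real" where
  "Ecd sig Om vs ds u v = lim (\<lambda>k. lim (\<lambda>l. Lim at_top (\<lambda>\<beta>::real. \<beta> *
     ((\<integral>z. indicator (Lam (Om l) (vs l)) z * ((u (snd z) - u (fst z)) * v (snd z)) \<partial>sig \<beta>) +
      (\<integral>z. indicator (Gam (Om l) (vs l)) z *
          ((\<Sum>b\<in>Basis. ((snd z - fst z) \<bullet> b) * pd b u (snd z)) *
           indicator {w. norm (fst w - snd w) \<le> ds k} z * v (snd z)) \<partial>sig \<beta>)))))"

text \<open><L^delta(u,v), f> for u, v in C_0^infinity(U^delta).\<close>
definition L0 ::
  "(real \<Rightarrow> ('a::euclidean_space \<times> 'a) measure) \<Rightarrow> (real \<Rightarrow> ('a \<times> 'a) measure) \<Rightarrow> (nat \<Rightarrow> 'a set)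
     \<Rightarrow> (nat \<Rightarrow> real) \<Rightarrow> (nat \<Rightarrow> real) \<Rightarrow> ('a \<Rightarrow> real) \<Rightarrow> ('a \<Rightarrow> real) \<Rightarrow> ('a \<Rightarrow> real) \<Rightarrow> real" where
  "L0 sig sigh Om vs ds u v f =
     (Ecd sig Om vs ds u (\<lambda>x. v x * f x) - Ecd sigh Om vs ds u (\<lambda>x. v x * f x)) / 2"

text \<open><L^delta(u,v), f> for u, v in C^infinity(U^delta): localisation along V_l increasing to U^delta.\<close>
definition Ld ::
  "'a::euclidean_space set \<Rightarrow> real \<Rightarrow> (real \<Rightarrow> ('a \<times> 'a) measure) \<Rightarrow> (real \<Rightarrow> ('a \<times> 'a) measure)
     \<Rightarrow> (nat \<Rightarrow> 'a set) \<Rightarrow> (nat \<Rightarrow> real) \<Rightarrow> (nat \<Rightarrow> real)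
     \<Rightarrow> ('a \<Rightarrow> real) \<Rightarrow> ('a \<Rightarrow> real) \<Rightarrow> ('a \<Rightarrow> real) \<Rightarrow> real" where
  "Ld U \<delta> sig sigh Om vs ds u v f =
     (let (V, ul, vl) = (SOME (V, ul, vl).
            (\<forall>l. open (V l) \<and> compact (closure (V l)) \<and> closure (V l) \<subseteq> Udelta U \<delta>) \<and>
            incseq V \<and> (\<Union>l. V l) = Udelta U \<delta> \<and>
            (\<forall>l. test_fun (Udelta U \<delta>) (ul l) \<and> test_fun (Udelta U \<delta>) (vl l) \<and>
                 (\<forall>x\<in>V l. ul l x = u x \<and> vl l x = v x)))
      in lim (\<lambda>l. L0 sig sigh Om vs ds (ul l) (vl l) f))"

end

theory Submission
  imports Defs
begin

text \<open>
  Resolvent identities give \<open>\<beta> ((u, v) - (\<beta> G\<^sub>\<beta> u, v)) \<longlongrightarrow> E(u, v)\<close> for test functions, so \<open>\<beta> \<integral> H d\<sigma>\<^sub>\<beta>\<close>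
  converges whenever \<open>H\<close> is a sum of products \<open>a(x) b(y)\<close> that vanishes on the diagonal. For such an \<open>H\<close>
  comparable to \<open>|x - y|\<^sup>2\<close> this bounds the second moments of \<open>\<beta> \<sigma>\<^sub>\<beta>\<close>; hence \<open>\<beta> \<sigma>\<^sub>\<beta>\<close> converges to \<open>2 J\<close> not only
  vaguely off the diagonal but also against functions of order \<open>|x - y|\<^sup>3\<close>. Therefore all iterated limits
  exist: they equal \<open>lim \<beta> \<integral> H d\<sigma>\<^sub>\<beta> - 2 \<integral> H dJ\<close> (with a compensator of \<open>H\<close> inside the second integral in the
  case of \<open>Ecd\<close>), which is linear in \<open>H\<close> and vanishes on terms of third order.

  For (i), Taylor's formula makes the difference of the two integrands a term of third order. For (ii) the
  difference is only of second order, but by the trapezoidal rule it is symmetric in \<open>x\<close> and \<open>y\<close> up to third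
  order. Since the co-kernels are the reflections of the kernels, it contributes equally to both halves of
  \<open>L0\<close> and cancels.
\<close>

section \<open>Smooth functions\<close>

text \<open>The limits in the statement are values of \<open>lim\<close> and \<open>Lim\<close>, and
  the extensions to smooth functions are values of \<open>SOME\<close>. Such a value means nothing
  until convergence, or existence and independence of the choice, is proved. Hence convergence has
  to come before linearity, and locality lemmas replace every chosen representative by a convenient
  one. For a term of first or second order at the diagonal, the limit of the scaled kernel integrals
  contains a contribution of the local part of the form, which no integral against \<open>J\<close>
  expresses. It is never computed: it is carried along as an unnamed number \<open>L\<close> and
  disappears by uniqueness of limits from a combination in which it cancels. The kernels need not
  have compact support in the first variable, and the sets \<open>Om l\<close> cut the domain
  sharply. A cutoff \<kappa> in the first variable, equal to 1 near the support of the test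
  function, repairs both: for large \<open>l\<close> the truncation then depends on
  \<open>|x - y|\<close> alone. The factor 2 in front of \<open>J\<close> comes from the
  normalisation of the jumping measure: for disjoint supports \<open>E a b\<close> is
  \<open>- 2\<close> times the \<open>J\<close>-integral of \<open>a(x) b(y)\<close>.\<close>

lemma hpd_cong:
  assumes "open S" "\<And>x. x \<in> S \<Longrightarrow> f x = g x" "x \<in> S"
  shows "hpd bs f x = hpd bs g x"
  using assms(3)
proof (induction bs arbitrary: x)
  case Nil
  then show ?case using assms(2) by simp
next
  case (Cons b bs)
  \<comment> \<open>\<open>frechet_derivative\<close> is a choice among all derivatives and so is
    determined by the predicate \<open>has_derivative\<close>, which is local; the equality holds
    even where no derivative exists.\<close>
  have "(hpd bs f has_derivative D) (at x) \<longleftrightarrow> (hpd bs g has_derivative D) (at x)" for D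
    using has_derivative_transform_within_open[OF _ assms(1) Cons.prems] Cons.IH by metis
  then show ?case by (simp add: pd_def frechet_derivative_def)
qed

lemma pd_cong:
  assumes "open S" "\<And>x. x \<in> S \<Longrightarrow> f x = g x" "x \<in> S"
  shows "pd b f x = pd b g x"
  using hpd_cong[OF assms, where bs = "[b]"] by simp

lemma differentiable_cong_open:
  assumes "open S" "\<And>x. x \<in> S \<Longrightarrow> f x = g x" "x \<in> S" "f differentiable (at x)"
  shows "g differentiable (at x)"
  using assms has_derivative_transform_within_open[of f _ x UNIV S g]
  unfolding differentiable_def by auto

text \<open>Smoothness cut at a finite order, so that product and chain rule can be proved by
  induction: each derivative taken costs one order. The recursion strips the innermost derivative,
  whereas \<open>hpd\<close> adds the outermost one; \<open>hpd_snoc\<close> mediates.\<close>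

fun diff_times :: "nat \<Rightarrow> 'a::euclidean_space set \<Rightarrow> ('a \<Rightarrow> real) \<Rightarrow> bool" where
  "diff_times 0 S f \<longleftrightarrow> (\<forall>x\<in>S. f differentiable (at x))"
| "diff_times (Suc k) S f \<longleftrightarrow> (\<forall>x\<in>S. f differentiable (at x)) \<and> (\<forall>b\<in>Basis. diff_times k S (pd b f))"

lemma hpd_snoc: "hpd (bs @ [b]) f = hpd bs (pd b f)"
  by (induction bs) auto

lemma diff_times_iff:
  "diff_times k S f \<longleftrightarrow> (\<forall>bs. set bs \<subseteq> Basis \<and> length bs \<le> k \<longrightarrow> (\<forall>x\<in>S. hpd bs f differentiable (at x)))"
proof (induction k arbitrary: f)
  case 0
  then show ?case by auto
next
  case (Suc k)
  show ?case
  proof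
    assume L: "diff_times (Suc k) S f"
    show "\<forall>bs. set bs \<subseteq> Basis \<and> length bs \<le> Suc k \<longrightarrow> (\<forall>x\<in>S. hpd bs f differentiable (at x))"
    proof (intro allI impI)
      fix bs assume bs: "set bs \<subseteq> (Basis::'a set) \<and> length bs \<le> Suc k"
      show "\<forall>x\<in>S. hpd bs f differentiable (at x)"
      proof (cases bs rule: rev_cases)
        case Nil
        then show ?thesis using L by simp
      next
        case (snoc cs c)
        then have "diff_times k S (pd c f)" using L bs by simp
        then have "\<forall>x\<in>S. hpd cs (pd c f) differentiable (at x)"
          using bs snoc unfolding Suc.IH by auto
        then show ?thesis by (simp only: snoc hpd_snoc)
      qed
    qed
  next
    assume R: "\<forall>bs. set bs \<subseteq> Basis \<and> length bs \<le> Suc k \<longrightarrow> (\<forall>x\<in>S. hpd bs f differentiable (at x))"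
    have "diff_times k S (pd b f)" if "b \<in> Basis" for b
      unfolding Suc.IH
    proof (intro allI impI)
      fix bs assume "set bs \<subseteq> (Basis::'a set) \<and> length bs \<le> k"
      then show "\<forall>x\<in>S. hpd bs (pd b f) differentiable (at x)"
        using R[THEN spec, of "bs @ [b]"] that unfolding hpd_snoc by simp
    qed
    moreover have "\<forall>x\<in>S. f differentiable (at x)" using R[THEN spec, of "[]"] by simp
    ultimately show "diff_times (Suc k) S f" by simp
  qed
qed

lemma smooth_on_iff: "smooth_on S f \<longleftrightarrow> (\<forall>k. diff_times k S f)"
  unfolding smooth_on_def diff_times_iff by blast

lemma diff_times_0: "diff_times k S f \<Longrightarrow> x \<in> S \<Longrightarrow> f differentiable (at x)"
  by (cases k) auto

lemma diff_times_Suc: "diff_times (Suc k) S f \<Longrightarrow> diff_times k S f"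
  by (auto simp: diff_times_iff)

lemma diff_times_cong:
  assumes "open S" "\<And>x. x \<in> S \<Longrightarrow> f x = g x" "diff_times k S f"
  shows "diff_times k S g"
  using assms(2,3)
proof (induction k arbitrary: f g)
  case 0
  then show ?case using differentiable_cong_open[OF assms(1)] by (metis diff_times.simps(1))
next
  case (Suc k)
  have "diff_times k S (pd b g)" if "b \<in> Basis" for b
    using Suc.IH[of "pd b f" "pd b g"] pd_cong[OF assms(1), of f g] Suc.prems that by auto
  moreover have "\<forall>x\<in>S. g differentiable (at x)"
    using differentiable_cong_open[OF assms(1)] Suc.prems by (metis diff_times.simps(2))
  ultimately show ?case by simp
qed

lemma has_derivative_pd:
  assumes "f differentiable (at x)"
  shows "(f has_derivative (\<lambda>h. \<Sum>b\<in>Basis. (h \<bullet> b) * pd b f x)) (at x)"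
proof -
  have D: "(f has_derivative frechet_derivative f (at x)) (at x)"
    using assms by (simp add: frechet_derivative_works)
  interpret linear "frechet_derivative f (at x)"
    using D has_derivative_linear by blast
  have "frechet_derivative f (at x) h = (\<Sum>b\<in>Basis. (h \<bullet> b) * pd b f x)" for h
  proof -
    have "frechet_derivative f (at x) h = frechet_derivative f (at x) (\<Sum>b\<in>Basis. (h \<bullet> b) *\<^sub>R b)"
      by (simp add: euclidean_representation)
    also have "\<dots> = (\<Sum>b\<in>Basis. (h \<bullet> b) * pd b f x)"
      by (simp add: sum scaleR pd_def)
    finally show ?thesis .
  qed
  then have "frechet_derivative f (at x) = (\<lambda>h. \<Sum>b\<in>Basis. (h \<bullet> b) * pd b f x)" by (rule ext)
  then show ?thesis using D by (simp only:)
qed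

lemma pd_eqI: "(f has_derivative D) (at x) \<Longrightarrow> pd b f x = D b"
  by (simp add: pd_def frechet_derivative_at[symmetric])

lemma diff_times_const: "diff_times k S (\<lambda>x. c)"
proof (induction k arbitrary: c)
  case (Suc k)
  have "pd b (\<lambda>x::'a. c) = (\<lambda>x. 0)" for b
    by (rule ext, rule pd_eqI[where D = "\<lambda>_. 0", simplified]) simp
  then show ?case using Suc by simp
qed simp

lemma diff_times_add:
  assumes "open S" "diff_times k S f" "diff_times k S g"
  shows "diff_times k S (\<lambda>x. f x + g x)"
  using assms(2,3)
proof (induction k arbitrary: f g)
  case (Suc k)
  have "diff_times k S (pd b (\<lambda>x. f x + g x))" if b: "b \<in> Basis" for b
  proof (rule diff_times_cong[OF assms(1), of "\<lambda>x. pd b f x + pd b g x"])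
    show "diff_times k S (\<lambda>x. pd b f x + pd b g x)" using Suc b by auto
    fix x assume "x \<in> S"
    then have "((\<lambda>x. f x + g x) has_derivative (\<lambda>h. (\<Sum>b\<in>Basis. (h \<bullet> b) * pd b f x) + (\<Sum>b\<in>Basis. (h \<bullet> b) * pd b g x))) (at x)"
      using Suc.prems by (intro has_derivative_add has_derivative_pd) auto
    from pd_eqI[OF this, of b]
    show "pd b f x + pd b g x = pd b (\<lambda>x. f x + g x) x"
      using b by (simp add: inner_Basis if_distrib[of "\<lambda>t. t * _"] cong: if_cong)
  qed
  then show ?case using Suc.prems by auto
qed auto

lemma diff_times_mult:
  assumes "open S" "diff_times k S f" "diff_times k S g"
  shows "diff_times k S (\<lambda>x. f x * g x)"
  using assms(2,3)
proof (induction k arbitrary: f g)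
  case (Suc k)
  have "diff_times k S (pd b (\<lambda>x. f x * g x))" if b: "b \<in> Basis" for b
  proof (rule diff_times_cong[OF assms(1), of "\<lambda>x. f x * pd b g x + pd b f x * g x"])
    show "diff_times k S (\<lambda>x. f x * pd b g x + pd b f x * g x)"
      using Suc.prems b diff_times_Suc[OF Suc.prems(1)] diff_times_Suc[OF Suc.prems(2)]
      by (intro diff_times_add[OF assms(1)] Suc.IH) auto
    fix x assume "x \<in> S"
    then have "((\<lambda>x. f x * g x) has_derivative (\<lambda>h. f x * (\<Sum>b\<in>Basis. (h \<bullet> b) * pd b g x) + (\<Sum>b\<in>Basis. (h \<bullet> b) * pd b f x) * g x)) (at x)"
      using Suc.prems by (intro has_derivative_mult has_derivative_pd) auto
    from pd_eqI[OF this, of b]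
    show "f x * pd b g x + pd b f x * g x = pd b (\<lambda>x. f x * g x) x"
      using b by (simp add: inner_Basis if_distrib[of "\<lambda>t. t * _"] cong: if_cong)
  qed
  then show ?case using Suc.prems by auto
qed auto

lemma diff_times_sum:
  assumes "open S" "\<And>i. i \<in> I \<Longrightarrow> diff_times k S (f i)"
  shows "diff_times k S (\<lambda>x. \<Sum>i\<in>I. f i x)"
  using assms(2)
  by (induction I rule: infinite_finite_induct)
     (auto intro: diff_times_const diff_times_add[OF assms(1)])

lemma has_derivative_compose_pd:
  assumes "\<Phi> differentiable (at (u x))" "\<And>c. c \<in> Basis \<Longrightarrow> (\<lambda>x. u x \<bullet> c) differentiable (at x)"
  shows "((\<lambda>x. \<Phi> (u x)) has_derivative
      (\<lambda>h. \<Sum>c\<in>Basis. pd c \<Phi> (u x) * (\<Sum>b\<in>Basis. (h \<bullet> b) * pd b (\<lambda>x. u x \<bullet> c) x))) (at x)"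
proof -
  have u: "(u has_derivative (\<lambda>h. \<Sum>c\<in>Basis. (\<Sum>b\<in>Basis. (h \<bullet> b) * pd b (\<lambda>x. u x \<bullet> c) x) *\<^sub>R c)) (at x)"
    unfolding has_derivative_componentwise_within[of u]
    using has_derivative_pd[OF assms(2)] by (simp add: inner_sum_left_Basis)
  show ?thesis
    using diff_chain_at[OF u has_derivative_pd[OF assms(1)]]
    by (simp add: o_def inner_sum_left_Basis mult.commute)
qed

lemma pd_compose:
  assumes "\<Phi> differentiable (at (u x))" "\<And>c. c \<in> Basis \<Longrightarrow> (\<lambda>x. u x \<bullet> c) differentiable (at x)"
    and "b \<in> Basis"
  shows "pd b (\<lambda>x. \<Phi> (u x)) x = (\<Sum>c\<in>Basis. pd c \<Phi> (u x) * pd b (\<lambda>x. u x \<bullet> c) x)"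
  using pd_eqI[OF has_derivative_compose_pd[OF assms(1,2)], of b] assms(3)
  by (simp add: inner_Basis if_distrib[of "\<lambda>t. t * _"] cong: if_cong)

text \<open>Induction on the order with \<Phi> arbitrary: the derivative is a sum of products of
  \<open>pd c \<Phi>\<close> composed with \<open>u\<close> and derivatives of the components of
  \<open>u\<close>, and the induction hypothesis covers the former.\<close>

lemma diff_times_compose:
  assumes "open S" "diff_times k T \<Phi>" "\<And>c. c \<in> Basis \<Longrightarrow> diff_times k S (\<lambda>x. u x \<bullet> c)"
    and "\<And>x. x \<in> S \<Longrightarrow> u x \<in> T"
  shows "diff_times k S (\<lambda>x. \<Phi> (u x))"
  using assms(2,3)
proof (induction k arbitrary: \<Phi>)
  case 0
  show ?case
    unfolding diff_times.simps
  proof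
    fix x assume "x \<in> S"
    then show "(\<lambda>x. \<Phi> (u x)) differentiable (at x)"
      using has_derivative_compose_pd[of \<Phi> u x] assms(4) 0
      unfolding differentiable_def[of "\<lambda>x. \<Phi> (u x)"] by auto
  qed
next
  case (Suc k)
  have d\<Phi>: "\<Phi> differentiable (at (u x))" if "x \<in> S" for x
    by (rule diff_times_0[OF Suc.prems(1) assms(4)[OF that]])
  have du: "(\<lambda>x. u x \<bullet> c) differentiable (at x)" if "x \<in> S" "c \<in> Basis" for c x
    by (rule diff_times_0[OF Suc.prems(2)[OF that(2)] that(1)])
  have "diff_times k S (pd b (\<lambda>x. \<Phi> (u x)))" if b: "b \<in> Basis" for b
  proof (rule diff_times_cong[OF assms(1), of "\<lambda>x. \<Sum>c\<in>Basis. pd c \<Phi> (u x) * pd b (\<lambda>x. u x \<bullet> c) x"])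
    show "diff_times k S (\<lambda>x. \<Sum>c\<in>Basis. pd c \<Phi> (u x) * pd b (\<lambda>x. u x \<bullet> c) x)"
    proof (intro diff_times_sum[OF assms(1)] diff_times_mult[OF assms(1)])
      fix c :: 'b assume c: "c \<in> Basis"
      show "diff_times k S (\<lambda>x. pd c \<Phi> (u x))"
        using Suc.prems(1) c diff_times_Suc[OF Suc.prems(2)] by (intro Suc.IH[of "pd c \<Phi>"]) simp_all
      show "diff_times k S (pd b (\<lambda>x. u x \<bullet> c))"
        using Suc.prems(2)[OF c] b by simp
    qed
    fix x assume "x \<in> S"
    then show "(\<Sum>c\<in>Basis. pd c \<Phi> (u x) * pd b (\<lambda>x. u x \<bullet> c) x) = pd b (\<lambda>x. \<Phi> (u x)) x"
      using pd_compose[OF d\<Phi> du b] by simp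
  qed
  moreover have "\<forall>x\<in>S. (\<lambda>x. \<Phi> (u x)) differentiable (at x)"
    using has_derivative_compose_pd[OF d\<Phi> du] unfolding differentiable_def by blast
  ultimately show ?case by simp
qed

lemma smooth_on_differentiable: "smooth_on S f \<Longrightarrow> x \<in> S \<Longrightarrow> f differentiable (at x)"
  unfolding smooth_on_iff by (rule diff_times_0[of 0]) auto

lemma smooth_on_pd: "smooth_on S f \<Longrightarrow> b \<in> Basis \<Longrightarrow> smooth_on S (pd b f)"
  unfolding smooth_on_iff by (metis diff_times.simps(2))

lemma smooth_on_subset: "smooth_on S f \<Longrightarrow> T \<subseteq> S \<Longrightarrow> smooth_on T f"
  unfolding smooth_on_def by blast

lemma smooth_on_cong:
  "open S \<Longrightarrow> (\<And>x. x \<in> S \<Longrightarrow> f x = g x) \<Longrightarrow> smooth_on S f \<Longrightarrow> smooth_on S g"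
  unfolding smooth_on_iff by (metis diff_times_cong)

lemma smooth_on_const: "smooth_on S (\<lambda>x. c)"
  unfolding smooth_on_iff by (simp add: diff_times_const)

lemma smooth_on_add: "open S \<Longrightarrow> smooth_on S f \<Longrightarrow> smooth_on S g \<Longrightarrow> smooth_on S (\<lambda>x. f x + g x)"
  unfolding smooth_on_iff by (simp add: diff_times_add)

lemma smooth_on_mult: "open S \<Longrightarrow> smooth_on S f \<Longrightarrow> smooth_on S g \<Longrightarrow> smooth_on S (\<lambda>x. f x * g x)"
  unfolding smooth_on_iff by (simp add: diff_times_mult)

lemma smooth_on_sum:
  "open S \<Longrightarrow> (\<And>i. i \<in> I \<Longrightarrow> smooth_on S (f i)) \<Longrightarrow> smooth_on S (\<lambda>x. \<Sum>i\<in>I. f i x)"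
  unfolding smooth_on_iff by (simp add: diff_times_sum)

lemma smooth_on_diff: "open S \<Longrightarrow> smooth_on S f \<Longrightarrow> smooth_on S g \<Longrightarrow> smooth_on S (\<lambda>x. f x - g x)"
  using smooth_on_add[of S f "\<lambda>x. -1 * g x"] smooth_on_mult[of S "\<lambda>_. -1" g] smooth_on_const by auto

lemma smooth_on_power: "open S \<Longrightarrow> smooth_on S f \<Longrightarrow> smooth_on S (\<lambda>x. f x ^ n)"
  by (induction n) (simp_all add: smooth_on_const smooth_on_mult)

lemma smooth_on_compose:
  assumes "open S" "smooth_on T \<Phi>" "\<And>c. c \<in> Basis \<Longrightarrow> smooth_on S (\<lambda>x. u x \<bullet> c)"
    and "\<And>x. x \<in> S \<Longrightarrow> u x \<in> T"
  shows "smooth_on S (\<lambda>x. \<Phi> (u x))"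
  unfolding smooth_on_iff
proof
  fix k
  show "diff_times k S (\<lambda>x. \<Phi> (u x))"
    using assms(2,3) unfolding smooth_on_iff by (rule_tac diff_times_compose[OF assms(1) _ _ assms(4)]) auto
qed

lemma smooth_on_compose_real:
  fixes u :: "'a::euclidean_space \<Rightarrow> real"
  assumes "open S" "smooth_on T \<Phi>" "smooth_on S u" "\<And>x. x \<in> S \<Longrightarrow> u x \<in> T"
  shows "smooth_on S (\<lambda>x. \<Phi> (u x))"
  by (rule smooth_on_compose[OF assms(1,2)]) (use assms(3,4) in auto)

lemma smooth_on_inner: "smooth_on S (\<lambda>x. x \<bullet> a)"
proof -
  have "diff_times k S (\<lambda>x. x \<bullet> a)" for k
  proof (cases k)
    case (Suc j)
    have "pd b (\<lambda>x. x \<bullet> a) = (\<lambda>_. b \<bullet> a)" for b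
      by (rule ext, rule pd_eqI[where D = "\<lambda>h. h \<bullet> a"]) (auto intro!: derivative_eq_intros)
    then show ?thesis unfolding Suc by (auto simp: diff_times_const intro!: derivative_intros)
  qed (auto intro!: derivative_intros)
  then show ?thesis unfolding smooth_on_iff by blast
qed

lemma smooth_on_local:
  assumes "\<And>x. x \<in> S \<Longrightarrow> \<exists>T. open T \<and> x \<in> T \<and> smooth_on T f"
  shows "smooth_on S f"
  using assms unfolding smooth_on_def by meson

lemma diff_times_real_derivI:
  fixes f f' :: "real \<Rightarrow> real"
  assumes "open S" "\<And>x. x \<in> S \<Longrightarrow> (f has_real_derivative f' x) (at x)" "diff_times k S f'"
  shows "diff_times (Suc k) S f"
proof -
  have "pd 1 f x = f' x" if "x \<in> S" for x
    using pd_eqI[OF assms(2)[OF that, unfolded has_field_derivative_def], of 1] by simp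
  then have "diff_times k S (pd 1 f)"
    using diff_times_cong[OF assms(1) _ assms(3), of "pd 1 f"] by simp
  moreover have "\<forall>x\<in>S. f differentiable (at x)"
    using assms(2) unfolding differentiable_def has_field_derivative_def by blast
  ultimately show ?thesis by simp
qed

text \<open>The claim is strengthened to all powers of the inverse, a family closed under
  differentiation up to constants.\<close>

lemma smooth_on_inverse: "smooth_on {0<..} (inverse :: real \<Rightarrow> real)"
proof -
  have "diff_times k {0<..} (\<lambda>x::real. inverse x ^ n)" for k n
  proof (induction k arbitrary: n)
    case 0
    have "((\<lambda>x::real. inverse x ^ n) differentiable (at x))" if "x > 0" for x :: real
      using that by (intro derivative_intros) auto
    then show ?case by auto
  next
    case (Suc k)
    show ?case
    proof (rule diff_times_real_derivI)
      show "((\<lambda>x. inverse x ^ n) has_real_derivative - real n * (inverse x ^ (n + 1))) (at x)"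
        if "x \<in> {0<..}" for x :: real
        using DERIV_power[OF DERIV_inverse[of x], of n] that by (cases n) (auto simp: algebra_simps)
      show "diff_times k {0<..} (\<lambda>x::real. - real n * inverse x ^ (n + 1))"
        by (intro diff_times_mult diff_times_const Suc.IH) auto
    qed auto
  qed
  from this[of _ 1] show ?thesis unfolding smooth_on_iff by simp
qed

section \<open>Bump functions and cutoffs\<close>

text \<open>The polynomial parameter closes the family under differentiation: with
  \<open>s = 1/t\<close>, the derivative of \<open>p(s) exp(-s)\<close> is
  \<open>s^2 (p(s) - p'(s)) exp(-s)\<close>. For \<open>p = 1\<close> it is the classical flat
  function.\<close>

definition bump_profile :: "real poly \<Rightarrow> real \<Rightarrow> real" where
  "bump_profile p t = (if t > 0 then poly p (inverse t) * exp (- inverse t) else 0)"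

lemma bump_profile_tendsto_0:
  fixes p :: "real poly"
  shows "((\<lambda>t. poly p (inverse t) * exp (- inverse t)) \<longlongrightarrow> 0) (at_right 0)"
proof -
  have "((\<lambda>y. poly p y * exp (- y)) \<longlongrightarrow> (0::real)) at_top"
  proof -
    have "((\<lambda>y. y ^ k * exp (- y)) \<longlongrightarrow> (0::real)) at_top" for k
      using tendsto_power_div_exp_0[of k] by (simp add: exp_minus field_simps)
    then have "((\<lambda>y. \<Sum>k\<le>degree p. coeff p k * (y ^ k * exp (- y))) \<longlongrightarrow> (\<Sum>k\<le>degree p. coeff p k * 0)) at_top"
      by (intro tendsto_sum tendsto_mult tendsto_const)
    then show ?thesis by (simp add: poly_altdef sum_distrib_right mult.assoc)
  qed
  then show ?thesis
    using filterlim_compose[OF _ filterlim_inverse_at_top_right] by (simp add: filterlim_def)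
qed

lemma bump_profile_deriv:
  "(bump_profile p has_real_derivative bump_profile ([:0,0,1:] * (p - pderiv p)) t) (at t)"
proof -
  consider "t > 0" | "t < 0" | "t = 0" by linarith
  then show ?thesis
  proof cases
    case 1
    have "((\<lambda>t. poly p (inverse t) * exp (- inverse t)) has_real_derivative
        bump_profile ([:0,0,1:] * (p - pderiv p)) t) (at t)"
      using 1 unfolding bump_profile_def
      by (auto intro!: derivative_eq_intros DERIV_chain'[OF _ poly_DERIV] simp: field_simps)
    then show ?thesis
      by (rule has_field_derivative_transform_within_open[where S = "{0<..}"])
         (use 1 in \<open>auto simp: bump_profile_def\<close>)
  next
    case 2
    have "((\<lambda>t::real. 0) has_real_derivative bump_profile ([:0,0,1:] * (p - pderiv p)) t) (at t)"
      using 2 by (simp add: bump_profile_def)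
    then show ?thesis
      by (rule has_field_derivative_transform_within_open[where S = "{..<0}"])
         (use 2 in \<open>auto simp: bump_profile_def\<close>)
  next
    case 3
    have "((\<lambda>h. (bump_profile p (0 + h) - bump_profile p 0) / h) \<longlongrightarrow> 0) (at 0)"
      unfolding filterlim_at_split
    proof
      show "((\<lambda>h. (bump_profile p (0 + h) - bump_profile p 0) / h) \<longlongrightarrow> 0) (at_left 0)"
        by (rule tendsto_eventually) (auto simp: eventually_at_left_field bump_profile_def intro!: exI[of _ "-1"])
      \<comment> \<open>Dividing by \<open>h\<close> multiplies the polynomial in \<open>1/h\<close>
        by its variable, so the difference quotient from the right is again of the type that tends
        to 0.\<close>
      have "((\<lambda>t. poly (pCons 0 p) (inverse t) * exp (- inverse t)) \<longlongrightarrow> 0) (at_right 0)"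
        by (rule bump_profile_tendsto_0)
      then show "((\<lambda>h. (bump_profile p (0 + h) - bump_profile p 0) / h) \<longlongrightarrow> 0) (at_right 0)"
        by (rule Lim_transform_eventually)
           (auto simp: eventually_at_right_field bump_profile_def field_simps intro!: exI[of _ 1])
    qed
    then show ?thesis unfolding 3 DERIV_def by (simp add: bump_profile_def)
  qed
qed

lemma smooth_on_bump_profile: "smooth_on UNIV (bump_profile p)"
proof -
  have "diff_times k UNIV (bump_profile p)" for k p
  proof (induction k arbitrary: p)
    case 0
    then show ?case using bump_profile_deriv
      unfolding diff_times.simps differentiable_def has_field_derivative_def by blast
  next
    case (Suc k)
    then show ?case using diff_times_real_derivI[OF open_UNIV bump_profile_deriv] by blast
  qed
  then show ?thesis unfolding smooth_on_iff by blast
qed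

text \<open>The denominator cannot vanish because \<open>t\<close> and \<open>1 - t\<close> are
  never both nonpositive. Being exactly 1 on a half-line, the function yields cutoffs that are
  exactly 1 on open sets.\<close>

definition smooth_step :: "real \<Rightarrow> real" where
  "smooth_step t = bump_profile 1 t * inverse (bump_profile 1 t + bump_profile 1 (1 - t))"

lemma bump_profile_1_nonneg: "0 \<le> bump_profile 1 t"
  and bump_profile_1_pos: "0 < t \<Longrightarrow> 0 < bump_profile 1 t"
  and bump_profile_1_zero: "t \<le> 0 \<Longrightarrow> bump_profile 1 t = 0"
  by (auto simp: bump_profile_def)

lemma smooth_step_denom_pos: "bump_profile 1 t + bump_profile 1 (1 - t) > 0"
  using bump_profile_1_nonneg[of t] bump_profile_1_nonneg[of "1 - t"]
    bump_profile_1_pos[of t] bump_profile_1_pos[of "1 - t"]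
  by (cases "t > 0") auto

lemma smooth_step_eq_0: "t \<le> 0 \<Longrightarrow> smooth_step t = 0"
  and smooth_step_eq_1: "1 \<le> t \<Longrightarrow> smooth_step t = 1"
  using smooth_step_denom_pos[of t] by (auto simp: smooth_step_def bump_profile_1_zero)

lemma smooth_step_nonneg: "0 \<le> smooth_step t"
  unfolding smooth_step_def using smooth_step_denom_pos[of t] bump_profile_1_nonneg[of t] by simp

lemma smooth_step_le_1: "smooth_step t \<le> 1"
  using smooth_step_denom_pos[of t] bump_profile_1_nonneg[of "1 - t"]
  by (simp add: smooth_step_def field_simps)

lemma smooth_on_smooth_step: "smooth_on UNIV smooth_step"
proof -
  have "smooth_on UNIV (\<lambda>t. bump_profile 1 (1 - t))"
    by (rule smooth_on_compose_real[OF _ smooth_on_bump_profile])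
       (use smooth_on_diff[OF open_UNIV smooth_on_const smooth_on_inner[of _ "1::real"], of 1] in auto)
  then have "smooth_on UNIV (\<lambda>t. inverse (bump_profile 1 t + bump_profile 1 (1 - t)))"
    using smooth_step_denom_pos
    by (intro smooth_on_compose_real[OF _ smooth_on_inverse] smooth_on_add smooth_on_bump_profile) auto
  then show ?thesis
    unfolding smooth_step_def by (intro smooth_on_mult smooth_on_bump_profile) auto
qed

lemma tsupp_subsetI: "closed K \<Longrightarrow> (\<And>x. x \<notin> K \<Longrightarrow> f x = 0) \<Longrightarrow> tsupp f \<subseteq> K"
  unfolding tsupp_def by (rule closure_minimal) auto

lemma not_in_tsupp: "x \<notin> tsupp f \<Longrightarrow> f x = 0"
  unfolding tsupp_def using closure_subset[of "{x. f x \<noteq> 0}"] by auto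

lemma closed_tsupp: "closed (tsupp f)"
  unfolding tsupp_def by simp

lemma tsupp_mono: "(\<And>x. g x = 0 \<Longrightarrow> f x = 0) \<Longrightarrow> tsupp f \<subseteq> tsupp g"
  unfolding tsupp_def by (rule closure_mono) auto

lemma tsupp_mult_right: "tsupp (\<lambda>x. f x * g x) \<subseteq> tsupp g"
  by (rule tsupp_mono) simp

lemma test_funI:
  assumes "compact K" "K \<subseteq> S" "\<And>x. x \<notin> K \<Longrightarrow> f x = 0" "smooth_on S f"
  shows "test_fun S f"
proof -
  have "tsupp f \<subseteq> K" using assms by (intro tsupp_subsetI compact_imp_closed)
  then show ?thesis
    using assms compact_Int_closed[OF assms(1) closed_tsupp, of f]
    unfolding test_fun_def by (auto simp: Int_absorb1)
qed

text \<open>A point outside \<open>S\<close> has the open complement of the closed support as a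
  neighbourhood, and there the function is constantly 0.\<close>

lemma smooth_on_extend_zero:
  assumes "open S" "smooth_on S f" "tsupp f \<subseteq> S"
  shows "smooth_on UNIV f"
proof (rule smooth_on_local)
  fix x
  show "\<exists>T. open T \<and> x \<in> T \<and> smooth_on T f"
  proof (cases "x \<in> S")
    case False
    have "smooth_on (- tsupp f) f"
      by (rule smooth_on_cong[OF _ _ smooth_on_const[of _ 0]]) (auto simp: closed_tsupp not_in_tsupp)
    then show ?thesis using False assms(3) closed_tsupp[of f] by (intro exI[of _ "- tsupp f"]) auto
  qed (use assms in auto)
qed

lemma test_fun_smooth: "open S \<Longrightarrow> test_fun S f \<Longrightarrow> smooth_on UNIV f"
  unfolding test_fun_def using smooth_on_extend_zero by blast

lemma smooth_on_continuous: "smooth_on S f \<Longrightarrow> continuous_on S f"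
  by (intro differentiable_imp_continuous_on differentiable_at_imp_differentiable_on smooth_on_differentiable)

lemma test_fun_continuous:
  assumes "open S" "test_fun S f"
  shows "continuous_on T f"
  using smooth_on_continuous[OF test_fun_smooth[OF assms]] continuous_on_subset by blast

lemma test_fun_iff_smooth_UNIV:
  "open S \<Longrightarrow> test_fun S f \<longleftrightarrow> smooth_on UNIV f \<and> compact (tsupp f) \<and> tsupp f \<subseteq> S"
  unfolding test_fun_def using smooth_on_extend_zero smooth_on_subset[of UNIV f S] by blast

lemma test_fun_mult:
  assumes "open S" "test_fun S f" "smooth_on S g"
  shows "test_fun S (\<lambda>x. f x * g x)"
  using assms smooth_on_mult[OF assms(1)] unfolding test_fun_def[of S f]
  by (intro test_funI[of "tsupp f"]) (auto simp: not_in_tsupp)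

lemma test_fun_add: 
  assumes "open S" "test_fun S f" "test_fun S g"
  shows "test_fun S (\<lambda>x. f x + g x)"
  using assms smooth_on_add[OF assms(1)] unfolding test_fun_def[of S f] test_fun_def[of S g]
  by (intro test_funI[of "tsupp f \<union> tsupp g"]) (auto simp: not_in_tsupp)

lemma test_fun_zero: "test_fun S (\<lambda>_. 0)"
  by (rule test_funI[of "{}"]) (auto intro: smooth_on_const)

lemma test_fun_sum:
  assumes "open S" "\<And>i. i \<in> I \<Longrightarrow> test_fun S (f i)"
  shows "test_fun S (\<lambda>x. \<Sum>i\<in>I. f i x)"
  using assms(2)
  by (induction I rule: infinite_finite_induct) (simp_all add: test_fun_zero test_fun_add[OF assms(1)])

lemma test_fun_subset: "S \<subseteq> T \<Longrightarrow> open S \<Longrightarrow> open T \<Longrightarrow> test_fun S f \<Longrightarrow> test_fun T f"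
  by (auto simp: test_fun_iff_smooth_UNIV)

lemma exists_bump:
  fixes x :: "'a::euclidean_space"
  assumes "open S" "x \<in> S"
  obtains \<alpha> where "test_fun S \<alpha>" "\<And>y. 0 \<le> \<alpha> y" "\<alpha> x > 0"
proof -
  obtain r where r: "r > 0" "cball x r \<subseteq> S" using assms open_contains_cball by blast
  \<comment> \<open>The squared distance is written in coordinates because smoothness is at hand for
    coordinate functions and polynomials in them.\<close>
  define \<alpha> where "\<alpha> y = bump_profile 1 (r\<^sup>2 - (\<Sum>b\<in>Basis. (y \<bullet> b - x \<bullet> b)\<^sup>2))" for y
  have nrm: "(\<Sum>b\<in>Basis. (y \<bullet> b - x \<bullet> b)\<^sup>2) = (dist x y)\<^sup>2" for y
    by (subst euclidean_dist_l2) (simp add: L2_set_def sum_nonneg dist_real_def power2_commute)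
  have "smooth_on UNIV \<alpha>"
    unfolding \<alpha>_def
    by (rule smooth_on_compose_real[OF _ smooth_on_bump_profile])
       (auto intro!: smooth_on_diff smooth_on_sum smooth_on_power smooth_on_inner smooth_on_const)
  moreover have "\<alpha> y = 0" if "y \<notin> cball x r" for y
    using that r(1) unfolding \<alpha>_def nrm by (intro bump_profile_1_zero) (auto intro!: power_mono)
  ultimately have "test_fun S \<alpha>"
    using r by (intro test_funI[of "cball x r"]) (auto intro: smooth_on_subset)
  moreover have "\<alpha> x > 0" using r(1) by (auto simp: \<alpha>_def intro: bump_profile_1_pos)
  ultimately show ?thesis using that bump_profile_1_nonneg by (auto simp: \<alpha>_def)
qed

lemma exists_positive_test_fun:
  fixes K :: "'a::euclidean_space set"
  assumes "open S" "compact K" "K \<subseteq> S"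
  obtains \<alpha> where "test_fun S \<alpha>" "\<And>y. 0 \<le> \<alpha> y" "\<And>y. y \<in> K \<Longrightarrow> \<alpha> y > 0"
proof -
  have "\<forall>x\<in>K. \<exists>\<alpha>. test_fun S \<alpha> \<and> (\<forall>y. 0 \<le> \<alpha> y) \<and> \<alpha> x > 0"
    using exists_bump[OF assms(1)] assms(3) by (metis subsetD)
  then obtain A where A: "\<And>x. x \<in> K \<Longrightarrow> test_fun S (A x)" "\<And>x y. x \<in> K \<Longrightarrow> 0 \<le> A x y"
    "\<And>x. x \<in> K \<Longrightarrow> 0 < A x x" by metis
  have "open {y. A x y > 0}" if "x \<in> K" for x
  proof -
    have "continuous_on UNIV (A x)" by (rule test_fun_continuous[OF assms(1) A(1)[OF that]])
    then show ?thesis by (intro open_Collect_less) auto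
  qed
  then obtain C where C: "C \<subseteq> K" "finite C" "K \<subseteq> (\<Union>x\<in>C. {y. A x y > 0})"
    using compactE_image[OF assms(2), of K "\<lambda>x. {y. A x y > 0}"] A(3) by blast
  show ?thesis
  proof (rule that[of "\<lambda>y. \<Sum>x\<in>C. A x y"])
    show "test_fun S (\<lambda>y. \<Sum>x\<in>C. A x y)" using A(1) C(1) by (intro test_fun_sum[OF assms(1)]) auto
    show "0 \<le> (\<Sum>x\<in>C. A x y)" for y using A(2) C(1) by (intro sum_nonneg) auto
    fix y assume "y \<in> K"
    then obtain x where "x \<in> C" "A x y > 0" using C(3) by auto
    then show "(\<Sum>x\<in>C. A x y) > 0" using A(2) C by (intro sum_pos2[of C x]) auto
  qed
qed

lemma exists_cutoff:
  fixes K :: "'a::euclidean_space set"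
  assumes "open S" "compact K" "K \<subseteq> S"
  obtains \<kappa> W where "test_fun S \<kappa>" "\<And>y. 0 \<le> \<kappa> y" "\<And>y. \<kappa> y \<le> 1" "open W" "K \<subseteq> W"
    "\<And>y. y \<in> W \<Longrightarrow> \<kappa> y = 1"
proof -
  obtain \<alpha> where \<alpha>: "test_fun S \<alpha>" "\<And>y. 0 \<le> \<alpha> y" "\<And>y. y \<in> K \<Longrightarrow> \<alpha> y > 0"
    using exists_positive_test_fun[OF assms] by metis
  have cont: "continuous_on T \<alpha>" for T using test_fun_continuous[OF assms(1) \<alpha>(1)] .
  obtain c where c: "c > 0" "\<And>y. y \<in> K \<Longrightarrow> \<alpha> y \<ge> c"
  proof (cases "K = {}")
    case False
    then obtain z where "z \<in> K" "\<And>y. y \<in> K \<Longrightarrow> \<alpha> z \<le> \<alpha> y"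
      using continuous_attains_inf[OF assms(2) _ cont] by auto
    then show ?thesis using that[of "\<alpha> z"] \<alpha>(3) by auto
  qed (use that[of 1] in auto)
  \<comment> \<open>The factor \<open>2 / c\<close> makes the step function equal to 1 wherever
    \<open>\<alpha> y \<ge> c / 2\<close>, hence on an open set around \<open>K\<close> and not only
    on \<open>K\<close>.\<close>
  define \<kappa> where "\<kappa> y = smooth_step (2 / c * \<alpha> y)" for y
  have "smooth_on UNIV \<kappa>" unfolding \<kappa>_def
    by (rule smooth_on_compose_real[OF _ smooth_on_smooth_step])
       (rule smooth_on_mult smooth_on_const test_fun_smooth[OF assms(1) \<alpha>(1)] open_UNIV UNIV_I)+
  then have "test_fun S \<kappa>"
    using \<alpha>(1) smooth_on_subset unfolding test_fun_def[of S \<alpha>]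
    by (intro test_funI[of "tsupp \<alpha>"]) (auto simp: \<kappa>_def not_in_tsupp smooth_step_eq_0)
  moreover have "open {y. \<alpha> y > c / 2}" using cont by (intro open_Collect_less) auto
  ultimately show ?thesis
    using that[of \<kappa> "{y. \<alpha> y > c / 2}"] c
    by (fastforce simp: \<kappa>_def smooth_step_nonneg smooth_step_le_1 field_simps intro!: smooth_step_eq_1)
qed

section \<open>Taylor estimates\<close>

text \<open>The mean value inequality needs segments; these run in the convex hull of
  \<open>K\<close>, which is still compact and on which the partial derivatives are bounded.\<close>

lemma smooth_on_lipschitz:
  fixes f :: "'a::euclidean_space \<Rightarrow> real"
  assumes "smooth_on UNIV f" "compact K"
  obtains C where "C \<ge> 0" "\<And>x y. x \<in> K \<Longrightarrow> y \<in> K \<Longrightarrow> \<bar>f y - f x\<bar> \<le> C * norm (y - x)"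
proof -
  define K' where "K' = convex hull K"
  have cK: "compact K'" "convex K'" "K \<subseteq> K'"
    by (auto simp: K'_def assms(2) compact_convex_hull hull_subset)
  have ct: "continuous_on K' (pd b f)" if "b \<in> Basis" for b
    using continuous_on_subset[OF smooth_on_continuous[OF smooth_on_pd[OF assms(1) that]]] by simp
  have "\<exists>B. \<forall>x\<in>K'. \<bar>pd b f x\<bar> \<le> B" if "b \<in> Basis" for b
    using compact_imp_bounded[OF compact_continuous_image[OF ct[OF that] cK(1)]]
    unfolding bounded_iff by auto
  then obtain B where B: "\<And>b x. b \<in> Basis \<Longrightarrow> x \<in> K' \<Longrightarrow> \<bar>pd b f x\<bar> \<le> B b" by metis
  define C where "C = (\<Sum>b\<in>(Basis::'a set). \<bar>B b\<bar>)"
  show ?thesis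
  proof (rule that[of C])
    show "C \<ge> 0" unfolding C_def by (simp add: sum_nonneg)
    fix x y assume "x \<in> K" "y \<in> K"
    then have xy: "x \<in> K'" "y \<in> K'" using cK by auto
    have "norm (f y - f x) \<le> C * norm (y - x)"
    proof (rule differentiable_bound[OF cK(2) _ _ xy(2,1)])
      fix z assume z: "z \<in> K'"
      show "(f has_derivative (\<lambda>h. \<Sum>b\<in>Basis. (h \<bullet> b) * pd b f z)) (at z within K')"
        using has_derivative_pd[OF smooth_on_differentiable[OF assms(1)]] has_derivative_at_withinI by blast
      show "onorm (\<lambda>h. \<Sum>b\<in>Basis. (h \<bullet> b) * pd b f z) \<le> C"
      proof (rule onorm_le)
        fix h :: 'a
        have "\<bar>\<Sum>b\<in>Basis. (h \<bullet> b) * pd b f z\<bar> \<le> (\<Sum>b\<in>Basis. \<bar>(h \<bullet> b) * pd b f z\<bar>)" by (rule sum_abs)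
        also have "\<dots> \<le> (\<Sum>b\<in>Basis. norm h * \<bar>B b\<bar>)"
        proof (rule sum_mono)
          fix b :: 'a assume b: "b \<in> Basis"
          have "\<bar>pd b f z\<bar> \<le> \<bar>B b\<bar>" using B[OF b z] by linarith
          then show "\<bar>(h \<bullet> b) * pd b f z\<bar> \<le> norm h * \<bar>B b\<bar>"
            unfolding abs_mult by (intro mult_mono Basis_le_norm[OF b]) auto
        qed
        finally show "norm (\<Sum>b\<in>Basis. (h \<bullet> b) * pd b f z) \<le> C * norm h"
          by (simp add: C_def sum_distrib_left mult.commute)
      qed
    qed
    then show "\<bar>f y - f x\<bar> \<le> C * norm (y - x)" by simp
  qed
qed

lemma smooth_on_segment_deriv:
  assumes "smooth_on UNIV f"
  shows "((\<lambda>t. f (x + t *\<^sub>R h)) has_real_derivative (\<Sum>b\<in>Basis. (h \<bullet> b) * pd b f (x + t *\<^sub>R h))) (at t)"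
proof -
  have "((\<lambda>t. x + t *\<^sub>R h) has_derivative (\<lambda>s. s *\<^sub>R h)) (at t)"
    by (auto intro!: derivative_eq_intros)
  from diff_chain_at[OF this has_derivative_pd[OF smooth_on_differentiable[OF assms UNIV_I]]]
  have "((\<lambda>t. f (x + t *\<^sub>R h)) has_derivative (\<lambda>s. \<Sum>b\<in>Basis. (s *\<^sub>R h \<bullet> b) * pd b f (x + t *\<^sub>R h))) (at t)"
    by (simp add: o_def)
  then show ?thesis
    unfolding has_field_derivative_def
    by (rule has_derivative_eq_rhs) (auto simp: sum_distrib_left sum_distrib_right mult_ac)
qed

text \<open>Mean value theorem along the segment, then the derivative is moved from the intermediate
  point to \<open>y\<close> at a Lipschitz cost. The expansion is at \<open>y\<close> because the
  compensator of \<open>Ecd\<close> takes its derivatives there.\<close>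

lemma smooth_on_taylor1:
  fixes f :: "'a::euclidean_space \<Rightarrow> real"
  assumes "smooth_on UNIV f" "compact K"
  obtains C where "C \<ge> 0" "\<And>x y. x \<in> K \<Longrightarrow> y \<in> K \<Longrightarrow>
    \<bar>f y - f x - (\<Sum>b\<in>Basis. ((y - x) \<bullet> b) * pd b f y)\<bar> \<le> C * (norm (y - x))\<^sup>2"
proof -
  define K' where "K' = convex hull K"
  have cK: "compact K'" "convex K'" "K \<subseteq> K'"
    by (auto simp: K'_def assms(2) compact_convex_hull hull_subset)
  have "\<exists>L. L \<ge> 0 \<and> (\<forall>x\<in>K'. \<forall>y\<in>K'. \<bar>pd b f y - pd b f x\<bar> \<le> L * norm (y - x))" if "b \<in> Basis" for b
    using smooth_on_lipschitz[OF smooth_on_pd[OF assms(1) that] cK(1)] by metis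
  then obtain L where L: "\<And>b. b \<in> Basis \<Longrightarrow> L b \<ge> 0"
    "\<And>b x y. b \<in> Basis \<Longrightarrow> x \<in> K' \<Longrightarrow> y \<in> K' \<Longrightarrow> \<bar>pd b f y - pd b f x\<bar> \<le> L b * norm (y - x)" by metis
  show ?thesis
  proof (rule that[of "\<Sum>b\<in>Basis. L b"])
    show "(\<Sum>b\<in>Basis. L b) \<ge> 0" using L(1) by (rule sum_nonneg)
    fix x y assume "x \<in> K" "y \<in> K"
    then have xy: "x \<in> K'" "y \<in> K'" using cK by auto
    define h where "h = y - x"
    obtain s :: real where s: "0 < s" "s < 1" and eq: "f (x + 1 *\<^sub>R h) - f (x + 0 *\<^sub>R h)
        = (1 - 0) * (\<Sum>b\<in>Basis. (h \<bullet> b) * pd b f (x + s *\<^sub>R h))"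
      using MVT2[of 0 1 "\<lambda>t. f (x + t *\<^sub>R h)", OF _ smooth_on_segment_deriv[OF assms(1)]] by auto
    have z: "x + s *\<^sub>R h \<in> K'"
      using convexD_alt[OF cK(2) xy(1,2), of s] s by (simp add: h_def algebra_simps)
    have nz: "norm (x + s *\<^sub>R h - y) \<le> norm h"
    proof -
      have "x + s *\<^sub>R h - y = (s - 1) *\<^sub>R h" by (simp add: h_def algebra_simps)
      then show ?thesis using s by (simp add: mult_left_le_one_le)
    qed
    have "f y - f x - (\<Sum>b\<in>Basis. ((y - x) \<bullet> b) * pd b f y)
        = (\<Sum>b\<in>Basis. (h \<bullet> b) * (pd b f (x + s *\<^sub>R h) - pd b f y))"
      using eq by (simp add: h_def sum_subtractf right_diff_distrib)
    also have "\<bar>\<dots>\<bar> \<le> (\<Sum>b\<in>Basis. \<bar>(h \<bullet> b) * (pd b f (x + s *\<^sub>R h) - pd b f y)\<bar>)" by (rule sum_abs)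
    also have "\<dots> \<le> (\<Sum>b\<in>Basis. norm h * (L b * norm h))"
    proof (rule sum_mono)
      fix b :: 'a assume b: "b \<in> Basis"
      have "\<bar>pd b f (x + s *\<^sub>R h) - pd b f y\<bar> \<le> L b * norm h"
        using L(2)[OF b xy(2) z] mult_left_mono[OF nz L(1)[OF b]] by linarith
      then show "\<bar>(h \<bullet> b) * (pd b f (x + s *\<^sub>R h) - pd b f y)\<bar> \<le> norm h * (L b * norm h)"
        unfolding abs_mult by (intro mult_mono Basis_le_norm[OF b]) auto
    qed
    also have "\<dots> = (\<Sum>b\<in>Basis. L b) * (norm (y - x))\<^sup>2"
      by (simp add: h_def power2_eq_square sum_distrib_right mult_ac)
    finally show "\<bar>f y - f x - (\<Sum>b\<in>Basis. ((y - x) \<bullet> b) * pd b f y)\<bar> \<le> (\<Sum>b\<in>Basis. L b) * (norm (y - x))\<^sup>2" .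
  qed
qed

text \<open>Averaging the derivatives at the two ends cancels the second-order term; what remains is
  controlled by the Lipschitz continuity of the second derivatives.\<close>

lemma smooth_on_trapezoid:
  fixes f :: "'a::euclidean_space \<Rightarrow> real"
  assumes "smooth_on UNIV f" "compact K"
  obtains C where "C \<ge> 0" "\<And>x y. x \<in> K \<Longrightarrow> y \<in> K \<Longrightarrow>
    \<bar>2 * (f y - f x) - (\<Sum>b\<in>Basis. ((y - x) \<bullet> b) * (pd b f x + pd b f y))\<bar> \<le> C * norm (y - x) ^ 3"
proof -
  define K' where "K' = convex hull K"
  have cK: "compact K'" "convex K'" "K \<subseteq> K'"
    by (auto simp: K'_def assms(2) compact_convex_hull hull_subset)
  have sm: "smooth_on UNIV (pd b f)" if "b \<in> Basis" for b by (rule smooth_on_pd[OF assms(1) that])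
  have "\<exists>L. L \<ge> 0 \<and> (\<forall>x\<in>K'. \<forall>y\<in>K'. \<bar>pd c (pd b f) y - pd c (pd b f) x\<bar> \<le> L * norm (y - x))"
    if "b \<in> Basis" "c \<in> Basis" for b c
    using smooth_on_lipschitz[OF smooth_on_pd[OF sm[OF that(1)] that(2)] cK(1)] by metis
  then obtain L where L: "\<And>b c. b \<in> Basis \<Longrightarrow> c \<in> Basis \<Longrightarrow> L b c \<ge> 0"
    "\<And>b c x y. b \<in> Basis \<Longrightarrow> c \<in> Basis \<Longrightarrow> x \<in> K' \<Longrightarrow> y \<in> K' \<Longrightarrow>
      \<bar>pd c (pd b f) y - pd c (pd b f) x\<bar> \<le> L b c * norm (y - x)" by metis
  define C where "C = (\<Sum>b\<in>Basis. \<Sum>c\<in>Basis. L b c)"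
  show ?thesis
  proof (rule that[of C])
    show "C \<ge> 0" unfolding C_def using L(1) by (intro sum_nonneg) auto
    fix x y assume "x \<in> K" "y \<in> K"
    then have xy: "x \<in> K'" "y \<in> K'" using cK by auto
    define h where "h = y - x"
    define q1 where "q1 t = (\<Sum>b\<in>Basis. (h \<bullet> b) * pd b f (x + t *\<^sub>R h))" for t
    define q2 where "q2 t = (\<Sum>b\<in>Basis. (h \<bullet> b) * (\<Sum>c\<in>Basis. (h \<bullet> c) * pd c (pd b f) (x + t *\<^sub>R h)))" for t
    have dq1: "(q1 has_real_derivative q2 t) (at t)" for t
      unfolding q1_def q2_def
      by (intro DERIV_sum DERIV_cmult smooth_on_segment_deriv sm)
    have dq: "((\<lambda>t. f (x + t *\<^sub>R h)) has_real_derivative q1 t) (at t)" for t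
      unfolding q1_def by (rule smooth_on_segment_deriv[OF assms(1)])
    \<comment> \<open>The error of the trapezoidal rule up to time \<open>t\<close>. Its derivative
      at \<open>s\<close> equals \<open>s * (q2 \<xi> - q2 s)\<close> by a second use of the mean
      value theorem, and this difference supplies the third factor \<open>norm h\<close>.\<close>
    define r where "r t = 2 * (f (x + t *\<^sub>R h) - f x) - t * (q1 0 + q1 t)" for t
    have dr: "(r has_real_derivative (q1 t - q1 0 - t * q2 t)) (at t)" for t
      unfolding r_def by (auto intro!: derivative_eq_intros dq dq1 simp: algebra_simps)
    obtain s :: real where s: "0 < s" "s < 1" and eq: "r 1 - r 0 = (1 - 0) * (q1 s - q1 0 - s * q2 s)"
      using MVT2[of 0 1 r, OF _ dr] by auto
    obtain \<xi> where \<xi>: "0 < \<xi>" "\<xi> < s" and eq1: "q1 s - q1 0 = (s - 0) * q2 \<xi>"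
      using MVT2[of 0 s q1, OF _ dq1] s by auto
    have seg: "x + t *\<^sub>R h \<in> K'" if "0 \<le> t" "t \<le> 1" for t
      using convexD_alt[OF cK(2) xy(1,2), of t] that by (simp add: h_def algebra_simps)
    have "r 1 - r 0 = s * (q2 \<xi> - q2 s)" using eq eq1 by (simp add: algebra_simps)
    also have "\<bar>\<dots>\<bar> \<le> 1 * \<bar>q2 \<xi> - q2 s\<bar>"
      using s unfolding abs_mult by (intro mult_right_mono) auto
    also have "q2 \<xi> - q2 s = (\<Sum>b\<in>Basis. \<Sum>c\<in>Basis. (h \<bullet> b) * ((h \<bullet> c) *
        (pd c (pd b f) (x + \<xi> *\<^sub>R h) - pd c (pd b f) (x + s *\<^sub>R h))))"
      unfolding q2_def by (simp add: sum_subtractf right_diff_distrib sum_distrib_left)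
    also have "1 * \<bar>\<dots>\<bar> \<le> (\<Sum>b\<in>Basis. \<Sum>c\<in>Basis. norm h * (norm h * (L b c * norm h)))"
      unfolding mult_1
    proof (rule order_trans[OF sum_abs sum_mono], rule order_trans[OF sum_abs sum_mono])
      fix b c :: 'a assume b: "b \<in> Basis" and c: "c \<in> Basis"
      have "(x + \<xi> *\<^sub>R h) - (x + s *\<^sub>R h) = (\<xi> - s) *\<^sub>R h" by (simp add: algebra_simps)
      then have "norm ((x + \<xi> *\<^sub>R h) - (x + s *\<^sub>R h)) \<le> norm h"
        using \<xi> s by (simp add: mult_left_le_one_le)
      then have "\<bar>pd c (pd b f) (x + \<xi> *\<^sub>R h) - pd c (pd b f) (x + s *\<^sub>R h)\<bar> \<le> L b c * norm h"
        using L(2)[OF b c seg seg, of s \<xi>] mult_left_mono[OF _ L(1)[OF b c]] \<xi> s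
        by (meson less_imp_le less_trans order_trans)
      then show "\<bar>(h \<bullet> b) * ((h \<bullet> c) * (pd c (pd b f) (x + \<xi> *\<^sub>R h) - pd c (pd b f) (x + s *\<^sub>R h)))\<bar>
          \<le> norm h * (norm h * (L b c * norm h))"
        unfolding abs_mult by (intro mult_mono Basis_le_norm b c) auto
    qed
    also have "\<dots> = C * norm (y - x) ^ 3"
      unfolding C_def h_def power3_eq_cube sum_distrib_right by (simp add: mult_ac)
    also have "r 1 - r 0 = 2 * (f y - f x) - (\<Sum>b\<in>Basis. ((y - x) \<bullet> b) * (pd b f x + pd b f y))"
      by (simp add: r_def q1_def h_def sum.distrib distrib_left)
    finally show "\<bar>2 * (f y - f x) - (\<Sum>b\<in>Basis. ((y - x) \<bullet> b) * (pd b f x + pd b f y))\<bar> \<le> C * norm (y - x) ^ 3" .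
  qed
qed

section \<open>Convergence of the approximating forms\<close>

lemma integrable_compact_support:
  fixes H :: "'b::euclidean_space \<Rightarrow> real"
  assumes "radon_on S N" "continuous_on UNIV H" "compact (tsupp H)" "tsupp H \<subseteq> S"
  shows "integrable N H"
proof -
  have sN: "sets N = sets borel" and fin: "emeasure N (tsupp H) < \<infinity>"
    using assms unfolding radon_on_def by auto
  have "bounded (H ` tsupp H)"
    using assms(2,3) by (intro compact_imp_bounded compact_continuous_image) (auto intro: continuous_on_subset)
  then obtain B where B: "\<And>x. x \<in> tsupp H \<Longrightarrow> \<bar>H x\<bar> \<le> B" unfolding bounded_iff by auto
  show ?thesis
  proof (rule Bochner_Integration.integrable_bound)
    show "integrable N (\<lambda>x. B * indicator (tsupp H) x)"
      using fin sN assms(3) by (intro integrable_mult_right integrable_real_indicator) (auto intro: borel_compact)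
    show "H \<in> borel_measurable N"
      using borel_measurable_continuous_onI[OF assms(2)] by (simp cong: measurable_cong_sets add: sN)
    show "AE x in N. norm (H x) \<le> norm (B * indicator (tsupp H) x)"
      using B by (intro AE_I2) (fastforce simp: indicator_def not_in_tsupp)
  qed
qed

lemma quadratic_nonneg_discriminant:
  fixes a b c :: real
  assumes "\<And>t. a + 2 * t * b + t\<^sup>2 * c \<ge> 0" "c \<ge> 0"
  shows "b\<^sup>2 \<le> a * c"
proof (cases "c = 0")
  case True
  have "b = 0"
  proof (rule ccontr)
    assume "b \<noteq> 0"
    \<comment> \<open>This \<open>t\<close> makes the expression, linear in \<open>t\<close> when
      \<open>c = 0\<close>, equal to -1.\<close>
    then show False using assms(1)[of "- (a + 1) / (2 * b)"] True by (simp add: field_simps)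
  qed
  then show ?thesis using True by simp
next
  case False
  then show ?thesis using assms(1)[of "- b / c"] assms(2)
    by (simp add: field_simps power2_eq_square)
qed

section \<open>Square-integrable functions as a semi-inner-product space\<close>

context
  fixes M :: "'a measure"
begin

lemma L2_mult_integrable:
  assumes "L2 M f" "L2 M g"
  shows "integrable M (\<lambda>x. f x * g x)"
proof (rule Bochner_Integration.integrable_bound)
  show "integrable M (\<lambda>x. (f x)\<^sup>2 + (g x)\<^sup>2)" using assms by (auto simp: L2_def)
  show "(\<lambda>x. f x * g x) \<in> borel_measurable M" using assms by (auto simp: L2_def)
  have "\<bar>a * b\<bar> \<le> a\<^sup>2 + b\<^sup>2" for a b :: real
    using sum_squares_bound[of "\<bar>a\<bar>" "\<bar>b\<bar>"] mult_nonneg_nonneg[of "\<bar>a\<bar>" "\<bar>b\<bar>"]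
    by (simp add: abs_mult del: mult_nonneg_nonneg)
  then show "AE x in M. norm (f x * g x) \<le> norm ((f x)\<^sup>2 + (g x)\<^sup>2)" by (intro AE_I2) simp
qed

lemma L2_lincomb:
  assumes "L2 M f" "L2 M g"
  shows "L2 M (\<lambda>x. a * f x + b * g x)"
proof -
  have "integrable M (\<lambda>x. a\<^sup>2 * (f x)\<^sup>2 + b\<^sup>2 * (g x)\<^sup>2 + 2 * a * b * (f x * g x))"
    using assms L2_mult_integrable[OF assms]
    by (intro Bochner_Integration.integrable_add integrable_mult_right) (auto simp: L2_def)
  moreover have "(a * f x + b * g x)\<^sup>2 = a\<^sup>2 * (f x)\<^sup>2 + b\<^sup>2 * (g x)\<^sup>2 + 2 * a * b * (f x * g x)" for x
    by (simp add: power2_eq_square algebra_simps)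
  ultimately show ?thesis using assms by (auto simp: L2_def)
qed

lemma L2_cmult: "L2 M f \<Longrightarrow> L2 M (\<lambda>x. a * f x)"
  using L2_lincomb[of f f a 0] by simp

lemma L2_diff: "L2 M f \<Longrightarrow> L2 M g \<Longrightarrow> L2 M (\<lambda>x. f x - g x)"
  using L2_lincomb[of f g 1 "-1"] by simp

lemma ip_lincomb:
  assumes "L2 M f" "L2 M g" "L2 M h"
  shows "ip M (\<lambda>x. a * f x + b * g x) h = a * ip M f h + b * ip M g h"
proof -
  have "ip M (\<lambda>x. a * f x + b * g x) h = (\<integral>x. a * (f x * h x) + b * (g x * h x) \<partial>M)"
    unfolding ip_def by (rule Bochner_Integration.integral_cong) (auto simp: algebra_simps)
  then show ?thesis
    using L2_mult_integrable[OF assms(1,3)] L2_mult_integrable[OF assms(2,3)] by (simp add: ip_def)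
qed

lemma ip_commute: "ip M f g = ip M g f"
  unfolding ip_def by (simp add: mult.commute)

lemma ip_cmult: "ip M (\<lambda>x. a * f x) h = a * ip M f h"
  unfolding ip_def by (simp add: mult.assoc)

lemma ip_diff: "L2 M f \<Longrightarrow> L2 M g \<Longrightarrow> L2 M h \<Longrightarrow> ip M (\<lambda>x. f x - g x) h = ip M f h - ip M g h"
  using ip_lincomb[of f g h 1 "-1"] by simp

lemma ip_lincomb_self:
  assumes "L2 M f" "L2 M g"
  shows "ip M (\<lambda>x. a * f x + b * g x) (\<lambda>x. a * f x + b * g x)
    = a\<^sup>2 * ip M f f + 2 * a * b * ip M f g + b\<^sup>2 * ip M g g"
proof -
  define S where "S = (\<lambda>x. a * f x + b * g x)"
  have S: "ip M S h = a * ip M f h + b * ip M g h" if "L2 M h" for h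
    unfolding S_def by (rule ip_lincomb[OF assms that])
  have "ip M S S = a * ip M f S + b * ip M g S"
    by (rule S) (simp add: S_def L2_lincomb assms)
  also have "ip M f S = a * ip M f f + b * ip M f g"
    using S[OF assms(1)] ip_commute[of f S] ip_commute[of f g] by simp
  also have "ip M g S = a * ip M f g + b * ip M g g"
    using S[OF assms(2)] ip_commute[of g S] by simp
  finally show ?thesis unfolding S_def by (simp add: power2_eq_square algebra_simps)
qed

lemma ip_self_nonneg: "0 \<le> ip M f f"
  unfolding ip_def by (rule integral_nonneg_AE) auto

lemma ip_cong_AE:
  assumes "L2 M f" "L2 M g" "L2 M h" "AE x in M. f x = g x"
  shows "ip M f h = ip M g h"
  unfolding ip_def using assms by (intro integral_cong_AE) (auto simp: L2_def)

lemma ip_Cauchy_Schwarz: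
  assumes "L2 M f" "L2 M g"
  shows "\<bar>ip M f g\<bar> \<le> l2norm M f * l2norm M g"
proof -
  have "(ip M f g)\<^sup>2 \<le> ip M f f * ip M g g"
  proof (rule quadratic_nonneg_discriminant)
    fix t
    have "0 \<le> ip M (\<lambda>x. 1 * f x + t * g x) (\<lambda>x. 1 * f x + t * g x)" by (rule ip_self_nonneg)
    also have "\<dots> = ip M f f + 2 * t * ip M f g + t\<^sup>2 * ip M g g"
      using ip_lincomb_self[OF assms, of 1 t] by simp
    finally show "0 \<le> ip M f f + 2 * t * ip M f g + t\<^sup>2 * ip M g g" .
  qed (rule ip_self_nonneg)
  then have "sqrt ((ip M f g)\<^sup>2) \<le> sqrt (ip M f f * ip M g g)" by (rule real_sqrt_le_mono)
  then show ?thesis by (simp add: l2norm_def real_sqrt_mult)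
qed

lemma l2norm_nonneg: "0 \<le> l2norm M f"
  unfolding l2norm_def using ip_self_nonneg by simp

lemma l2norm_squared: "(l2norm M f)\<^sup>2 = ip M f f"
  unfolding l2norm_def using ip_self_nonneg by simp

lemma l2norm_triangle:
  assumes "L2 M f" "L2 M g"
  shows "l2norm M (\<lambda>x. f x + g x) \<le> l2norm M f + l2norm M g"
proof (rule power2_le_imp_le)
  have "ip M (\<lambda>x. f x + g x) (\<lambda>x. f x + g x) = ip M f f + 2 * ip M f g + ip M g g"
    using ip_lincomb_self[OF assms, of 1 1] by simp
  also have "\<dots> \<le> (l2norm M f + l2norm M g)\<^sup>2"
    using ip_Cauchy_Schwarz[OF assms] by (simp add: power2_sum l2norm_squared)
  finally show "(l2norm M (\<lambda>x. f x + g x))\<^sup>2 \<le> (l2norm M f + l2norm M g)\<^sup>2"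
    by (simp add: l2norm_squared)
qed (simp add: l2norm_nonneg)

lemma l2norm_cmult: "l2norm M (\<lambda>x. a * f x) = \<bar>a\<bar> * l2norm M f"
proof -
  have "ip M (\<lambda>x. a * f x) (\<lambda>x. a * f x) = a\<^sup>2 * ip M f f"
    unfolding ip_def by (simp add: power2_eq_square mult_ac)
  then show ?thesis by (simp add: l2norm_def real_sqrt_mult)
qed

lemma l2norm_zero_AE:
  assumes "L2 M f" "l2norm M f = 0"
  shows "AE x in M. f x = 0"
proof -
  have "(\<integral>x. (f x)\<^sup>2 \<partial>M) = 0" using assms(2) by (simp add: l2norm_def ip_def power2_eq_square)
  then have "AE x in M. (f x)\<^sup>2 = 0"
    using assms(1) by (subst (asm) integral_nonneg_eq_0_iff_AE) (auto simp: L2_def)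
  then show ?thesis by simp
qed

end

context
  fixes U :: "'a::euclidean_space set" and M :: "'a measure"
  assumes U: "open U" and M: "radon_full_support U M"
begin

lemma radon_full_support_radon_on: "radon_on U M"
  using M unfolding radon_full_support_def radon_on_def by auto

lemma test_fun_L2:
  assumes "test_fun U f"
  shows "L2 M f"
proof -
  have c: "continuous_on UNIV f" by (rule test_fun_continuous[OF U assms])
  have "sets M = sets borel" using M by (simp add: radon_full_support_def)
  then have "f \<in> borel_measurable M"
    using borel_measurable_continuous_onI[OF c] by (simp cong: measurable_cong_sets)
  moreover have "integrable M (\<lambda>x. (f x)\<^sup>2)"
  proof (rule integrable_compact_support[OF radon_full_support_radon_on])
    have "tsupp (\<lambda>x. (f x)\<^sup>2) \<subseteq> tsupp f" by (rule tsupp_mono) auto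
    then show "compact (tsupp (\<lambda>x. (f x)\<^sup>2))" "tsupp (\<lambda>x. (f x)\<^sup>2) \<subseteq> U"
      using assms compact_Int_closed[OF _ closed_tsupp[of "\<lambda>x. (f x)\<^sup>2"]]
      unfolding test_fun_def by (metis inf.absorb2, blast)
    show "continuous_on UNIV (\<lambda>x. (f x)\<^sup>2)" using c by (intro continuous_intros)
  qed
  ultimately show ?thesis by (simp add: L2_def)
qed

end

section \<open>Weak convergence for semi-Dirichlet forms\<close>

lemma semi_dirichlet_formD:
  assumes "semi_dirichlet_form M D E"
  shows "u \<in> D \<Longrightarrow> L2 M u"
    and "u \<in> D \<Longrightarrow> v \<in> D \<Longrightarrow> (\<lambda>x. a * u x + b * v x) \<in> D"
    and "u \<in> D \<Longrightarrow> u' \<in> D \<Longrightarrow> v \<in> D \<Longrightarrow> (AE x in M. u x = u' x) \<Longrightarrow> E u v = E u' v"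
    and "u \<in> D \<Longrightarrow> v \<in> D \<Longrightarrow> w \<in> D \<Longrightarrow> E (\<lambda>x. a * u x + b * v x) w = a * E u w + b * E v w"
    and "u \<in> D \<Longrightarrow> v \<in> D \<Longrightarrow> w \<in> D \<Longrightarrow> E w (\<lambda>x. a * u x + b * v x) = a * E w u + b * E w v"
    and "u \<in> D \<Longrightarrow> 0 \<le> E u u"
    and "\<exists>K>0. \<forall>u\<in>D. \<forall>v\<in>D. \<bar>E u v + ip M u v\<bar> \<le> K * sqrt (E1 M E u) * sqrt (E1 M E v)"
    and "(\<And>n. s n \<in> D) \<Longrightarrow> (\<And>\<epsilon>. \<epsilon> > 0 \<Longrightarrow> \<exists>N. \<forall>i\<ge>N. \<forall>j\<ge>N. E1 M E (\<lambda>x. s i x - s j x) < \<epsilon>) \<Longrightarrow>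
        \<exists>u\<in>D. (\<lambda>n. E1 M E (\<lambda>x. s n x - u x)) \<longlonglongrightarrow> 0"
proof -
  note s1 = assms[unfolded semi_dirichlet_form_def]
  note s2 = s1[THEN conjunct2] note s3 = s2[THEN conjunct2] note s4 = s3[THEN conjunct2]
  note s5 = s4[THEN conjunct2] note s6 = s5[THEN conjunct2] note s7 = s6[THEN conjunct2]
  note s8 = s7[THEN conjunct2] note s9 = s8[THEN conjunct2]
  show "u \<in> D \<Longrightarrow> L2 M u" using s1[THEN conjunct1] by auto
  show "u \<in> D \<Longrightarrow> v \<in> D \<Longrightarrow> (\<lambda>x. a * u x + b * v x) \<in> D" by (rule s2[THEN conjunct1, rule_format])
  show "u \<in> D \<Longrightarrow> u' \<in> D \<Longrightarrow> v \<in> D \<Longrightarrow> (AE x in M. u x = u' x) \<Longrightarrow> E u v = E u' v"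
    by (rule s4[THEN conjunct1, rule_format, THEN conjunct1])
  show "u \<in> D \<Longrightarrow> v \<in> D \<Longrightarrow> w \<in> D \<Longrightarrow> E (\<lambda>x. a * u x + b * v x) w = a * E u w + b * E v w"
    by (rule s5[THEN conjunct1, rule_format, THEN conjunct1])
  show "u \<in> D \<Longrightarrow> v \<in> D \<Longrightarrow> w \<in> D \<Longrightarrow> E w (\<lambda>x. a * u x + b * v x) = a * E w u + b * E w v"
    by (rule s5[THEN conjunct1, rule_format, THEN conjunct2])
  show "u \<in> D \<Longrightarrow> 0 \<le> E u u" by (rule s7[THEN conjunct1, rule_format])
  show "\<exists>K>0. \<forall>u\<in>D. \<forall>v\<in>D. \<bar>E u v + ip M u v\<bar> \<le> K * sqrt (E1 M E u) * sqrt (E1 M E v)"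
    by (rule s8[THEN conjunct1])
  show "(\<And>n. s n \<in> D) \<Longrightarrow> (\<And>\<epsilon>. \<epsilon> > 0 \<Longrightarrow> \<exists>N. \<forall>i\<ge>N. \<forall>j\<ge>N. E1 M E (\<lambda>x. s i x - s j x) < \<epsilon>) \<Longrightarrow>
        \<exists>u\<in>D. (\<lambda>n. E1 M E (\<lambda>x. s n x - u x)) \<longlonglongrightarrow> 0"
    using s9[THEN conjunct1, THEN spec, of s] by blast
qed

text \<open>A Mazur-type argument: the convex sets of elements that are small in the square norm but large
  for the functional have nearly energy-minimal elements forming a Cauchy sequence.\<close>

lemma semi_dirichlet_weak_convergence:
  assumes sd: "semi_dirichlet_form M D E" and v: "v \<in> D"
    and w: "\<And>t. w t \<in> D" and bd: "eventually (\<lambda>t. E1 M E (w t) \<le> C) F"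
    and l2: "((\<lambda>t. l2norm M (w t)) \<longlongrightarrow> 0) F"
  shows "((\<lambda>t. E (w t) v) \<longlongrightarrow> 0) F"
proof -
  define A where "A x y = E x y + ip M x y" for x y
  define B where "B x = E1 M E x" for x
  note sdD = semi_dirichlet_formD[OF sd]
  note DL = sdD(1) and Dlin = sdD(2) and Elin1 = sdD(4) and Elin2 = sdD(5)
  have Alin1: "A (\<lambda>z. a * x z + b * y z) u = a * A x u + b * A y u"
    if "x \<in> D" "y \<in> D" "u \<in> D" for x y u a b
    unfolding A_def using Elin1[OF that] ip_lincomb[of M x y u a b] DL that by (simp add: algebra_simps)
  have Alin2: "A u (\<lambda>z. a * x z + b * y z) = a * A u x + b * A u y"
    if "x \<in> D" "y \<in> D" "u \<in> D" for x y u a b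
    unfolding A_def using Elin2[OF that] ip_lincomb[of M x y u a b] DL that
    by (simp add: algebra_simps ip_commute[of M u])
  have BA: "B x = A x x" for x by (simp add: A_def B_def E1_def)
  have Bip: "ip M x x \<le> B x" if "x \<in> D" for x using sdD(6)[OF that] by (simp add: B_def E1_def)
  have B0: "0 \<le> B x" if "x \<in> D" for x using Bip[OF that] ip_self_nonneg[of M x] by linarith
  obtain K where K: "K > 0" "\<And>x y. x \<in> D \<Longrightarrow> y \<in> D \<Longrightarrow> \<bar>A x y\<bar> \<le> K * sqrt (B x) * sqrt (B y)"
    using sdD(7) unfolding A_def B_def by blast
  \<comment> \<open>The form need not be symmetric, but the parallelogram law involves its diagonal
    alone: the cross terms \<open>A x y + A y x\<close> enter sum and difference with opposite
    signs.\<close>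
  have par: "B (\<lambda>z. x z - y z) = 2 * B x + 2 * B y - 4 * B (\<lambda>z. 1/2 * x z + 1/2 * y z)"
    if "x \<in> D" "y \<in> D" for x y
  proof -
    have quad: "B (\<lambda>z. a * x z + b * y z) = a\<^sup>2 * B x + b\<^sup>2 * B y + a * b * (A x y + A y x)" for a b
      unfolding BA using that Dlin[OF that, of a b]
      by (simp add: Alin1 Alin2 power2_eq_square algebra_simps)
    show ?thesis using quad[of 1 "-1"] quad[of "1/2" "1/2"] by (simp add: power2_eq_square field_simps)
  qed
  have main: "((\<lambda>t. A (w t) v) \<longlongrightarrow> 0) F"
  proof (rule ccontr)
    assume "\<not> ((\<lambda>t. A (w t) v) \<longlongrightarrow> 0) F"
    then obtain e where e: "e > 0" "\<not> eventually (\<lambda>t. \<bar>A (w t) v\<bar> < e) F"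
      unfolding tendsto_iff by (auto simp: dist_real_def)
    \<comment> \<open>Midpoints stay in \<open>S N\<close>, since the functional is linear and the
      norm convex. If the claim fails, each \<open>S N\<close> contains an element of energy at most
      \<open>C\<close>.\<close>
    define S where "S N = {z \<in> D. A z v \<ge> e \<and> l2norm M z \<le> 1 / real (Suc N)}" for N
    have SC: "\<exists>z\<in>S N. B z \<le> C" for N
    proof -
      have "eventually (\<lambda>t. l2norm M (w t) < 1 / real (Suc N)) F"
        using order_tendstoD(2)[OF l2, of "1 / real (Suc N)"] by simp
      then have ev: "eventually (\<lambda>t. B (w t) \<le> C \<and> l2norm M (w t) < 1 / real (Suc N)) F"
        using bd unfolding B_def by eventually_elim auto
      then obtain t where t: "B (w t) \<le> C" "l2norm M (w t) < 1 / real (Suc N)" "\<bar>A (w t) v\<bar> \<ge> e"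
      proof -
        have "\<exists>t. (B (w t) \<le> C \<and> l2norm M (w t) < 1 / real (Suc N)) \<and> \<not> \<bar>A (w t) v\<bar> < e"
        proof (rule ccontr)
          assume "\<not> ?thesis"
          then have "eventually (\<lambda>t. \<bar>A (w t) v\<bar> < e) F" by (intro eventually_mono[OF ev]) blast
          then show False using e(2) by blast
        qed
        then show ?thesis using that by (auto simp: not_less)
      qed
      \<comment> \<open>The sign turns the bound on the absolute value into a one-sided bound, which
        midpoints preserve.\<close>
      define s where "s = sgn (A (w t) v)"
      have s: "s\<^sup>2 = 1" "\<bar>s\<bar> = 1" "s * A (w t) v \<ge> e"
        using t(3) e(1) by (auto simp: s_def sgn_real_def power2_eq_square)
      have wD: "w t \<in> D" by (rule w)
      have "(\<lambda>z. s * w t z) \<in> D" using Dlin[OF wD wD, of s 0] by simp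
      moreover have "A (\<lambda>z. s * w t z) v = s * A (w t) v" using Alin1[OF wD wD v, of s 0] by simp
      moreover have "B (\<lambda>z. s * w t z) = B (w t)"
        using Alin1[OF wD wD, of "\<lambda>z. s * w t z" s 0] Alin2[OF wD wD wD, of s 0] calculation(1) s(1)
        by (simp add: BA power2_eq_square flip: mult.assoc)
      ultimately have "(\<lambda>z. s * w t z) \<in> S N \<and> B (\<lambda>z. s * w t z) \<le> C"
        using t s by (simp add: S_def l2norm_cmult)
      then show ?thesis by blast
    qed
    have SD: "S N \<subseteq> D" for N by (auto simp: S_def)
    have Sdec: "S j \<subseteq> S i" if "i \<le> j" for i j
    proof -
      have "1 / real (Suc j) \<le> 1 / real (Suc i)" using that by (simp add: field_simps)
      then show ?thesis unfolding S_def by auto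
    qed
    define d where "d N = Inf (B ` S N)" for N
    have bb: "bdd_below (B ` S N)" for N by (rule bdd_belowI[of _ 0]) (use SD B0 in blast)
    have ne: "B ` S N \<noteq> {}" for N using SC by blast
    have dle: "d N \<le> B z" if "z \<in> S N" for N z unfolding d_def by (rule cINF_lower[OF bb that])
    have dC: "d N \<le> C" for N using SC dle by (meson order_trans)
    have dmono: "d i \<le> d j" if "i \<le> j" for i j
      unfolding d_def using Sdec[OF that] bb ne by (intro cInf_superset_mono image_mono) auto
    have "incseq d" using dmono by (auto simp: incseq_def)
    then obtain dl where dl: "d \<longlonglongrightarrow> dl" "\<And>n. d n \<le> dl"
      using incseq_convergent[of d C] dC by metis
    have "\<exists>z. z \<in> S N \<and> B z < d N + 1 / real (Suc N)" for N
      using cInf_lessD[OF ne, of N "d N + 1 / real (Suc N)"] unfolding d_def by auto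
    then obtain z where z: "\<And>N. z N \<in> S N" "\<And>N. B (z N) < d N + 1 / real (Suc N)" by metis
    have zD: "z N \<in> D" for N using z(1) SD by blast
    \<comment> \<open>The midpoint of \<open>z i\<close> and \<open>z j\<close> lies in
      \<open>S N\<close> and has energy at least \<open>d N\<close>, whereas both energies exceed
      \<open>dl\<close> by at most a small error; the parallelogram law bounds the energy of the
      difference.\<close>
    have diff: "B (\<lambda>x. z i x - z j x) \<le> 4 * (dl - d N + 1 / real (Suc N))" if ij: "i \<ge> N" "j \<ge> N" for i j N
    proof -
      have "z i \<in> S N" "z j \<in> S N" using z(1) Sdec ij by blast+
      then have "(\<lambda>x. 1/2 * z i x + 1/2 * z j x) \<in> S N"
        using Dlin[OF zD zD, of "1/2" i "1/2" j] Alin1[OF zD zD v, of "1/2" i "1/2" j]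
          l2norm_triangle[OF L2_cmult[OF DL[OF zD]] L2_cmult[OF DL[OF zD]], of "1/2" i "1/2" j]
          l2norm_cmult[of M "1/2" "z i"] l2norm_cmult[of M "1/2" "z j"]
        by (auto simp: S_def)
      then have "d N \<le> B (\<lambda>x. 1/2 * z i x + 1/2 * z j x)" by (rule dle)
      moreover have "1 / real (Suc i) \<le> 1 / real (Suc N)" "1 / real (Suc j) \<le> 1 / real (Suc N)"
        using ij by (simp_all add: field_simps)
      ultimately show ?thesis
        using par[OF zD zD, of i j] z(2)[of i] z(2)[of j] dl(2)[of i] dl(2)[of j] by argo
    qed
    have lim4: "(\<lambda>N. 4 * (dl - d N + 1 / real (Suc N))) \<longlonglongrightarrow> 4 * (dl - dl + 0)"
      by (intro tendsto_intros dl(1) LIMSEQ_Suc[OF lim_1_over_n])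
    have "\<forall>\<epsilon>>0. \<exists>N. \<forall>i\<ge>N. \<forall>j\<ge>N. E1 M E (\<lambda>x. z i x - z j x) < \<epsilon>"
    proof (intro allI impI)
      fix \<epsilon> :: real assume "\<epsilon> > 0"
      then have "eventually (\<lambda>N. 4 * (dl - d N + 1 / real (Suc N)) < \<epsilon>) sequentially"
        using order_tendstoD(2)[OF lim4, of \<epsilon>] by simp
      then obtain N where "4 * (dl - d N + 1 / real (Suc N)) < \<epsilon>" by (meson eventually_happens sequentially_bot)
      then show "\<exists>N. \<forall>i\<ge>N. \<forall>j\<ge>N. E1 M E (\<lambda>x. z i x - z j x) < \<epsilon>"
        using diff unfolding B_def by (meson le_less_trans)
    qed
    moreover have "\<forall>n. z n \<in> D" using zD by blast
    ultimately obtain u where u: "u \<in> D" "(\<lambda>n. B (\<lambda>x. z n x - u x)) \<longlonglongrightarrow> 0"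
      using sdD(8)[of z] unfolding B_def by blast
    have zu: "(\<lambda>x. z n x - u x) \<in> D" for n using Dlin[OF zD u(1), of 1 n "-1"] by simp
    have sq0: "(\<lambda>n. sqrt (B (\<lambda>x. z n x - u x))) \<longlonglongrightarrow> 0"
      using tendsto_real_sqrt[OF u(2)] by simp
    \<comment> \<open>The energy limit \<open>u\<close> has norm 0 because the norms of the
      \<open>z n\<close> tend to 0. Hence \<open>A u v = 0\<close>, which the sector bound makes
      incompatible with \<open>A (z n) v \<ge> e\<close>.\<close>
    have ul: "l2norm M u \<le> sqrt (B (\<lambda>x. z n x - u x)) + 1 / real (Suc n)" for n
    proof -
      have "l2norm M u = l2norm M (\<lambda>x. (-1) * (z n x - u x) + z n x)" by simp
      also have "\<dots> \<le> l2norm M (\<lambda>x. (-1) * (z n x - u x)) + l2norm M (z n)"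
        by (rule l2norm_triangle[OF L2_cmult[OF DL[OF zu]] DL[OF zD]])
      also have "l2norm M (\<lambda>x. (-1) * (z n x - u x)) \<le> sqrt (B (\<lambda>x. z n x - u x))"
        unfolding l2norm_cmult using Bip[OF zu] by (simp add: l2norm_def)
      also have "l2norm M (z n) \<le> 1 / real (Suc n)" using z(1) by (simp add: S_def)
      finally show ?thesis by simp
    qed
    have "(\<lambda>n. sqrt (B (\<lambda>x. z n x - u x)) + 1 / real (Suc n)) \<longlonglongrightarrow> 0 + 0"
      by (intro tendsto_intros sq0 LIMSEQ_Suc[OF lim_1_over_n])
    then have "l2norm M u \<le> 0" using ul by (intro LIMSEQ_le_const[of _ 0]) auto
    then have "AE x in M. u x = 0" using l2norm_zero_AE[OF DL[OF u(1)]] l2norm_nonneg[of M u] by simp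
    moreover have zeroD: "(\<lambda>x. 0) \<in> D" using Dlin[OF v v, of 0 0] by simp
    ultimately have "E u v = E (\<lambda>x. 0) v" using sdD(3) u(1) v by blast
    moreover have "ip M u v = ip M (\<lambda>x. 0) v"
      using \<open>AE x in M. u x = 0\<close> u(1) v zeroD DL by (intro ip_cong_AE) auto
    moreover have "A (\<lambda>x. 0) v = 0" using Alin1[OF v v v, of 0 0] by simp
    ultimately have Au: "A u v = 0" by (simp add: A_def)
    have "e \<le> K * sqrt (B (\<lambda>x. z n x - u x)) * sqrt (B v)" for n
    proof -
      have "A (\<lambda>x. z n x - u x) v = A (z n) v" using Alin1[OF zD u(1) v, of 1 n "-1"] Au by simp
      moreover have "A (z n) v \<ge> e" using z(1) by (simp add: S_def)
      ultimately show ?thesis using K(2)[OF zu v, of n] by linarith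
    qed
    moreover have "(\<lambda>n. K * sqrt (B (\<lambda>x. z n x - u x)) * sqrt (B v)) \<longlonglongrightarrow> K * 0 * sqrt (B v)"
      by (intro tendsto_intros sq0)
    ultimately have "e \<le> K * 0 * sqrt (B v)" by (intro LIMSEQ_le_const) auto
    then show False using e(1) by simp
  qed
  have "((\<lambda>t. ip M (w t) v) \<longlongrightarrow> 0) F"
  proof (rule tendsto_rabs_zero_cancel, rule tendsto_sandwich)
    show "eventually (\<lambda>t. 0 \<le> \<bar>ip M (w t) v\<bar>) F" by simp
    show "eventually (\<lambda>t. \<bar>ip M (w t) v\<bar> \<le> l2norm M (w t) * l2norm M v) F"
      using ip_Cauchy_Schwarz[OF DL[OF w] DL[OF v]] by simp
    show "((\<lambda>t. l2norm M (w t) * l2norm M v) \<longlongrightarrow> 0) F" using tendsto_mult_right[OF l2] by simp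
  qed simp
  from tendsto_diff[OF main this] show ?thesis by (simp add: A_def)
qed

section \<open>Contraction semigroups and their generators\<close>

lemma contraction_semigroupD:
  assumes "sc_contr_subMarkov_sg M T" "t \<ge> 0" "L2 M f"
  shows "L2 M (T t f)" "l2norm M (T t f) \<le> l2norm M f"
    and "L2 M g \<Longrightarrow> AE x in M. T t (\<lambda>y. a * f y + b * g y) x = a * T t f x + b * T t g x"
proof -
  note s1 = assms(1)[unfolded sc_contr_subMarkov_sg_def]
  note s2 = s1[THEN conjunct2] note s3 = s2[THEN conjunct2] note s4 = s3[THEN conjunct2]
  note s5 = s4[THEN conjunct2] note s6 = s5[THEN conjunct2]
  show "L2 M (T t f)" using s1[THEN conjunct1, rule_format, OF assms(2,3)] .
  show "l2norm M (T t f) \<le> l2norm M f" using s6[THEN conjunct1, rule_format, OF assms(2,3)] .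
  show "L2 M g \<Longrightarrow> AE x in M. T t (\<lambda>y. a * f y + b * g y) x = a * T t f x + b * T t g x"
    by (rule s3[THEN conjunct1, rule_format, OF assms(2,3)])
qed

lemma generator_limit:
  assumes gen: "is_generator M T DA A" and f: "f \<in> DA"
  shows "L2 M f" "L2 M (A f)" "((\<lambda>t. l2norm M (\<lambda>x. (T t f x - f x) / t - A f x)) \<longlongrightarrow> 0) (at_right 0)"
  using assms unfolding is_generator_def by blast+

lemma generator_unique:
  assumes L: "\<And>t. t > 0 \<Longrightarrow> L2 M (F t)" "L2 M g" "L2 M h"
    and lg: "((\<lambda>t. l2norm M (\<lambda>x. F t x - g x)) \<longlongrightarrow> 0) (at_right (0::real))"
    and lh: "((\<lambda>t. l2norm M (\<lambda>x. F t x - h x)) \<longlongrightarrow> 0) (at_right 0)"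
  shows "AE x in M. g x = h x"
proof -
  have "l2norm M (\<lambda>x. g x - h x) \<le> 0"
  proof (rule tendsto_lowerbound)
    show "((\<lambda>t. l2norm M (\<lambda>x. F t x - g x) + l2norm M (\<lambda>x. F t x - h x)) \<longlongrightarrow> 0) (at_right 0)"
      using tendsto_add[OF lg lh] by simp
    have "l2norm M (\<lambda>x. g x - h x) \<le> l2norm M (\<lambda>x. F t x - g x) + l2norm M (\<lambda>x. F t x - h x)" if "t > 0" for t
      using l2norm_triangle[OF L2_cmult[OF L2_diff[OF L(1)[OF that] L(2)], of "-1"] L2_diff[OF L(1)[OF that] L(3)]]
        l2norm_cmult[of M "-1" "\<lambda>x. F t x - g x"] by simp
    then show "eventually (\<lambda>t. l2norm M (\<lambda>x. g x - h x) \<le> l2norm M (\<lambda>x. F t x - g x) + l2norm M (\<lambda>x. F t x - h x)) (at_right 0)"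
      by (auto simp: eventually_at_right_field intro!: exI[of _ 1])
  qed simp
  then show ?thesis
    using l2norm_zero_AE[OF L2_diff[OF L(2,3)]] l2norm_nonneg[of M "\<lambda>x. g x - h x"] by simp
qed

text \<open>\<open>is_generator\<close> fixes \<open>A f\<close> only up to a null set, and
  \<open>T t\<close> is linear only almost everywhere; linearity of \<open>A\<close> is therefore
  read off from the difference quotients by uniqueness of their limit in norm.\<close>

lemma generator_lincomb:
  assumes sg: "sc_contr_subMarkov_sg M T" and gen: "is_generator M T DA A" and f: "f \<in> DA" and g: "g \<in> DA"
  shows "(\<lambda>x. a * f x + b * g x) \<in> DA" "AE x in M. A (\<lambda>x. a * f x + b * g x) x = a * A f x + b * A g x"
proof -
  define s where "s = (\<lambda>x. a * f x + b * g x)"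
  define As where "As = (\<lambda>x. a * A f x + b * A g x)"
  note F = generator_limit[OF gen f] and G = generator_limit[OF gen g]
  have TL: "L2 M (T t f)" if "L2 M f" "t \<ge> 0" for t f by (rule contraction_semigroupD(1)[OF sg that(2,1)])
  have Tlin: "AE x in M. T t s x = a * T t f x + b * T t g x" if "t \<ge> 0" for t
    unfolding s_def by (rule contraction_semigroupD(3)[OF sg that F(1) G(1)])
  have Ls: "L2 M s" and LAs: "L2 M As" unfolding s_def As_def by (rule L2_lincomb[OF F(1) G(1)] L2_lincomb[OF F(2) G(2)])+
  have Lq: "L2 M (\<lambda>x. (T t f x - f x) / t)" if "L2 M f" "t > 0" for t f
    using L2_cmult[OF L2_diff[OF TL[OF that(1), of t] that(1)], of "1 / t"] that by simp
  have lim: "((\<lambda>t. l2norm M (\<lambda>x. (T t s x - s x) / t - As x)) \<longlongrightarrow> 0) (at_right 0)"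
  proof (rule tendsto_sandwich)
    show "eventually (\<lambda>t. 0 \<le> l2norm M (\<lambda>x. (T t s x - s x) / t - As x)) (at_right 0)"
      by (simp add: l2norm_nonneg)
    have "l2norm M (\<lambda>x. (T t s x - s x) / t - As x) \<le> \<bar>a\<bar> * l2norm M (\<lambda>x. (T t f x - f x) / t - A f x) + \<bar>b\<bar> * l2norm M (\<lambda>x. (T t g x - g x) / t - A g x)"
      if t: "t > 0" for t
    proof -
      have Lf: "L2 M (\<lambda>x. (T t f x - f x) / t - A f x)" by (rule L2_diff[OF Lq[OF F(1) t] F(2)])
      have Lg: "L2 M (\<lambda>x. (T t g x - g x) / t - A g x)" by (rule L2_diff[OF Lq[OF G(1) t] G(2)])
      have Lsum: "L2 M (\<lambda>x. a * ((T t f x - f x) / t - A f x) + b * ((T t g x - g x) / t - A g x))"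
        by (rule L2_lincomb[OF Lf Lg])
      have LL: "L2 M (\<lambda>x. (T t s x - s x) / t - As x)" by (rule L2_diff[OF Lq[OF Ls t] LAs])
      have "l2norm M (\<lambda>x. (T t s x - s x) / t - As x) =
          l2norm M (\<lambda>x. a * ((T t f x - f x) / t - A f x) + b * ((T t g x - g x) / t - A g x))"
        unfolding l2norm_def ip_def
      proof (intro arg_cong[of _ _ sqrt] integral_cong_AE)
        show "AE x in M. ((T t s x - s x) / t - As x) * ((T t s x - s x) / t - As x) =
          (a * ((T t f x - f x) / t - A f x) + b * ((T t g x - g x) / t - A g x)) * (a * ((T t f x - f x) / t - A f x) + b * ((T t g x - g x) / t - A g x))"
          using Tlin[OF less_imp_le[OF t]]
        proof eventually_elim
          case (elim x)
          with t have "(T t s x - s x) / t - As x = a * ((T t f x - f x) / t - A f x) + b * ((T t g x - g x) / t - A g x)"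
            by (simp add: s_def As_def field_simps)
          then show ?case by simp
        qed
      qed (use LL Lsum in \<open>auto simp: L2_def\<close>)
      also have "\<dots> \<le> \<bar>a\<bar> * l2norm M (\<lambda>x. (T t f x - f x) / t - A f x) + \<bar>b\<bar> * l2norm M (\<lambda>x. (T t g x - g x) / t - A g x)"
        using l2norm_triangle[OF L2_cmult[OF Lf, of a] L2_cmult[OF Lg, of b]] by (simp add: l2norm_cmult)
      finally show ?thesis .
    qed
    then show "eventually (\<lambda>t. l2norm M (\<lambda>x. (T t s x - s x) / t - As x) \<le> \<bar>a\<bar> * l2norm M (\<lambda>x. (T t f x - f x) / t - A f x) + \<bar>b\<bar> * l2norm M (\<lambda>x. (T t g x - g x) / t - A g x)) (at_right 0)"
      by (auto simp: eventually_at_right_field intro!: exI[of _ 1])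
    show "((\<lambda>t. \<bar>a\<bar> * l2norm M (\<lambda>x. (T t f x - f x) / t - A f x) + \<bar>b\<bar> * l2norm M (\<lambda>x. (T t g x - g x) / t - A g x)) \<longlongrightarrow> 0) (at_right 0)"
      using tendsto_add[OF tendsto_mult_left[OF F(3), of "\<bar>a\<bar>"] tendsto_mult_left[OF G(3), of "\<bar>b\<bar>"]] by simp
  qed simp
  show sDA: "(\<lambda>x. a * f x + b * g x) \<in> DA"
    using gen lim Ls LAs unfolding is_generator_def s_def by blast
  have "AE x in M. A s x = As x"
    using generator_limit[OF gen sDA] Lq[OF Ls] LAs lim unfolding s_def
    by (intro generator_unique[where F = "\<lambda>t x. (T t s x - s x) / t"]) (auto simp: s_def)
  then show "AE x in M. A (\<lambda>x. a * f x + b * g x) x = a * A f x + b * A g x" by (simp add: s_def As_def)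
qed

text \<open>By contractivity and Cauchy-Schwarz \<open>(T t f, f) \<le> (f, f)\<close>, so the
  difference quotients have nonpositive inner product with \<open>f\<close>, and this passes to the
  limit.\<close>

lemma generator_dissipative:
  assumes sg: "sc_contr_subMarkov_sg M T" and gen: "is_generator M T DA A" and f: "f \<in> DA"
  shows "ip M (A f) f \<le> 0"
proof (rule tendsto_lowerbound[where F = "at_right (0::real)"])
  note F = generator_limit[OF gen f]
  have TL: "L2 M (T t f)" "l2norm M (T t f) \<le> l2norm M f" if "t \<ge> 0" for t
    by (rule contraction_semigroupD[OF sg that F(1)])+
  show "((\<lambda>t. l2norm M (\<lambda>x. (T t f x - f x) / t - A f x) * l2norm M f) \<longlongrightarrow> 0) (at_right 0)"
    using tendsto_mult_right[OF F(3), of "l2norm M f"] by simp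
  have "ip M (A f) f \<le> l2norm M (\<lambda>x. (T t f x - f x) / t - A f x) * l2norm M f" if t: "t > 0" for t
  proof -
    have Tf: "L2 M (T t f)" using TL(1)[of t] t by simp
    have Lq: "L2 M (\<lambda>x. (T t f x - f x) / t)"
      using L2_cmult[OF L2_diff[OF Tf F(1)], of "1 / t"] by simp
    have "ip M (T t f) f \<le> l2norm M (T t f) * l2norm M f" using ip_Cauchy_Schwarz[OF Tf F(1)] by linarith
    also have "\<dots> \<le> l2norm M f * l2norm M f" using TL(2)[of t] t l2norm_nonneg by (intro mult_right_mono) auto
    also have "\<dots> = ip M f f" by (simp add: l2norm_squared flip: power2_eq_square)
    finally have "ip M (\<lambda>x. T t f x - f x) f \<le> 0" by (simp add: ip_diff[OF Tf F(1) F(1)])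
    then have "ip M (\<lambda>x. (T t f x - f x) / t) f \<le> 0"
      using ip_cmult[of M "1 / t" "\<lambda>x. T t f x - f x" f] t by (simp add: divide_nonpos_pos)
    then have "ip M (A f) f \<le> - ip M (\<lambda>x. (T t f x - f x) / t - A f x) f"
      using ip_diff[OF Lq F(2) F(1)] by simp
    also have "\<dots> \<le> l2norm M (\<lambda>x. (T t f x - f x) / t - A f x) * l2norm M f"
      using ip_Cauchy_Schwarz[OF L2_diff[OF Lq F(2)] F(1)] by linarith
    finally show ?thesis .
  qed
  then show "eventually (\<lambda>t. ip M (A f) f \<le> l2norm M (\<lambda>x. (T t f x - f x) / t - A f x) * l2norm M f) (at_right 0)"
    by (auto simp: eventually_at_right_field intro!: exI[of _ 1])
qed simp

text \<open>For \<open>z = u - \<beta> G u\<close> one has \<open>\<beta> z - A z = - A u\<close>, so dissipativity gives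
  \<open>\<beta> \<parallel>z\<parallel> \<le> \<parallel>A u\<parallel>\<close>, while \<open>\<beta> (z, v) = (z, A\<^sup>* v) - (A u, v)\<close>.\<close>

lemma case1_limit:
  assumes U: "open U" and M: "radon_full_support U M" and c: "case1 U M E G Gh"
    and u: "test_fun U u" and v: "test_fun U v"
  shows "((\<lambda>\<beta>. \<beta> * (ip M u v - \<beta> * ip M (G \<beta> u) v)) \<longlongrightarrow> E u v) at_top"
proof -
  obtain T DA A DAh Ah where sg: "sc_contr_subMarkov_sg M T" and gen: "is_generator M T DA A"
    and adj: "is_adjoint M DA A DAh Ah" and td: "\<And>f. test_fun U f \<Longrightarrow> f \<in> DA \<and> f \<in> DAh"
    and E: "E u v = ip M (\<lambda>x. - A u x) v"
    and G: "\<And>\<beta> f. \<beta> > 0 \<Longrightarrow> L2 M f \<Longrightarrow> G \<beta> f \<in> DA \<and> (AE x in M. \<beta> * G \<beta> f x - A (G \<beta> f) x = f x)"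
    using c u v unfolding case1_def by auto
  have Lu: "L2 M u" and Lv: "L2 M v" using test_fun_L2[OF U M] u v by auto
  have uD: "u \<in> DA" and vD: "v \<in> DAh" using td u v by auto
  have LAu: "L2 M (A u)" using generator_limit[OF gen uD] by simp
  have LAv: "L2 M (Ah v)" and adjv: "\<And>x. x \<in> DA \<Longrightarrow> ip M (A x) v = ip M x (Ah v)"
    using adj vD unfolding is_adjoint_def by blast+
  define z where "z \<beta> = (\<lambda>x. 1 * u x + (- \<beta>) * G \<beta> u x)" for \<beta>
  have key: "\<bar>\<beta> * (ip M u v - \<beta> * ip M (G \<beta> u) v) - E u v\<bar> \<le> l2norm M (A u) * l2norm M (Ah v) / \<beta>" if b: "\<beta> > 0" for \<beta>
  proof -
    have GD: "G \<beta> u \<in> DA" and GE: "AE x in M. \<beta> * G \<beta> u x - A (G \<beta> u) x = u x" using G[OF b Lu] by auto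
    have LG: "L2 M (G \<beta> u)" using generator_limit[OF gen GD] by simp
    have zD: "z \<beta> \<in> DA" and zA: "AE x in M. A (z \<beta>) x = 1 * A u x + (- \<beta>) * A (G \<beta> u) x"
      unfolding z_def by (rule generator_lincomb[OF sg gen uD GD])+
    have Lz: "L2 M (z \<beta>)" and LAz: "L2 M (A (z \<beta>))" using generator_limit[OF gen zD] by auto
    \<comment> \<open>The resolvent equation eliminates \<open>A (G \<beta> u)\<close>, so
      \<open>A z\<close> and \<open>\<beta> z\<close> differ by the fixed function
      \<open>A u\<close>.\<close>
    have "AE x in M. A (z \<beta>) x = 1 * A u x + \<beta> * z \<beta> x"
      using zA GE
    proof eventually_elim
      case (elim x)
      then show ?case by (simp add: z_def algebra_simps)
    qed
    then have eq: "ip M (A (z \<beta>)) h = ip M (A u) h + \<beta> * ip M (z \<beta>) h" if "L2 M h" for h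
      using ip_cong_AE[OF LAz L2_lincomb[OF LAu Lz] that] ip_lincomb[OF LAu Lz that, of 1 \<beta>] by fastforce
    have "\<beta> * (l2norm M (z \<beta>) * l2norm M (z \<beta>)) = \<beta> * ip M (z \<beta>) (z \<beta>)"
      by (simp add: l2norm_squared flip: power2_eq_square)
    also have "\<dots> \<le> - ip M (A u) (z \<beta>)" using eq[OF Lz] generator_dissipative[OF sg gen zD] by linarith
    also have "\<dots> \<le> l2norm M (A u) * l2norm M (z \<beta>)" using ip_Cauchy_Schwarz[OF LAu Lz] by linarith
    finally have "\<beta> * l2norm M (z \<beta>) \<le> l2norm M (A u)"
      using l2norm_nonneg[of M "z \<beta>"] l2norm_nonneg[of M "A u"]
      by (cases "l2norm M (z \<beta>) = 0") (auto simp: mult.assoc[symmetric])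
    then have zn: "l2norm M (z \<beta>) \<le> l2norm M (A u) / \<beta>" using b by (simp add: field_simps)
    have "\<beta> * (ip M u v - \<beta> * ip M (G \<beta> u) v) = \<beta> * ip M (z \<beta>) v"
      unfolding z_def using ip_lincomb[OF Lu LG Lv, of 1 "- \<beta>"] by simp
    also have "\<dots> = ip M (z \<beta>) (Ah v) - ip M (A u) v" using eq[OF Lv] adjv[OF zD] by simp
    finally have "\<bar>\<beta> * (ip M u v - \<beta> * ip M (G \<beta> u) v) - E u v\<bar> = \<bar>ip M (z \<beta>) (Ah v)\<bar>"
      unfolding E using ip_cmult[of M "-1" "A u" v] by simp
    also have "\<dots> \<le> l2norm M (z \<beta>) * l2norm M (Ah v)" by (rule ip_Cauchy_Schwarz[OF Lz LAv])
    also have "\<dots> \<le> l2norm M (A u) / \<beta> * l2norm M (Ah v)" by (intro mult_right_mono zn l2norm_nonneg)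
    finally show ?thesis by simp
  qed
  have "((\<lambda>\<beta>. l2norm M (A u) * l2norm M (Ah v) / \<beta>) \<longlongrightarrow> 0) at_top"
    by (rule tendsto_divide_0[OF tendsto_const]) (rule filterlim_at_top_imp_at_infinity[OF filterlim_ident])
  then have "((\<lambda>\<beta>. \<beta> * (ip M u v - \<beta> * ip M (G \<beta> u) v) - E u v) \<longlongrightarrow> 0) at_top"
    by (rule Lim_null_comparison[rotated]) (use key in \<open>auto intro: eventually_mono[OF eventually_gt_at_top[of 0]]\<close>)
  then show ?thesis by (simp add: LIM_zero_cancel)
qed

text \<open>With \<open>w = \<beta> G u - u\<close> the resolvent equation turns the claim into
  convergence of \<open>E w v\<close> to 0. Testing that equation with \<open>w\<close> itself
  bounds the energy of \<open>w\<close> and forces its norm to vanish like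
  \<open>\<beta>^(-1/2)\<close>; weak convergence follows.\<close>

lemma case2_limit:
  assumes U: "open U" and M: "radon_full_support U M" and c: "case2 U M E G Gh"
    and u: "test_fun U u" and v: "test_fun U v"
  shows "((\<lambda>\<beta>. \<beta> * (ip M u v - \<beta> * ip M (G \<beta> u) v)) \<longlongrightarrow> E u v) at_top"
proof -
  obtain D where sd: "semi_dirichlet_form M D E" and td: "\<And>f. test_fun U f \<Longrightarrow> f \<in> D"
    and G: "\<And>\<beta> f. \<beta> > 0 \<Longrightarrow> L2 M f \<Longrightarrow> G \<beta> f \<in> D \<and> (\<forall>v\<in>D. E (G \<beta> f) v + \<beta> * ip M (G \<beta> f) v = ip M f v)"
    using c unfolding case2_def by auto
  note sdD = semi_dirichlet_formD[OF sd]
  have uD: "u \<in> D" and vD: "v \<in> D" using td u v by auto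
  have Lu: "L2 M u" and Lv: "L2 M v" using sdD(1) uD vD by auto
  \<comment> \<open>The value for nonpositive \<beta> merely keeps \<open>w\<close> in
    \<open>D\<close>; the limit at infinity does not see it.\<close>
  define w where "w \<beta> = (if \<beta> > 0 then \<lambda>x. \<beta> * G \<beta> u x + (-1) * u x else u)" for \<beta>
  have wD: "w \<beta> \<in> D" for \<beta> unfolding w_def using sdD(2)[of "G \<beta> u" u \<beta> "-1"] G[OF _ Lu] uD by auto
  have Ew: "E (w \<beta>) x = - \<beta> * ip M (w \<beta>) x - E u x" if b: "\<beta> > 0" and x: "x \<in> D" for \<beta> x
  proof -
    have GD: "G \<beta> u \<in> D" and eq: "E (G \<beta> u) x + \<beta> * ip M (G \<beta> u) x = ip M u x" using G[OF b Lu] x by auto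
    have "E (w \<beta>) x = \<beta> * E (G \<beta> u) x - E u x"
      using sdD(4)[OF GD uD x, of \<beta> "-1"] b by (simp add: w_def)
    moreover have "ip M (w \<beta>) x = \<beta> * ip M (G \<beta> u) x - ip M u x"
      using ip_lincomb[OF sdD(1)[OF GD] Lu sdD(1)[OF x], of \<beta> "-1"] b by (simp add: w_def)
    moreover have "E (G \<beta> u) x = - ip M (w \<beta>) x" using eq calculation(2) by linarith
    ultimately show ?thesis by (simp only: mult_minus_left mult_minus_right)
  qed
  obtain K where K: "K > 0" "\<And>x y. x \<in> D \<Longrightarrow> y \<in> D \<Longrightarrow>
      \<bar>E x y + ip M x y\<bar> \<le> K * sqrt (E1 M E x) * sqrt (E1 M E y)" using sdD(7) by blast
  \<comment> \<open>The sector bound controls \<open>E u w + (u, w)\<close>; the norm of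
    \<open>u\<close> is added to pass to \<open>E u w\<close> alone.\<close>
  define c where "c = K * sqrt (E1 M E u) + l2norm M u"
  have bound: "E1 M E (w \<beta>) \<le> c\<^sup>2" "\<beta> * (l2norm M (w \<beta>))\<^sup>2 \<le> c\<^sup>2" if b: "\<beta> \<ge> 1" for \<beta>
  proof -
    define B where "B = E1 M E (w \<beta>)"
    have e0: "0 \<le> E (w \<beta>) (w \<beta>)" by (rule sdD(6)[OF wD])
    have i0: "0 \<le> ip M (w \<beta>) (w \<beta>)" by (rule ip_self_nonneg)
    have nB: "l2norm M (w \<beta>) \<le> sqrt B" unfolding l2norm_def B_def E1_def using e0 by simp
    have B0: "0 \<le> B" using e0 i0 by (simp add: B_def E1_def)
    have "- E u (w \<beta>) \<le> K * sqrt (E1 M E u) * sqrt B + l2norm M u * l2norm M (w \<beta>)"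
      using K(2)[OF uD wD, of \<beta>] ip_Cauchy_Schwarz[OF Lu sdD(1)[OF wD], of \<beta>] unfolding B_def by linarith
    also have "\<dots> \<le> K * sqrt (E1 M E u) * sqrt B + l2norm M u * sqrt B"
      using nB l2norm_nonneg[of M u] by (intro add_left_mono mult_left_mono)
    also have "\<dots> = c * sqrt B" by (simp add: c_def algebra_simps)
    finally have up: "- E u (w \<beta>) \<le> c * sqrt B" .
    have id: "E (w \<beta>) (w \<beta>) + \<beta> * ip M (w \<beta>) (w \<beta>) = - E u (w \<beta>)"
      using Ew[OF _ wD, of \<beta> \<beta>] b by simp
    have "B \<le> E (w \<beta>) (w \<beta>) + \<beta> * ip M (w \<beta>) (w \<beta>)"
      using mult_right_mono[OF b i0] by (simp add: B_def E1_def)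
    then have BB: "sqrt B * sqrt B \<le> c * sqrt B" using id up B0 by simp
    have sB: "sqrt B \<le> c"
    proof (cases "B = 0")
      case True
      have "0 \<le> E1 M E u" using sdD(6)[OF uD] ip_self_nonneg[of M u] by (simp add: E1_def)
      then show ?thesis using True K(1) l2norm_nonneg[of M u] by (simp add: c_def)
    next
      case False
      then show ?thesis using mult_right_le_imp_le[OF BB] B0 by simp
    qed
    then show "E1 M E (w \<beta>) \<le> c\<^sup>2"
      using B0 by (metis B_def power_mono real_sqrt_ge_zero real_sqrt_pow2)
    have "\<beta> * (l2norm M (w \<beta>))\<^sup>2 \<le> c * sqrt B" using id up e0 by (simp add: l2norm_squared)
    also have "\<dots> \<le> c * c" using sB B0 by (intro mult_left_mono) (auto intro: order_trans[of 0 "sqrt B"])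
    finally show "\<beta> * (l2norm M (w \<beta>))\<^sup>2 \<le> c\<^sup>2" by (simp add: power2_eq_square)
  qed
  have "((\<lambda>\<beta>. (l2norm M (w \<beta>))\<^sup>2) \<longlongrightarrow> 0) at_top"
  proof (rule Lim_null_comparison)
    show "((\<lambda>\<beta>. c\<^sup>2 / \<beta>) \<longlongrightarrow> 0) at_top"
      by (rule tendsto_divide_0[OF tendsto_const]) (rule filterlim_at_top_imp_at_infinity[OF filterlim_ident])
    show "eventually (\<lambda>\<beta>. norm ((l2norm M (w \<beta>))\<^sup>2) \<le> c\<^sup>2 / \<beta>) at_top"
      using eventually_ge_at_top[of 1] by eventually_elim (use bound(2) in \<open>simp add: field_simps\<close>)
  qed
  from tendsto_real_sqrt[OF this] have "((\<lambda>\<beta>. l2norm M (w \<beta>)) \<longlongrightarrow> 0) at_top"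
    by (simp add: l2norm_nonneg)
  moreover have "eventually (\<lambda>\<beta>. E1 M E (w \<beta>) \<le> c\<^sup>2) at_top"
    using eventually_ge_at_top[of 1] by eventually_elim (rule bound(1))
  ultimately have "((\<lambda>\<beta>. E (w \<beta>) v) \<longlongrightarrow> 0) at_top"
    by (intro semi_dirichlet_weak_convergence[OF sd vD, of w] wD)
  then have "((\<lambda>\<beta>. E (w \<beta>) v + E u v) \<longlongrightarrow> 0 + E u v) at_top" by (intro tendsto_intros)
  then have "((\<lambda>\<beta>. E (w \<beta>) v + E u v) \<longlongrightarrow> E u v) at_top" by simp
  then show ?thesis
  proof (rule Lim_transform_eventually)
    show "eventually (\<lambda>\<beta>. E (w \<beta>) v + E u v = \<beta> * (ip M u v - \<beta> * ip M (G \<beta> u) v)) at_top"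
      using eventually_gt_at_top[of 0]
    proof eventually_elim
      case (elim \<beta>)
      have LG: "L2 M (G \<beta> u)" using G[OF elim Lu] sdD(1) by blast
      have wv: "ip M (w \<beta>) v = \<beta> * ip M (G \<beta> u) v - ip M u v"
        using ip_lincomb[OF LG Lu Lv, of \<beta> "-1"] elim by (simp add: w_def)
      show ?case unfolding Ew[OF elim vD] wv by (simp add: algebra_simps)
    qed
  qed
qed

lemma resolvent_limit:
  assumes "open U" "radon_full_support U M" "case1 U M E G Gh \<or> case2 U M E G Gh" "test_fun U u" "test_fun U v"
  shows "((\<lambda>\<beta>. \<beta> * (ip M u v - \<beta> * ip M (G \<beta> u) v)) \<longlongrightarrow> E u v) at_top"
  using assms case1_limit case2_limit by blast

text \<open>Part of the hypotheses in the first case. In the second, each resolvent equation is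
  tested with the other resolvent, and the left-hand sides coincide.\<close>

lemma resolvent_duality:
  assumes c: "case1 U M E G Gh \<or> case2 U M E G Gh" and b: "\<beta> > 0" and f: "L2 M f" and g: "L2 M g"
  shows "ip M (G \<beta> f) g = ip M f (Gh \<beta> g)"
  using c
proof
  assume "case1 U M E G Gh"
  then obtain DA where "\<forall>\<beta>>0. \<forall>g. L2 M g \<longrightarrow> L2 M (Gh \<beta> g) \<and> (\<forall>f. L2 M f \<longrightarrow> ip M (G \<beta> f) g = ip M f (Gh \<beta> g))"
    unfolding case1_def by (elim exE conjE) simp
  then show ?thesis using b f g by blast
next
  assume "case2 U M E G Gh"
  then obtain D where
    "\<forall>\<beta>>0. \<forall>f. L2 M f \<longrightarrow> G \<beta> f \<in> D \<and> (\<forall>v\<in>D. E (G \<beta> f) v + \<beta> * ip M (G \<beta> f) v = ip M f v)"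
    "\<forall>\<beta>>0. \<forall>f. L2 M f \<longrightarrow> Gh \<beta> f \<in> D \<and> (\<forall>v\<in>D. E v (Gh \<beta> f) + \<beta> * ip M v (Gh \<beta> f) = ip M v f)"
    unfolding case2_def by (elim exE conjE) simp
  then have D: "G \<beta> f \<in> D" "Gh \<beta> g \<in> D"
    and eqs: "\<forall>v\<in>D. E (G \<beta> f) v + \<beta> * ip M (G \<beta> f) v = ip M f v"
    "\<forall>v\<in>D. E v (Gh \<beta> g) + \<beta> * ip M v (Gh \<beta> g) = ip M v g"
    using b f g by blast+
  show ?thesis using bspec[OF eqs(1) D(2)] bspec[OF eqs(2) D(1)] by linarith
qed

section \<open>Vague limits of the resolvent kernels\<close>

lemma cc_funI:
  assumes "compact K" "K \<subseteq> S" "\<And>x. x \<notin> K \<Longrightarrow> f x = 0" "continuous_on UNIV f"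
  shows "cc_fun S f"
proof -
  have "tsupp f \<subseteq> K" using assms by (intro tsupp_subsetI compact_imp_closed)
  then show ?thesis
    using assms compact_Int_closed[OF assms(1) closed_tsupp, of f]
    unfolding cc_fun_def by (auto simp: Int_absorb1)
qed

lemma cc_funD:
  assumes "cc_fun S f"
  shows "continuous_on UNIV f" "compact (tsupp f)" "tsupp f \<subseteq> S"
  using assms unfolding cc_fun_def by auto

lemma cc_fun_mult:
  assumes "cc_fun S f" "continuous_on UNIV g"
  shows "cc_fun S (\<lambda>x. f x * g x)"
  using cc_funD[OF assms(1)] assms(2)
  by (intro cc_funI[of "tsupp f"] continuous_intros) (auto simp: not_in_tsupp)

lemma cc_fun_add:
  assumes "cc_fun S f" "cc_fun S g"
  shows "cc_fun S (\<lambda>x. f x + g x)"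
  using cc_funD[OF assms(1)] cc_funD[OF assms(2)]
  by (intro cc_funI[of "tsupp f \<union> tsupp g"] continuous_intros) (auto simp: not_in_tsupp)

lemma cc_fun_abs: "cc_fun S f \<Longrightarrow> cc_fun S (\<lambda>x. \<bar>f x\<bar>)"
  using cc_funD[of S f] by (intro cc_funI[of "tsupp f"] continuous_intros) (auto simp: not_in_tsupp)

lemma cc_fun_diff: "cc_fun S f \<Longrightarrow> cc_fun S g \<Longrightarrow> cc_fun S (\<lambda>x. f x - g x)"
  using cc_fun_add[of S f "\<lambda>x. g x * (-1)"] cc_fun_mult[of S g "\<lambda>_. -1"] by simp

lemma cc_fun_integrable: "radon_on S N \<Longrightarrow> cc_fun S f \<Longrightarrow> integrable N f"
  using integrable_compact_support cc_funD by blast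

definition gap :: "'a::real_normed_vector \<times> 'a \<Rightarrow> real" where
  "gap z = norm (fst z - snd z)"

lemma continuous_on_gap [continuous_intros]: "continuous_on S gap"
  unfolding gap_def by (intro continuous_intros)

lemma gap_nonneg: "0 \<le> gap z"
  unfolding gap_def by simp

lemma gap_measurable: "gap \<in> borel_measurable (borel :: ('a::euclidean_space \<times> 'a) measure)"
  by (rule borel_measurable_continuous_onI[OF continuous_on_gap])

lemma gap_squared: "(gap z)\<^sup>2 = (\<Sum>b\<in>Basis. ((fst z - snd z) \<bullet> b)\<^sup>2)"
  unfolding gap_def by (subst euclidean_inner[of "fst z - snd z" "fst z - snd z", folded power2_norm_eq_inner power2_eq_square]) simp

lemma cc_fun_off_diag:
  fixes \<Psi> :: "'a::euclidean_space \<times> 'a \<Rightarrow> real"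
  assumes "cc_fun (U \<times> U) \<Psi>" "continuous_on UNIV h" "\<rho> > 0" "\<And>r. r < \<rho> \<Longrightarrow> h r = 0"
  shows "cc_fun (U \<times> U - diag U) (\<lambda>z. \<Psi> z * h (gap z))"
proof (rule cc_funI[of "tsupp \<Psi> \<inter> {z. \<rho> \<le> gap z}"])
  note cc_funD[OF assms(1)]
  have "closed {z::'a\<times>'a. \<rho> \<le> gap z}" by (intro closed_Collect_le continuous_intros)
  then show "compact (tsupp \<Psi> \<inter> {z. \<rho> \<le> gap z})" by (intro compact_Int_closed \<open>compact (tsupp \<Psi>)\<close>)
  show "tsupp \<Psi> \<inter> {z. \<rho> \<le> gap z} \<subseteq> U \<times> U - diag U"
    using \<open>tsupp \<Psi> \<subseteq> U \<times> U\<close> assms(3) by (auto simp: diag_def gap_def)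
  show "continuous_on UNIV (\<lambda>z. \<Psi> z * h (gap z))"
    using \<open>continuous_on UNIV \<Psi>\<close> continuous_on_compose2[OF assms(2) continuous_on_gap] by (intro continuous_intros) auto
  show "\<Psi> z * h (gap z) = 0" if "z \<notin> tsupp \<Psi> \<inter> {z. \<rho> \<le> gap z}" for z
    using that assms(4)[of "gap z"] not_in_tsupp[of z \<Psi>] by auto
qed

text \<open>For \<open>c > 0\<close> it is 0 up to \<open>d / c\<close>, 1 from
  \<open>(d + 1) / c\<close> on, and linear between. Continuity suffices because convergence off the
  diagonal is proved for all continuous compactly supported functions.\<close>

definition ramp :: "real \<Rightarrow> real \<Rightarrow> real \<Rightarrow> real" where
  "ramp c d r = min 1 (max 0 (c * r - d))"

lemma continuous_on_ramp: "continuous_on S (ramp c d)"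
  unfolding ramp_def[abs_def] by (intro continuous_intros)

lemma ramp_nonneg: "0 \<le> ramp c d r"
  and ramp_le_1: "ramp c d r \<le> 1"
  and ramp_eq_0: "c * r \<le> d \<Longrightarrow> ramp c d r = 0"
  and ramp_eq_1: "d + 1 \<le> c * r \<Longrightarrow> ramp c d r = 1"
  by (auto simp: ramp_def)

lemma cc_fun_ramp:
  assumes "cc_fun (U \<times> U) \<Psi>" "c > 0" "d > 0"
  shows "cc_fun (U \<times> U - diag U) (\<lambda>z. \<Psi> z * ramp c d (gap z))"
proof (rule cc_fun_off_diag[OF assms(1) continuous_on_ramp])
  show "d / c > 0" using assms by simp
  show "ramp c d r = 0" if "r < d / c" for r
    using that assms by (intro ramp_eq_0) (simp add: field_simps)
qed

text \<open>The algebraic tensor product of test functions, on which the defining relation of the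
  kernels can be applied term by term. Scalars are absorbed into the factors.\<close>

inductive product_sum :: "'a::euclidean_space set \<Rightarrow> 'a set \<Rightarrow> ('a \<times> 'a \<Rightarrow> real) \<Rightarrow> bool"
  for A B where
  product_sum_zero: "product_sum A B (\<lambda>z. 0)"
| product_sum_add_mult: "product_sum A B H \<Longrightarrow> test_fun A a \<Longrightarrow> test_fun B b \<Longrightarrow>
    product_sum A B (\<lambda>z. H z + a (fst z) * b (snd z))"

lemma product_sum_mult: "test_fun A a \<Longrightarrow> test_fun B b \<Longrightarrow> product_sum A B (\<lambda>z. a (fst z) * b (snd z))"
  using product_sum_add_mult[OF product_sum_zero, of A a B b] by simp

lemma product_sum_add:
  assumes "product_sum A B H" "product_sum A B H'"
  shows "product_sum A B (\<lambda>z. H z + H' z)"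
  using assms(2)
proof (induction rule: product_sum.induct)
  case product_sum_zero
  then show ?case using assms(1) by simp
next
  case (product_sum_add_mult H' a b)
  from product_sum.product_sum_add_mult[OF product_sum_add_mult.IH product_sum_add_mult(2,3)]
  show ?case by (simp add: add.assoc)
qed

lemma product_sum_sum:
  "(\<And>i. i \<in> I \<Longrightarrow> product_sum A B (H i)) \<Longrightarrow> product_sum A B (\<lambda>z. \<Sum>i\<in>I. H i z)"
  by (induction I rule: infinite_finite_induct) (simp_all add: product_sum_zero product_sum_add)

lemma product_sum_smooth_mult:
  assumes "open A" "open B" "product_sum A B H" "smooth_on A f" "smooth_on B g"
  shows "product_sum A B (\<lambda>z. H z * (f (fst z) * g (snd z)))"
  using assms(3)
proof (induction rule: product_sum.induct)
  case product_sum_zero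
  then show ?case by (simp add: product_sum.product_sum_zero)
next
  case (product_sum_add_mult H a b)
  from product_sum.product_sum_add_mult[OF product_sum_add_mult.IH
      test_fun_mult[OF assms(1) product_sum_add_mult(2) assms(4)] test_fun_mult[OF assms(2) product_sum_add_mult(3) assms(5)]]
  show ?case by (simp add: algebra_simps)
qed

lemma product_sum_diff:
  assumes "open A" "open B" "product_sum A B H" "product_sum A B H'"
  shows "product_sum A B (\<lambda>z. H z - H' z)"
  using product_sum_add[OF assms(3) product_sum_smooth_mult[OF assms(1,2,4) smooth_on_const[of _ "-1"] smooth_on_const[of _ 1]]]
  by simp

lemma product_sum_swap:
  assumes "product_sum A B H"
  shows "product_sum B A (\<lambda>z. H (snd z, fst z))"
  using assms
proof (induction rule: product_sum.induct)
  case product_sum_zero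
  then show ?case by (simp add: product_sum.product_sum_zero)
next
  case (product_sum_add_mult H a b)
  from product_sum.product_sum_add_mult[OF product_sum_add_mult.IH product_sum_add_mult(3,2)]
  show ?case by (simp add: mult.commute)
qed

lemma product_sum_cc_fun:
  assumes "open A" "open B" "product_sum A B H"
  shows "cc_fun (A \<times> B) H"
  using assms(3)
proof (induction rule: product_sum.induct)
  case product_sum_zero
  then show ?case by (simp add: cc_funI[of "{}"])
next
  case (product_sum_add_mult H a b)
  have "cc_fun (A \<times> B) (\<lambda>z. a (fst z) * b (snd z))"
  proof (rule cc_funI[of "tsupp a \<times> tsupp b"])
    show "compact (tsupp a \<times> tsupp b)" "tsupp a \<times> tsupp b \<subseteq> A \<times> B"
      using product_sum_add_mult(2,3) unfolding test_fun_def by (auto intro: compact_Times)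
    have c: "continuous_on UNIV a" "continuous_on UNIV b"
      by (rule test_fun_continuous[OF assms(1) product_sum_add_mult(2)] test_fun_continuous[OF assms(2) product_sum_add_mult(3)])+
    show "continuous_on UNIV (\<lambda>z. a (fst z) * b (snd z))"
      by (rule continuous_on_mult[OF continuous_on_compose2[OF c(1) continuous_on_fst[OF continuous_on_id]]
            continuous_on_compose2[OF c(2) continuous_on_snd[OF continuous_on_id]]]) auto
    show "a (fst z) * b (snd z) = 0" if "z \<notin> tsupp a \<times> tsupp b" for z
      using that not_in_tsupp[of "fst z" a] not_in_tsupp[of "snd z" b] by (cases z) auto
  qed
  then show ?case by (rule cc_fun_add[OF product_sum_add_mult.IH])
qed

text \<open>A linear form splits as \<open>f (x, 0) + f (0, y)\<close>, and each summand depends on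
  one variable and can be absorbed into a factor. Keeping \<open>H\<close> arbitrary lets the
  factors of a polynomial act one after the other.\<close>

lemma product_sum_polynomial_mult:
  fixes p :: "'a::euclidean_space \<times> 'a \<Rightarrow> real"
  assumes "real_polynomial_function p" "open A" "open B" "product_sum A B H"
  shows "product_sum A B (\<lambda>z. H z * p z)"
  using assms(1,4)
proof (induction p arbitrary: H rule: real_polynomial_function.induct)
  case (linear f)
  note blf = linear(1) and pH = linear(2)
  interpret bounded_linear f by (rule blf)
  have rep: "g x = x \<bullet> (\<Sum>b\<in>Basis. g b *\<^sub>R b)" if "linear g" for g :: "'a \<Rightarrow> real" and x
  proof -
    interpret g: linear g by fact
    have "g x = g (\<Sum>b\<in>Basis. (x \<bullet> b) *\<^sub>R b)" by (simp add: euclidean_representation)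
    then show ?thesis by (simp add: g.sum g.scaleR inner_sum_right mult.commute)
  qed
  have l1: "linear (\<lambda>x. f (x, 0))"
    using add[of "(_, 0)" "(_, 0)"] scaleR[of _ "(_, 0)"] by (intro linearI) simp_all
  have l2: "linear (\<lambda>y. f (0, y))"
    using add[of "(0, _)" "(0, _)"] scaleR[of _ "(0, _)"] by (intro linearI) simp_all
  have "smooth_on A (\<lambda>x. f (x, 0))" "smooth_on B (\<lambda>y. f (0, y))"
    by (subst ext[OF rep[OF l1]] ext[OF rep[OF l2]], rule smooth_on_inner)+
  from product_sum_add[OF product_sum_smooth_mult[OF assms(2,3) pH this(1) smooth_on_const[of _ 1]]
      product_sum_smooth_mult[OF assms(2,3) pH smooth_on_const[of _ 1] this(2)]]
  have "product_sum A B (\<lambda>z. H z * (f (fst z, 0) + f (0, snd z)))" by (simp add: distrib_left)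
  moreover have "f (fst z, 0) + f (0, snd z) = f z" for z
    using add[of "(fst z, 0)" "(0, snd z)"] by simp
  ultimately show ?case by simp
next
  case (const k)
  from product_sum_smooth_mult[OF assms(2,3) const smooth_on_const[of _ k] smooth_on_const[of _ 1]]
  show ?case by simp
next
  case (add f g)
  from product_sum_add[OF add.IH(1)[OF add.prems] add.IH(2)[OF add.prems]]
  show ?case by (simp add: distrib_left)
next
  case (mult f g)
  from mult.IH(2)[OF mult.IH(1)[OF mult.prems]]
  show ?case by (simp add: mult.assoc)
qed

text \<open>Isolates what the asymptotic analysis rests on, so that it serves twice: for the kernels
  with the form and \<open>J\<close>, and for the co-kernels with the transposed form and the
  reflected measure.\<close>

locale jump_limit =
  fixes U :: "'a::euclidean_space set" and M :: "'a measure"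
    and sig :: "real \<Rightarrow> ('a \<times> 'a) measure" and J :: "('a \<times> 'a) measure"
    and e :: "('a \<Rightarrow> real) \<Rightarrow> ('a \<Rightarrow> real) \<Rightarrow> real"
  assumes open_U: "open U" and radon_M: "radon_on U M"
    and radon_sig: "\<And>\<beta>. \<beta> > 0 \<Longrightarrow> radon_on (U \<times> U) (sig \<beta>)"
    and radon_J: "radon_on (U \<times> U - diag U) J"
    and form_lim: "\<And>a b. test_fun U a \<Longrightarrow> test_fun U b \<Longrightarrow>
      ((\<lambda>\<beta>. \<beta> * (ip M a b - (\<integral>z. a (fst z) * b (snd z) \<partial>sig \<beta>))) \<longlongrightarrow> e a b) at_top"
    and jump: "\<And>a b. test_fun U a \<Longrightarrow> test_fun U b \<Longrightarrow> tsupp a \<inter> tsupp b = {} \<Longrightarrow>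
      e a b = - 2 * (\<integral>z. a (fst z) * b (snd z) \<partial>J)"
begin

text \<open>Integrability is built in because the integral of a non-integrable function is 0 by
  convention, which would spoil linearity of the limit.\<close>

definition tend :: "('a \<times> 'a \<Rightarrow> real) \<Rightarrow> real \<Rightarrow> bool" where
  "tend H L \<longleftrightarrow> (\<forall>\<beta>>0. integrable (sig \<beta>) H) \<and> ((\<lambda>\<beta>. \<beta> * integral\<^sup>L (sig \<beta>) H) \<longlongrightarrow> L) at_top"

lemma tend_cong_lim:
  assumes "\<And>\<beta>. \<beta> > 0 \<Longrightarrow> f \<beta> = g \<beta>" "(f \<longlongrightarrow> (L::real)) (at_top :: real filter)"
  shows "(g \<longlongrightarrow> L) at_top"
  using assms(2) by (rule Lim_transform_eventually) (use assms(1) in \<open>auto intro: eventually_mono[OF eventually_gt_at_top[of 0]]\<close>)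

lemma tend_zero: "tend (\<lambda>z. 0) 0"
  by (simp add: tend_def)

lemma tend_add:
  assumes "tend H L" "tend H' L'"
  shows "tend (\<lambda>z. H z + H' z) (L + L')"
  unfolding tend_def
proof
  show "\<forall>\<beta>>0. integrable (sig \<beta>) (\<lambda>z. H z + H' z)" using assms by (simp add: tend_def)
  have "((\<lambda>\<beta>. \<beta> * integral\<^sup>L (sig \<beta>) H + \<beta> * integral\<^sup>L (sig \<beta>) H') \<longlongrightarrow> L + L') at_top"
    using assms by (intro tendsto_add) (auto simp: tend_def)
  then show "((\<lambda>\<beta>. \<beta> * (\<integral>z. H z + H' z \<partial>sig \<beta>)) \<longlongrightarrow> L + L') at_top"
    by (rule tend_cong_lim[rotated]) (use assms in \<open>simp add: tend_def distrib_left\<close>)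
qed

lemma tend_cmult:
  assumes "tend H L"
  shows "tend (\<lambda>z. c * H z) (c * L)"
  using assms tendsto_mult_left[of "\<lambda>\<beta>. \<beta> * integral\<^sup>L (sig \<beta>) H" L at_top c]
  by (simp add: tend_def mult.left_commute)

lemma tend_diff:
  assumes "tend H L" "tend H' L'"
  shows "tend (\<lambda>z. H z - H' z) (L - L')"
  using tend_add[OF assms(1) tend_cmult[OF assms(2), of "-1"]] by simp

lemma tend_sum: "(\<And>i. i \<in> I \<Longrightarrow> tend (H i) (L i)) \<Longrightarrow> tend (\<lambda>z. \<Sum>i\<in>I. H i z) (\<Sum>i\<in>I. L i)"
  by (induction I rule: infinite_finite_induct) (simp_all add: tend_zero tend_add)

lemma tend_unique: "tend H L \<Longrightarrow> tend H L' \<Longrightarrow> L = L'"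
  unfolding tend_def using tendsto_unique[OF trivial_limit_at_top_linorder] by blast

lemma tend_mono:
  assumes "tend H L" "tend H' L'" "\<And>z. H z \<le> H' z"
  shows "L \<le> L'"
proof (rule tendsto_le[OF trivial_limit_at_top_linorder])
  show "((\<lambda>\<beta>. \<beta> * integral\<^sup>L (sig \<beta>) H') \<longlongrightarrow> L') at_top" "((\<lambda>\<beta>. \<beta> * integral\<^sup>L (sig \<beta>) H) \<longlongrightarrow> L) at_top"
    using assms by (auto simp: tend_def)
  show "eventually (\<lambda>\<beta>. \<beta> * integral\<^sup>L (sig \<beta>) H \<le> \<beta> * integral\<^sup>L (sig \<beta>) H') at_top"
    using eventually_gt_at_top[of 0]
    by eventually_elim (use assms in \<open>auto simp: tend_def intro!: mult_left_mono integral_mono\<close>)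
qed

text \<open>Because of the factor \<beta> a uniformly small error proves nothing: the error must
  have a majorant \<open>W\<close> whose own scaled integrals have a small limit.\<close>

lemma tend_approx:
  assumes int: "\<And>\<beta>. \<beta> > 0 \<Longrightarrow> integrable (sig \<beta>) H"
    and ap: "\<And>\<epsilon>. \<epsilon> > 0 \<Longrightarrow> \<exists>H' L' W w. tend H' L' \<and> \<bar>L' - L\<bar> \<le> \<epsilon> \<and> tend W w \<and> w \<le> \<epsilon> \<and> (\<forall>z. \<bar>H z - H' z\<bar> \<le> W z)"
  shows "tend H L"
  unfolding tend_def
proof
  show "((\<lambda>\<beta>. \<beta> * integral\<^sup>L (sig \<beta>) H) \<longlongrightarrow> L) at_top"
    unfolding tendsto_iff
  proof (intro allI impI)
    fix \<epsilon> :: real assume "\<epsilon> > 0"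
    then have pos: "\<epsilon> / 5 > 0" by simp
    from ap[OF pos] obtain H' L' W w where t: "tend H' L'" "\<bar>L' - L\<bar> \<le> \<epsilon> / 5" "tend W w" "w \<le> \<epsilon> / 5"
      and le: "\<And>z. \<bar>H z - H' z\<bar> \<le> W z" by blast
    have "eventually (\<lambda>\<beta>. dist (\<beta> * integral\<^sup>L (sig \<beta>) H') L' < \<epsilon> / 5) at_top"
      "eventually (\<lambda>\<beta>. dist (\<beta> * integral\<^sup>L (sig \<beta>) W) w < \<epsilon> / 5) at_top"
      using t(1,3) pos unfolding tend_def tendsto_iff by blast+
    then show "eventually (\<lambda>\<beta>. dist (\<beta> * integral\<^sup>L (sig \<beta>) H) L < \<epsilon>) at_top"
      using eventually_gt_at_top[of 0]
    proof eventually_elim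
      case (elim \<beta>)
      have iH': "integrable (sig \<beta>) H'" and iW: "integrable (sig \<beta>) W" using t elim(3) by (auto simp: tend_def)
      have "\<bar>integral\<^sup>L (sig \<beta>) H - integral\<^sup>L (sig \<beta>) H'\<bar> = \<bar>\<integral>z. H z - H' z \<partial>sig \<beta>\<bar>"
        using int[OF elim(3)] iH' by simp
      also have "\<dots> \<le> (\<integral>z. \<bar>H z - H' z\<bar> \<partial>sig \<beta>)" by (rule integral_abs_bound)
      also have "\<dots> \<le> integral\<^sup>L (sig \<beta>) W"
        using int[OF elim(3)] iH' iW le by (intro integral_mono) auto
      finally have "\<beta> * \<bar>integral\<^sup>L (sig \<beta>) H - integral\<^sup>L (sig \<beta>) H'\<bar> \<le> \<beta> * integral\<^sup>L (sig \<beta>) W"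
        using elim(3) by (intro mult_left_mono) auto
      then have "\<bar>\<beta> * integral\<^sup>L (sig \<beta>) H - \<beta> * integral\<^sup>L (sig \<beta>) H'\<bar> \<le> \<beta> * integral\<^sup>L (sig \<beta>) W"
        using elim(3) by (simp add: abs_mult flip: right_diff_distrib)
      then show ?case using elim(1,2) t(2,4) unfolding dist_real_def by linarith
    qed
  qed
qed (use int in auto)

text \<open>Each product comes with a term \<open>\<beta> * ip M a b\<close> that may diverge; over
  the whole sum these add up to \<beta> times the integral of \<open>H (x, x)\<close>, which is
  0.\<close>

lemma product_sum_tend:
  assumes "product_sum U U H" "\<And>x. H (x, x) = 0"
  obtains L where "tend H L"
proof -
  have "integrable M (\<lambda>x. H (x, x)) \<and> (\<forall>\<beta>>0. integrable (sig \<beta>) H) \<and>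
    (\<exists>L. ((\<lambda>\<beta>. \<beta> * ((\<integral>x. H (x, x) \<partial>M) - integral\<^sup>L (sig \<beta>) H)) \<longlongrightarrow> L) at_top)"
    using assms(1)
  proof (induction rule: product_sum.induct)
    case product_sum_zero
    show ?case by auto
  next
    case (product_sum_add_mult H a b)
    have ps: "product_sum U U (\<lambda>z. a (fst z) * b (snd z))" by (rule product_sum_mult) fact+
    have ca: "continuous_on UNIV a" "continuous_on UNIV b"
      by (rule test_fun_continuous[OF open_U] product_sum_add_mult)+
    have "cc_fun U (\<lambda>x. a x * b x)"
      by (rule cc_fun_mult) (use product_sum_add_mult(2) ca in \<open>auto simp: cc_fun_def test_fun_def\<close>)
    then have iM: "integrable M (\<lambda>x. a x * b x)" by (rule cc_fun_integrable[OF radon_M])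
    have isg: "integrable (sig \<beta>) (\<lambda>z. a (fst z) * b (snd z))" if "\<beta> > 0" for \<beta>
      by (rule cc_fun_integrable[OF radon_sig[OF that] product_sum_cc_fun[OF open_U open_U ps]])
    obtain L where L: "((\<lambda>\<beta>. \<beta> * ((\<integral>x. H (x, x) \<partial>M) - integral\<^sup>L (sig \<beta>) H)) \<longlongrightarrow> L) at_top"
      and iH: "integrable M (\<lambda>x. H (x, x))" "\<And>\<beta>. \<beta> > 0 \<Longrightarrow> integrable (sig \<beta>) H"
      using product_sum_add_mult.IH by auto
    have "((\<lambda>\<beta>. \<beta> * ((\<integral>x. H (x, x) \<partial>M) - integral\<^sup>L (sig \<beta>) H) +
        \<beta> * (ip M a b - (\<integral>z. a (fst z) * b (snd z) \<partial>sig \<beta>))) \<longlongrightarrow> L + e a b) at_top"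
      by (intro tendsto_add L form_lim product_sum_add_mult)
    then have "((\<lambda>\<beta>. \<beta> * ((\<integral>x. H (x, x) + a (fst (x, x)) * b (snd (x, x)) \<partial>M) -
        (\<integral>z. H z + a (fst z) * b (snd z) \<partial>sig \<beta>))) \<longlongrightarrow> L + e a b) at_top"
      by (rule tend_cong_lim[rotated]) (use iH iM isg in \<open>simp add: ip_def algebra_simps\<close>)
    then show ?case using iH iM isg by auto
  qed
  then obtain L where "\<forall>\<beta>>0. integrable (sig \<beta>) H"
    "((\<lambda>\<beta>. \<beta> * ((\<integral>x. H (x, x) \<partial>M) - integral\<^sup>L (sig \<beta>) H)) \<longlongrightarrow> L) at_top" by blast
  then have "tend H (- L)"
    using tendsto_minus[of "\<lambda>\<beta>. \<beta> * ((\<integral>x. H (x, x) \<partial>M) - integral\<^sup>L (sig \<beta>) H)" L at_top]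
    by (simp add: tend_def assms(2))
  then show ?thesis by (rule that)
qed

text \<open>Disjointness of \<open>A\<close> and \<open>B\<close> makes the diagonal term of every
  product vanish and lets \<open>jump\<close> evaluate the form.\<close>

lemma product_sum_disjoint_tend:
  assumes "open A" "open B" "A \<subseteq> U" "B \<subseteq> U" "A \<inter> B = {}" "product_sum A B H"
  shows "integrable J H \<and> tend H (2 * integral\<^sup>L J H)"
  using assms(6)
proof (induction rule: product_sum.induct)
  case product_sum_zero
  then show ?case by (simp add: tend_zero)
next
  case (product_sum_add_mult H a b)
  have ps: "product_sum A B (\<lambda>z. a (fst z) * b (snd z))" by (rule product_sum_mult) fact+
  have tst: "test_fun U a" "test_fun U b"
    using product_sum_add_mult(2,3) test_fun_subset[OF _ _ open_U] assms by blast+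
  have "cc_fun (A \<times> B) (\<lambda>z. a (fst z) * b (snd z))" by (rule product_sum_cc_fun[OF assms(1,2) ps])
  then have "cc_fun (U \<times> U - diag U) (\<lambda>z. a (fst z) * b (snd z))"
    and "cc_fun (U \<times> U) (\<lambda>z. a (fst z) * b (snd z))"
    using assms(3,4,5) unfolding cc_fun_def diag_def by auto
  then have int: "integrable J (\<lambda>z. a (fst z) * b (snd z))"
    "\<And>\<beta>. \<beta> > 0 \<Longrightarrow> integrable (sig \<beta>) (\<lambda>z. a (fst z) * b (snd z))"
    using cc_fun_integrable[OF radon_J] cc_fun_integrable[OF radon_sig] by blast+
  have "tsupp a \<inter> tsupp b = {}" using product_sum_add_mult(2,3) assms(5) unfolding test_fun_def by blast
  from jump[OF tst this] have j: "- e a b = 2 * (\<integral>z. a (fst z) * b (snd z) \<partial>J)" by simp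
  have ab0: "a x * b x = 0" for x
    using \<open>tsupp a \<inter> tsupp b = {}\<close> not_in_tsupp[of x a] not_in_tsupp[of x b] by auto
  have "ip M a b = 0" unfolding ip_def ab0 by simp
  with tendsto_minus[OF form_lim[OF tst]] int(2)
  have "tend (\<lambda>z. a (fst z) * b (snd z)) (2 * (\<integral>z. a (fst z) * b (snd z) \<partial>J))"
    by (simp add: tend_def j)
  from tend_add[OF conjunct2[OF product_sum_add_mult.IH] this] int(1) product_sum_add_mult.IH
  show ?case by (simp add: distrib_left)
qed

text \<open>After division by a sum of bumps \<open>a (fst z) * b (snd z)\<close> with disjoint supports, Stone-Weierstrass
  reduces the claim to such bumps times polynomials.\<close>

lemma tend_off_diag:
  assumes "cc_fun (U \<times> U - diag U) \<Psi>"
  shows "tend \<Psi> (2 * integral\<^sup>L J \<Psi>)"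
proof -
  define K where "K = tsupp \<Psi>"
  have c\<Psi>: "continuous_on UNIV \<Psi>" and cK: "compact K" and Ksub: "K \<subseteq> U \<times> U - diag U"
    using assms by (auto simp: K_def cc_fun_def)
  define P where "P z \<theta> \<longleftrightarrow> cc_fun (U \<times> U) \<theta> \<and> (\<forall>w. 0 \<le> \<theta> w) \<and> \<theta> z > 0 \<and> (\<forall>p. real_polynomial_function p \<longrightarrow>
      integrable J (\<lambda>w. \<theta> w * p w) \<and> tend (\<lambda>w. \<theta> w * p w) (2 * (\<integral>w. \<theta> w * p w \<partial>J)))"
    for z and \<theta> :: "'a \<times> 'a \<Rightarrow> real"
  have "\<exists>\<theta>. P z \<theta>" if "z \<in> K" for z
  proof -
    have zU: "z \<in> U \<times> U - diag U" using that Ksub by blast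
    have z: "fst z \<in> U" "snd z \<in> U" using zU by auto
    have z3: "fst z \<noteq> snd z"
    proof
      assume "fst z = snd z"
      then have "z = (fst z, fst z)" by (simp add: prod_eq_iff)
      then have "z \<in> diag U" using z(1) unfolding diag_def by blast
      then show False using zU by blast
    qed
    obtain A' B' where AB': "open A'" "open B'" "fst z \<in> A'" "snd z \<in> B'" "A' \<inter> B' = {}"
      using hausdorff[OF z3] by blast
    define A B where "A = A' \<inter> U" and "B = B' \<inter> U"
    have AB: "open A" "open B" "A \<subseteq> U" "B \<subseteq> U" "A \<inter> B = {}" and zAB: "fst z \<in> A" "snd z \<in> B"
      using AB' open_U z by (auto simp: A_def B_def)
    obtain a where a: "test_fun A a" "\<And>y. 0 \<le> a y" "a (fst z) > 0"
      using exists_bump[OF AB(1) zAB(1)] by blast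
    obtain b where b: "test_fun B b" "\<And>y. 0 \<le> b y" "b (snd z) > 0"
      using exists_bump[OF AB(2) zAB(2)] by blast
    have ps: "product_sum A B (\<lambda>w. a (fst w) * b (snd w))" by (rule product_sum_mult[OF a(1) b(1)])
    have "cc_fun (U \<times> U) (\<lambda>w. a (fst w) * b (snd w))"
      using product_sum_cc_fun[OF AB(1,2) ps] AB(3,4) unfolding cc_fun_def by blast
    then show ?thesis
      unfolding P_def using a b product_sum_disjoint_tend[OF AB product_sum_polynomial_mult[OF _ AB(1,2) ps]]
      by (intro exI[of _ "\<lambda>w. a (fst w) * b (snd w)"] conjI) auto
  qed
  then obtain \<theta> where \<theta>: "\<forall>z\<in>K. P z (\<theta> z)" using bchoice[of K P] by blast
  have cc\<theta>: "cc_fun (U \<times> U) (\<theta> z)" and \<theta>0: "0 \<le> \<theta> z w" and \<theta>z: "\<theta> z z > 0" if "z \<in> K" for z w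
    using bspec[OF \<theta> that] unfolding P_def by blast+
  have \<theta>p: "integrable J (\<lambda>w. \<theta> z w * p w) \<and> tend (\<lambda>w. \<theta> z w * p w) (2 * (\<integral>w. \<theta> z w * p w \<partial>J))"
    if "z \<in> K" "real_polynomial_function p" for z p
    using bspec[OF \<theta> that(1)] that(2) unfolding P_def by blast
  have op: "open {w. \<theta> z w > 0}" if "z \<in> K" for z
    using cc_funD(1)[OF cc\<theta>[OF that]] by (intro open_Collect_less) auto
  have cov: "K \<subseteq> (\<Union>z\<in>K. {w. \<theta> z w > 0})" using \<theta>z by blast
  obtain C where C: "C \<subseteq> K" "finite C" "K \<subseteq> (\<Union>z\<in>C. {w. \<theta> z w > 0})"
    using compactE_image[OF cK op cov] by metis
  have CK: "z \<in> K" if "z \<in> C" for z using C(1) that by blast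
  define \<Theta> where "\<Theta> w = (\<Sum>z\<in>C. \<theta> z w)" for w
  have \<Theta>0: "0 \<le> \<Theta> w" for w unfolding \<Theta>_def by (rule sum_nonneg) (rule \<theta>0[OF CK])
  have \<Theta>pos: "0 < \<Theta> w" if wK: "w \<in> K" for w
  proof -
    obtain z where z: "z \<in> C" "\<theta> z w > 0" using C(3) wK by blast
    show ?thesis unfolding \<Theta>_def by (rule sum_pos2[where f = "\<lambda>z. \<theta> z w", OF C(2) z \<theta>0[OF CK]])
  qed
  have c\<Theta>: "continuous_on UNIV \<Theta>"
    unfolding \<Theta>_def by (rule continuous_on_sum) (rule cc_funD(1)[OF cc\<theta>[OF CK]])
  define Q where "Q = (\<Union>z\<in>C. tsupp (\<theta> z))"
  have cQ: "compact Q" unfolding Q_def by (rule compact_UN[OF C(2)]) (rule cc_funD(2)[OF cc\<theta>[OF CK]])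
  have \<Theta>Q: "\<Theta> w = 0" if "w \<notin> Q" for w
    using that not_in_tsupp[of w] by (auto simp: \<Theta>_def Q_def intro!: sum.neutral)
  have zero: "\<Psi> w = 0" if "\<Theta> w = 0" for w
    using \<Theta>pos[of w] that not_in_tsupp[of w \<Psi>] by (auto simp: K_def)
  \<comment> \<open>The zero set of \<Theta> causes no discontinuity: it lies in the open complement
    of \<open>K\<close>, where the numerator vanishes and with it the quotient, whatever the
    denominator.\<close>
  have "continuous_on ({w. \<Theta> w \<noteq> 0} \<union> - K) (\<lambda>w. \<Psi> w / \<Theta> w)"
  proof (rule continuous_on_open_Un)
    show "open {w. \<Theta> w \<noteq> 0}" by (rule open_Collect_neq) (use c\<Theta> in auto)
    show "open (- K)" using cK compact_imp_closed by blast
    show "continuous_on {w. \<Theta> w \<noteq> 0} (\<lambda>w. \<Psi> w / \<Theta> w)"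
      using c\<Psi> c\<Theta> by (intro continuous_on_divide) (auto intro: continuous_on_subset)
    show "continuous_on (- K) (\<lambda>w. \<Psi> w / \<Theta> w)"
      by (rule continuous_on_eq[of _ "\<lambda>_. 0"]) (auto simp: K_def not_in_tsupp)
  qed
  moreover have "{w. \<Theta> w \<noteq> 0} \<union> - K = UNIV" using \<Theta>pos by fastforce
  ultimately have cquot: "continuous_on UNIV (\<lambda>w. \<Psi> w / \<Theta> w)" by simp
  have tend\<Theta>: "integrable J (\<lambda>w. \<Theta> w * p w) \<and> tend (\<lambda>w. \<Theta> w * p w) (2 * (\<integral>w. \<Theta> w * p w \<partial>J))"
    if "real_polynomial_function p" for p
  proof -
    have *: "integrable J (\<lambda>w. \<theta> z w * p w) \<and> tend (\<lambda>w. \<theta> z w * p w) (2 * (\<integral>w. \<theta> z w * p w \<partial>J))" if "z \<in> C" for z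
      by (rule \<theta>p[OF CK[OF that] \<open>real_polynomial_function p\<close>])
    then have "tend (\<lambda>w. \<Sum>z\<in>C. \<theta> z w * p w) (\<Sum>z\<in>C. 2 * (\<integral>w. \<theta> z w * p w \<partial>J))" by (intro tend_sum) auto
    moreover have "(\<Sum>z\<in>C. 2 * (\<integral>w. \<theta> z w * p w \<partial>J)) = 2 * (\<integral>w. \<Theta> w * p w \<partial>J)"
      using * by (simp add: \<Theta>_def sum_distrib_right Bochner_Integration.integral_sum sum_distrib_left)
    moreover have "integrable J (\<lambda>w. \<Theta> w * p w)"
      unfolding \<Theta>_def sum_distrib_right using * by (intro Bochner_Integration.integrable_sum) auto
    ultimately show ?thesis by (simp add: \<Theta>_def sum_distrib_right)
  qed
  from tend\<Theta>[OF real_polynomial_function.intros(2)[of 1]]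
  have i\<Theta>: "integrable J \<Theta>" and t\<Theta>: "tend \<Theta> (2 * integral\<^sup>L J \<Theta>)" by simp_all
  have i\<Psi>: "integrable J \<Psi>" by (rule cc_fun_integrable[OF radon_J assms])
  have J0: "0 \<le> integral\<^sup>L J \<Theta>" using \<Theta>0 by simp
  show ?thesis
  proof (rule tend_approx)
    fix \<beta> :: real assume "\<beta> > 0"
    have "cc_fun (U \<times> U) \<Psi>" using assms by (auto simp: cc_fun_def)
    then show "integrable (sig \<beta>) \<Psi>" by (rule cc_fun_integrable[OF radon_sig[OF \<open>\<beta> > 0\<close>]])
  next
    fix \<epsilon> :: real assume "\<epsilon> > 0"
    \<comment> \<open>The error of the approximation is at most \<open>\<eta> * \<Theta>\<close>,
      which has a limit of its own, and \<eta> makes that limit at most \<epsilon>. The summand 1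
      protects against a zero denominator.\<close>
    define \<eta> where "\<eta> = \<epsilon> / (2 * integral\<^sup>L J \<Theta> + 1)"
    have \<eta>: "\<eta> > 0" using \<open>\<epsilon> > 0\<close> J0 by (simp add: \<eta>_def)
    have "\<epsilon> * (2 * integral\<^sup>L J \<Theta>) \<le> \<epsilon> * (2 * integral\<^sup>L J \<Theta> + 1)" using \<open>\<epsilon> > 0\<close> by (intro mult_left_mono) auto
    then have \<eta>le: "\<eta> * (2 * integral\<^sup>L J \<Theta>) \<le> \<epsilon>" unfolding \<eta>_def using J0 by (simp add: field_simps)
    obtain p where p: "real_polynomial_function p" "\<And>w. w \<in> Q \<Longrightarrow> \<bar>\<Psi> w / \<Theta> w - p w\<bar> < \<eta>"
      using Stone_Weierstrass_real_polynomial_function[OF cQ continuous_on_subset[OF cquot] \<eta>] by auto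
    have close: "\<bar>\<Psi> w - \<Theta> w * p w\<bar> \<le> \<eta> * \<Theta> w" for w
    proof (cases "\<Theta> w = 0")
      case False
      then have "w \<in> Q" using \<Theta>Q by blast
      have "\<Psi> w - \<Theta> w * p w = \<Theta> w * (\<Psi> w / \<Theta> w - p w)"
        using False by (simp add: right_diff_distrib)
      then have "\<bar>\<Psi> w - \<Theta> w * p w\<bar> = \<Theta> w * \<bar>\<Psi> w / \<Theta> w - p w\<bar>"
        using \<Theta>0[of w] by (simp only: abs_mult abs_of_nonneg)
      also have "\<dots> \<le> \<Theta> w * \<eta>" using p(2)[OF \<open>w \<in> Q\<close>] \<Theta>0[of w] by (intro mult_left_mono) auto
      finally show ?thesis by (simp add: mult.commute)
    qed (simp add: zero)
    have "\<bar>2 * (\<integral>w. \<Theta> w * p w \<partial>J) - 2 * integral\<^sup>L J \<Psi>\<bar> = 2 * \<bar>\<integral>w. \<Psi> w - \<Theta> w * p w \<partial>J\<bar>"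
      using i\<Psi> tend\<Theta>[OF p(1)] by (simp add: abs_if)
    also have "\<dots> \<le> 2 * (\<integral>w. \<bar>\<Psi> w - \<Theta> w * p w\<bar> \<partial>J)" by (intro mult_left_mono integral_abs_bound) auto
    also have "\<dots> \<le> 2 * (\<integral>w. \<eta> * \<Theta> w \<partial>J)"
      using i\<Psi> tend\<Theta>[OF p(1)] i\<Theta> close by (intro mult_left_mono integral_mono) auto
    also have "\<dots> \<le> \<epsilon>" using \<eta>le by simp
    finally have "\<bar>2 * (\<integral>w. \<Theta> w * p w \<partial>J) - 2 * integral\<^sup>L J \<Psi>\<bar> \<le> \<epsilon>" .
    then show "\<exists>H' L' W w. tend H' L' \<and> \<bar>L' - 2 * integral\<^sup>L J \<Psi>\<bar> \<le> \<epsilon> \<and> tend W w \<and> w \<le> \<epsilon> \<and> (\<forall>z. \<bar>\<Psi> z - H' z\<bar> \<le> W z)"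
      using tend\<Theta>[OF p(1)] tend_cmult[OF t\<Theta>, of \<eta>] \<eta>le close by blast
  qed
qed

end

section \<open>Behaviour near the diagonal: second moments, cubic terms, truncations\<close>

context jump_limit begin

lemma sets_J: "sets J = sets borel"
  using radon_J by (simp add: radon_on_def)

lemma sets_sig: "\<beta> > 0 \<Longrightarrow> sets (sig \<beta>) = sets borel"
  using radon_sig by (simp add: radon_on_def)

lemma borel_measurable_J: "f \<in> borel_measurable borel \<Longrightarrow> f \<in> borel_measurable J"
  by (simp cong: measurable_cong_sets add: sets_J)

lemma borel_measurable_sig: "\<beta> > 0 \<Longrightarrow> f \<in> borel_measurable borel \<Longrightarrow> f \<in> borel_measurable (sig \<beta>)"
  by (simp cong: measurable_cong_sets add: sets_sig)

lemma cc_fun_borel: "cc_fun S f \<Longrightarrow> f \<in> borel_measurable borel"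
  by (rule borel_measurable_continuous_onI[OF cc_funD(1)])

lemma cc_fun_integrable_sig: "cc_fun (U \<times> U) f \<Longrightarrow> \<beta> > 0 \<Longrightarrow> integrable (sig \<beta>) f"
  by (rule cc_fun_integrable[OF radon_sig])

lemma cc_fun_integrable_J: "cc_fun (U \<times> U - diag U) f \<Longrightarrow> integrable J f"
  by (rule cc_fun_integrable[OF radon_J])

lemma AE_J_gap_pos: "AE z in J. z \<in> U \<times> U \<and> gap z > 0"
proof (rule AE_I)
  have cl: "closed {z::'a \<times> 'a. gap z \<le> 0}" by (intro closed_Collect_le continuous_intros)
  have op: "open (U \<times> U)" using open_U by (intro open_Times)
  have eq: "- (U \<times> U - diag U) = {z \<in> space J. \<not> (z \<in> U \<times> U \<and> gap z > 0)}"
    by (auto simp: diag_def gap_def sets_eq_imp_space_eq[OF sets_J])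
  show "{z \<in> space J. \<not> (z \<in> U \<times> U \<and> gap z > 0)} \<subseteq> - (U \<times> U - diag U)" using eq by blast
  show "emeasure J (- (U \<times> U - diag U)) = 0" using radon_J by (simp add: radon_on_def)
  have "- (U \<times> U - diag U) = - (U \<times> U) \<union> {z. gap z \<le> 0}" by (auto simp: diag_def gap_def)
  then show "- (U \<times> U - diag U) \<in> sets J"
    using borel_closed[OF cl] borel_open[OF op] by (simp add: sets_J borel_comp sets.Un)
qed

lemma exists_support_cutoff:
  assumes "cc_fun (U \<times> U) \<Psi>"
  obtains \<kappa> where "test_fun U \<kappa>" "\<And>x. 0 \<le> \<kappa> x" "\<And>x. \<kappa> x \<le> 1"
    "\<And>z. \<Psi> z \<noteq> 0 \<Longrightarrow> \<kappa> (fst z) = 1 \<and> \<kappa> (snd z) = 1"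
proof -
  define K where "K = fst ` tsupp \<Psi> \<union> snd ` tsupp \<Psi>"
  have "compact K" unfolding K_def using cc_funD(2)[OF assms]
    by (intro compact_Un compact_continuous_image continuous_intros)
  moreover have "K \<subseteq> U" using cc_funD(3)[OF assms] by (auto simp: K_def)
  ultimately obtain \<kappa> W where k: "test_fun U \<kappa>" "\<And>y. 0 \<le> \<kappa> y" "\<And>y. \<kappa> y \<le> 1" "K \<subseteq> W" "\<And>y. y \<in> W \<Longrightarrow> \<kappa> y = 1"
    using exists_cutoff[OF open_U] by metis
  show ?thesis
  proof (rule that[OF k(1-3)])
    fix z assume "\<Psi> z \<noteq> 0"
    then have "z \<in> tsupp \<Psi>" using not_in_tsupp by blast
    then have "fst z \<in> K" "snd z \<in> K" by (auto simp: K_def)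
    then show "\<kappa> (fst z) = 1 \<and> \<kappa> (snd z) = 1" using k(4,5) by blast
  qed
qed

text \<open>The squared gap made into a product sum, a polynomial times a product of cutoffs. Since
  it vanishes on the diagonal, its scaled integrals converge, and this is the control of the second
  moments.\<close>

definition weight :: "('a \<Rightarrow> real) \<Rightarrow> 'a \<times> 'a \<Rightarrow> real" where
  "weight \<kappa> z = \<kappa> (fst z) * \<kappa> (snd z) * (gap z)\<^sup>2"

lemma product_sum_weight:
  assumes "test_fun U \<kappa>"
  shows "product_sum U U (weight \<kappa>)"
proof -
  have "bounded_linear (\<lambda>z::'a\<times>'a. (fst z - snd z) \<bullet> b)" for b
    by (intro bounded_linear_inner_left_comp bounded_linear_sub bounded_linear_fst bounded_linear_snd)
  then have "real_polynomial_function (\<lambda>z::'a\<times>'a. (gap z)\<^sup>2)"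
    unfolding gap_squared by (intro real_polynomial_function_sum real_polynomial_function_power real_polynomial_function.intros(1)) auto
  from product_sum_polynomial_mult[OF this open_U open_U product_sum_mult[OF assms assms]]
  show ?thesis by (simp add: weight_def[abs_def])
qed

lemma weight_cc_fun: "test_fun U \<kappa> \<Longrightarrow> cc_fun (U \<times> U) (weight \<kappa>)"
  by (rule product_sum_cc_fun[OF open_U open_U product_sum_weight])

lemma weight_tend:
  assumes "test_fun U \<kappa>"
  obtains L where "tend (weight \<kappa>) L"
  by (rule product_sum_tend[OF product_sum_weight[OF assms]]) (auto simp: weight_def gap_def)

text \<open>Away from the diagonal, twice the \<open>J\<close>-integral is a limit of kernel
  integrals and hence at most the limit \<open>L\<close> for the full weight. Monotone convergence
  removes the truncation and keeps the bound.\<close>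

lemma weight_integrable_J:
  assumes "test_fun U \<kappa>" "\<And>x. 0 \<le> \<kappa> x"
  shows "integrable J (weight \<kappa>)"
proof -
  define f where "f n z = weight \<kappa> z * ramp (real (Suc n)) 1 (gap z)" for n z
  have w0: "0 \<le> weight \<kappa> z" for z using assms(2) by (simp add: weight_def)
  have ccf: "cc_fun (U \<times> U - diag U) (f n)" for n
    unfolding f_def by (rule cc_fun_ramp[OF weight_cc_fun[OF assms(1)]]) auto
  have rmono: "ramp (real (Suc m)) 1 (gap z) \<le> ramp (real (Suc n)) 1 (gap z)" if "m \<le> n" for m n and z :: "'a \<times> 'a"
    using mult_right_mono[of "real (Suc m)" "real (Suc n)" "gap z"] that gap_nonneg[of z]
    unfolding ramp_def by (intro min.mono max.mono) auto
  then have fmono: "f m z \<le> f n z" if "m \<le> n" for m n z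
    unfolding f_def using that w0 by (intro mult_left_mono) auto
  have fw: "f n z \<le> weight \<kappa> z" for n z
    unfolding f_def using ramp_le_1[of "real (Suc n)" 1 "gap z"] mult_left_mono[OF _ w0[of z], of "ramp (real (Suc n)) 1 (gap z)" 1] by simp
  obtain L where L: "tend (weight \<kappa>) L" using weight_tend[OF assms(1)] .
  have "2 * integral\<^sup>L J (f n) \<le> L" for n
    by (rule tend_mono[OF tend_off_diag[OF ccf] L fw])
  then have bd: "integral\<^sup>L J (f n) \<le> L / 2" for n by (simp add: field_simps)
  have inc: "incseq (\<lambda>n. integral\<^sup>L J (f n))"
    unfolding incseq_def by (intro allI impI integral_mono cc_fun_integrable_J ccf fmono)
  obtain l where l: "(\<lambda>n. integral\<^sup>L J (f n)) \<longlonglongrightarrow> l"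
    using incseq_convergent[OF inc, of "L / 2"] bd by blast
  have lim: "(\<lambda>n. f n z) \<longlonglongrightarrow> weight \<kappa> z" for z
  proof (cases "gap z = 0")
    case False
    then have g: "gap z > 0" using gap_nonneg[of z] by simp
    obtain N where N: "2 / gap z < real N" using reals_Archimedean2 by blast
    show ?thesis
    proof (rule tendsto_eventually, rule eventually_sequentiallyI[of N])
      fix n assume "N \<le> n"
      then have "2 / gap z < real (Suc n)" using N by linarith
      then have "ramp (real (Suc n)) 1 (gap z) = 1" using g by (intro ramp_eq_1) (simp add: field_simps)
      then show "f n z = weight \<kappa> z" by (simp add: f_def)
    qed
  qed (simp add: f_def weight_def)
  show ?thesis
  proof (rule integrable_monotone_convergence)
    show "integrable J (f n)" for n by (rule cc_fun_integrable_J[OF ccf])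
    show "AE z in J. mono (\<lambda>n. f n z)" using fmono by (auto simp: mono_def)
    show "weight \<kappa> \<in> borel_measurable J" by (rule borel_measurable_J[OF cc_fun_borel[OF weight_cc_fun[OF assms(1)]]])
  qed (use lim l in auto)
qed

lemma second_order_integrable_J:
  assumes "cc_fun (U \<times> U) \<Psi>" "\<And>z. \<bar>\<Psi> z\<bar> \<le> C * (gap z)\<^sup>2"
  shows "integrable J \<Psi>"
proof -
  obtain \<kappa> where k: "test_fun U \<kappa>" "\<And>x. 0 \<le> \<kappa> x" "\<And>x. \<kappa> x \<le> 1"
    "\<And>z. \<Psi> z \<noteq> 0 \<Longrightarrow> \<kappa> (fst z) = 1 \<and> \<kappa> (snd z) = 1"
    by (rule exists_support_cutoff[OF assms(1)]) blast
  show ?thesis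
  proof (rule Bochner_Integration.integrable_bound)
    show "integrable J (\<lambda>z. C * weight \<kappa> z)" using weight_integrable_J[OF k(1,2)] by simp
    show "\<Psi> \<in> borel_measurable J" by (rule borel_measurable_J[OF cc_fun_borel[OF assms(1)]])
    have "norm (\<Psi> z) \<le> norm (C * weight \<kappa> z)" for z
    proof (cases "\<Psi> z = 0")
      case False
      then show ?thesis using k(4)[OF False] assms(2)[of z] by (simp add: weight_def)
    qed simp
    then show "AE z in J. norm (\<Psi> z) \<le> norm (C * weight \<kappa> z)" by simp
  qed
qed

text \<open>Where the gap is below \<open>2 / c\<close>, a cubic term is at most
  \<open>2 * C / c\<close> times the weight, so this part has a small limit; the rest is handled by
  convergence off the diagonal.\<close>

lemma third_order_tend:
  assumes cc: "cc_fun (U \<times> U) \<Psi>" and le: "\<And>z. \<bar>\<Psi> z\<bar> \<le> C * gap z ^ 3" and C: "C \<ge> 0"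
    and iJ: "integrable J \<Psi>"
  shows "tend \<Psi> (2 * integral\<^sup>L J \<Psi>)"
proof -
  obtain \<kappa> where k: "test_fun U \<kappa>" "\<And>x. 0 \<le> \<kappa> x" "\<And>x. \<kappa> x \<le> 1"
    "\<And>z. \<Psi> z \<noteq> 0 \<Longrightarrow> \<kappa> (fst z) = 1 \<and> \<kappa> (snd z) = 1"
    by (rule exists_support_cutoff[OF cc]) blast
  obtain L where L: "tend (weight \<kappa>) L" using weight_tend[OF k(1)] .
  have w0: "0 \<le> weight \<kappa> z" for z using k(2) by (simp add: weight_def)
  have L0: "0 \<le> L" by (rule tend_mono[OF tend_zero L w0])
  have iw: "integrable J (weight \<kappa>)" by (rule weight_integrable_J[OF k(1,2)])
  define X where "X = L + 2 * integral\<^sup>L J (weight \<kappa>)"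
  have J0: "0 \<le> integral\<^sup>L J (weight \<kappa>)" using w0 by simp
  show ?thesis
  proof (rule tend_approx)
    show "integrable (sig \<beta>) \<Psi>" if "\<beta> > 0" for \<beta> by (rule cc_fun_integrable_sig[OF cc that])
    fix \<epsilon> :: real assume e: "\<epsilon> > 0"
    \<comment> \<open>Chosen so that \<open>\<eta> * X \<le> \<epsilon>\<close> for
      \<open>\<eta> = 2 * C / c\<close>, where \<open>X\<close> dominates both the limit of the
      weight under the kernels and twice its integral under \<open>J\<close>.\<close>
    define c where "c = 2 * C * X / \<epsilon> + 1"
    have X0: "0 \<le> X" using L0 J0 by (simp add: X_def)
    have c: "c > 0" using X0 C e unfolding c_def by (intro add_nonneg_pos) auto
    define \<eta> where "\<eta> = 2 * C / c"
    have eta0: "0 \<le> \<eta>" using C c by (simp add: \<eta>_def)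
    have "2 * C * X \<le> \<epsilon> * c" using e by (simp add: c_def field_simps)
    then have eX: "\<eta> * X \<le> \<epsilon>" using c by (simp add: \<eta>_def field_simps)
    define H where "H z = \<Psi> z * ramp c 1 (gap z)" for z
    have ccH: "cc_fun (U \<times> U - diag U) H" unfolding H_def by (rule cc_fun_ramp[OF cc c]) simp
    have close: "\<bar>\<Psi> z - H z\<bar> \<le> \<eta> * weight \<kappa> z" for z
    proof (cases "\<Psi> z = 0 \<or> gap z \<ge> 2 / c")
      case True
      then have "\<Psi> z - H z = 0"
        using c ramp_eq_1[of 1 c "gap z"] by (auto simp: H_def field_simps)
      then show ?thesis using mult_nonneg_nonneg[OF eta0 w0[of z]] by simp
    next
      case False
      then have w: "weight \<kappa> z = (gap z)\<^sup>2" using k(4)[of z] by (simp add: weight_def)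
      have "\<bar>\<Psi> z - H z\<bar> = \<bar>\<Psi> z\<bar> * (1 - ramp c 1 (gap z))"
        using ramp_le_1[of c 1 "gap z"] by (simp add: H_def abs_mult flip: right_diff_distrib) (simp add: right_diff_distrib[of "\<Psi> z" 1, simplified, symmetric] abs_mult)
      also have "\<dots> \<le> \<bar>\<Psi> z\<bar> * 1" using ramp_nonneg[of c 1 "gap z"] by (intro mult_left_mono) auto
      also have "\<dots> \<le> C * gap z ^ 3" using le by simp
      also have "\<dots> = (C * gap z) * (gap z)\<^sup>2" by (simp add: power3_eq_cube power2_eq_square)
      also have "\<dots> \<le> \<eta> * (gap z)\<^sup>2"
        using False C mult_left_mono[of "gap z" "2 / c" C] by (intro mult_right_mono) (auto simp: \<eta>_def mult.commute)
      finally show ?thesis by (simp add: w)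
    qed
    have iH: "integrable J H" by (rule cc_fun_integrable_J[OF ccH])
    have "\<bar>2 * integral\<^sup>L J H - 2 * integral\<^sup>L J \<Psi>\<bar> = 2 * \<bar>\<integral>z. \<Psi> z - H z \<partial>J\<bar>"
      using iJ iH by (simp add: abs_if)
    also have "\<dots> \<le> 2 * (\<integral>z. \<bar>\<Psi> z - H z\<bar> \<partial>J)" by (intro mult_left_mono integral_abs_bound) auto
    also have "\<dots> \<le> 2 * (\<integral>z. \<eta> * weight \<kappa> z \<partial>J)"
      using iJ iH iw close by (intro mult_left_mono integral_mono) auto
    also have "\<dots> = \<eta> * (2 * integral\<^sup>L J (weight \<kappa>))" by simp
    also have "\<dots> \<le> \<eta> * X" using L0 eta0 by (intro mult_left_mono) (auto simp: X_def)
    finally have d: "\<bar>2 * integral\<^sup>L J H - 2 * integral\<^sup>L J \<Psi>\<bar> \<le> \<epsilon>" using eX by linarith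
    have "\<eta> * L \<le> \<eta> * X" using J0 eta0 by (intro mult_left_mono) (auto simp: X_def)
    then have "\<eta> * L \<le> \<epsilon>" using eX by linarith
    then show "\<exists>H' L' W w. tend H' L' \<and> \<bar>L' - 2 * integral\<^sup>L J \<Psi>\<bar> \<le> \<epsilon> \<and> tend W w \<and> w \<le> \<epsilon> \<and> (\<forall>z. \<bar>\<Psi> z - H' z\<bar> \<le> W z)"
      using tend_off_diag[OF ccH] d tend_cmult[OF L, of \<eta>] close by blast
  qed
qed

lemma far_integrable_J:
  assumes "cc_fun (U \<times> U) \<Psi>" "s > 0" "\<phi> \<in> borel_measurable borel" "\<And>r. r < s \<Longrightarrow> \<phi> r = 0" "\<And>r. \<bar>\<phi> r\<bar> \<le> (1::real)"
  shows "integrable J (\<lambda>z. \<Psi> z * \<phi> (gap z))"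
proof (rule Bochner_Integration.integrable_bound)
  show "integrable J (\<lambda>z. \<Psi> z * ramp (2 / s) 1 (gap z))"
    using assms(2) by (intro cc_fun_integrable_J cc_fun_ramp[OF assms(1)]) auto
  show "(\<lambda>z. \<Psi> z * \<phi> (gap z)) \<in> borel_measurable J"
    by (intro borel_measurable_J borel_measurable_times cc_fun_borel[OF assms(1)] measurable_compose[OF gap_measurable assms(3)])
  have "\<bar>\<Psi> z\<bar> * \<bar>\<phi> (gap z)\<bar> \<le> \<bar>\<Psi> z\<bar> * \<bar>ramp (2 / s) 1 (gap z)\<bar>" for z
  proof (cases "gap z < s")
    case False
    then have "ramp (2 / s) 1 (gap z) = 1" using assms(2) by (intro ramp_eq_1) (simp add: field_simps)
    then show ?thesis using assms(5)[of "gap z"] mult_left_mono[of "\<bar>\<phi> (gap z)\<bar>" 1 "\<bar>\<Psi> z\<bar>"] by simp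
  qed (simp add: assms(4))
  then show "AE z in J. norm (\<Psi> z * \<phi> (gap z)) \<le> norm (\<Psi> z * ramp (2 / s) 1 (gap z))"
    by (simp add: abs_mult)
qed

text \<open>The jump of \<phi> at \<open>s\<close> is harmless because \<Psi> vanishes
  \<open>J\<close>-almost everywhere on \<open>gap z = s\<close>: \<phi> is compared with a steep
  ramp starting at \<open>s\<close>, and the error lies under a tent around \<open>s\<close> whose
  integral against \<open>|\<Psi>|\<close> shrinks to 0.\<close>

lemma threshold_tend:
  assumes cc: "cc_fun (U \<times> U) \<Psi>" and s: "s > 0" and meas: "\<phi> \<in> borel_measurable borel"
    and lo: "\<And>r. r < s \<Longrightarrow> \<phi> r = 0" and hi: "\<And>r. r > s \<Longrightarrow> \<phi> r = (1::real)" and mid: "0 \<le> \<phi> s" "\<phi> s \<le> 1"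
    and null: "AE z in J. gap z = s \<longrightarrow> \<Psi> z = 0"
  shows "tend (\<lambda>z. \<Psi> z * \<phi> (gap z)) (2 * (\<integral>z. \<Psi> z * \<phi> (gap z) \<partial>J))"
proof -
  have b: "\<bar>\<phi> r\<bar> \<le> 1" for r using lo[of r] hi[of r] mid by (cases r s rule: linorder_cases) auto
  have iJ: "integrable J (\<lambda>z. \<Psi> z * \<phi> (gap z))" by (rule far_integrable_J[OF cc s meas lo b])
  define \<zeta> where "\<zeta> c r = max 0 (1 - c * \<bar>r - s\<bar>)" for c r
  \<comment> \<open>The tent has half-width \<open>1 / c n\<close>; the summand \<open>2 / s\<close>
    keeps it to the right of \<open>s / 2\<close>, hence off the diagonal.\<close>
  define c where "c n = real n + 2 / s" for n
  have cpos: "c n > 0" for n unfolding c_def using s by (intro add_nonneg_pos) auto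
  have cs: "1 < c n * s" for n
  proof -
    have "0 \<le> real n * s" using s by simp
    moreover have "c n * s = real n * s + 2" using s by (simp add: c_def distrib_right)
    ultimately show ?thesis by linarith
  qed
  have ccW: "cc_fun (U \<times> U - diag U) (\<lambda>z. \<bar>\<Psi> z\<bar> * \<zeta> (c n) (gap z))" for n
  proof (rule cc_fun_off_diag[OF cc_fun_abs[OF cc]])
    show "continuous_on UNIV (\<zeta> (c n))" unfolding \<zeta>_def[abs_def] by (intro continuous_intros)
    show "s / 2 > 0" using s by simp
    fix r assume r: "r < s / 2"
    have "1 \<le> 2 / s * (s - r)" using r s by (simp add: field_simps)
    also have "\<dots> \<le> c n * (s - r)" using r s by (intro mult_right_mono) (auto simp: c_def)
    finally show "\<zeta> (c n) r = 0" using r s by (simp add: \<zeta>_def)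
  qed
  have near: "\<bar>\<phi> r - ramp (c n) (c n * s) r\<bar> \<le> \<zeta> (c n) r" for r n
  proof (cases r s rule: linorder_cases)
    case less
    then show ?thesis using lo[of r] ramp_eq_0[of "c n" r "c n * s"] cpos[of n] by (simp add: \<zeta>_def)
  next
    case equal
    then show ?thesis using mid ramp_eq_0[of "c n" r "c n * s"] by (simp add: \<zeta>_def)
  next
    case greater
    then show ?thesis using hi[of r] cpos[of n] by (simp add: \<zeta>_def ramp_def right_diff_distrib max_def min_def)
  qed
  have lim: "(\<lambda>n. \<integral>z. \<bar>\<Psi> z\<bar> * \<zeta> (c n) (gap z) \<partial>J) \<longlonglongrightarrow> (\<integral>z. 0 \<partial>J)"
  proof (rule integral_dominated_convergence)
    show "integrable J (\<lambda>z. \<bar>\<Psi> z\<bar> * \<zeta> (c 0) (gap z))" by (rule cc_fun_integrable_J[OF ccW])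
    show "(\<lambda>z. \<bar>\<Psi> z\<bar> * \<zeta> (c n) (gap z)) \<in> borel_measurable J" for n
      by (rule borel_measurable_J[OF cc_fun_borel[OF ccW]])
    have "\<zeta> (c n) r \<le> \<zeta> (c 0) r" for n r
      unfolding \<zeta>_def by (intro max.mono diff_left_mono mult_right_mono) (auto simp: c_def)
    moreover have "0 \<le> \<zeta> (c n) r" for n r by (simp add: \<zeta>_def)
    ultimately show "AE z in J. norm (\<bar>\<Psi> z\<bar> * \<zeta> (c n) (gap z)) \<le> \<bar>\<Psi> z\<bar> * \<zeta> (c 0) (gap z)" for n
      by (intro AE_I2) (simp add: abs_mult mult_left_mono)
    show "AE z in J. (\<lambda>n. \<bar>\<Psi> z\<bar> * \<zeta> (c n) (gap z)) \<longlonglongrightarrow> 0"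
      using null
    proof eventually_elim
      case (elim z)
      show ?case
      proof (cases "gap z = s")
        case False
        then have d: "\<bar>gap z - s\<bar> > 0" by simp
        obtain N where N: "1 / \<bar>gap z - s\<bar> < real N" using reals_Archimedean2 by blast
        show ?thesis
        proof (rule tendsto_eventually, rule eventually_sequentiallyI[of N])
          fix n assume "N \<le> n"
          then have "1 / \<bar>gap z - s\<bar> < c n" using N s unfolding c_def by (smt (verit) divide_pos_pos of_nat_mono)
          then have "1 \<le> c n * \<bar>gap z - s\<bar>" using d by (simp add: field_simps)
          then show "\<bar>\<Psi> z\<bar> * \<zeta> (c n) (gap z) = 0" by (simp add: \<zeta>_def)
        qed
      qed (use elim in simp)
    qed
  qed simp
  show ?thesis
  proof (rule tend_approx)
    show "integrable (sig \<beta>) (\<lambda>z. \<Psi> z * \<phi> (gap z))" if "\<beta> > 0" for \<beta>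
    proof (rule Bochner_Integration.integrable_bound[OF cc_fun_integrable_sig[OF cc that]])
      show "(\<lambda>z. \<Psi> z * \<phi> (gap z)) \<in> borel_measurable (sig \<beta>)"
        by (intro borel_measurable_sig[OF that] borel_measurable_times cc_fun_borel[OF cc] measurable_compose[OF gap_measurable meas])
      show "AE z in sig \<beta>. norm (\<Psi> z * \<phi> (gap z)) \<le> norm (\<Psi> z)"
        using b by (intro AE_I2) (simp add: abs_mult mult_left_le)
    qed
    fix \<epsilon> :: real assume e: "\<epsilon> > 0"
    have "eventually (\<lambda>n. (\<integral>z. \<bar>\<Psi> z\<bar> * \<zeta> (c n) (gap z) \<partial>J) < \<epsilon> / 2) sequentially"
      using order_tendstoD(2)[OF lim, of "\<epsilon> / 2"] e by simp
    then obtain n where n: "(\<integral>z. \<bar>\<Psi> z\<bar> * \<zeta> (c n) (gap z) \<partial>J) < \<epsilon> / 2"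
      by (meson eventually_happens sequentially_bot)
    define H where "H z = \<Psi> z * ramp (c n) (c n * s) (gap z)" for z
    have ccH: "cc_fun (U \<times> U - diag U) H" unfolding H_def using cs[of n] by (intro cc_fun_ramp[OF cc cpos]) simp
    have close: "\<bar>\<Psi> z * \<phi> (gap z) - H z\<bar> \<le> \<bar>\<Psi> z\<bar> * \<zeta> (c n) (gap z)" for z
      using mult_left_mono[OF near[of "gap z" n], of "\<bar>\<Psi> z\<bar>"]
      by (simp add: H_def flip: right_diff_distrib abs_mult)
    have iH: "integrable J H" by (rule cc_fun_integrable_J[OF ccH])
    have "\<bar>2 * integral\<^sup>L J H - 2 * (\<integral>z. \<Psi> z * \<phi> (gap z) \<partial>J)\<bar> = 2 * \<bar>\<integral>z. \<Psi> z * \<phi> (gap z) - H z \<partial>J\<bar>"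
      using iJ iH by (simp add: abs_if)
    also have "\<dots> \<le> 2 * (\<integral>z. \<bar>\<Psi> z * \<phi> (gap z) - H z\<bar> \<partial>J)" by (intro mult_left_mono integral_abs_bound) auto
    also have "\<dots> \<le> 2 * (\<integral>z. \<bar>\<Psi> z\<bar> * \<zeta> (c n) (gap z) \<partial>J)"
      using iJ iH cc_fun_integrable_J[OF ccW] close by (intro mult_left_mono integral_mono) auto
    also have "\<dots> \<le> \<epsilon>" using n by simp
    finally have "\<bar>2 * integral\<^sup>L J H - 2 * (\<integral>z. \<Psi> z * \<phi> (gap z) \<partial>J)\<bar> \<le> \<epsilon>" .
    moreover have "2 * (\<integral>z. \<bar>\<Psi> z\<bar> * \<zeta> (c n) (gap z) \<partial>J) \<le> \<epsilon>" using n by simp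
    ultimately show "\<exists>H' L' W w. tend H' L' \<and> \<bar>L' - 2 * (\<integral>z. \<Psi> z * \<phi> (gap z) \<partial>J)\<bar> \<le> \<epsilon> \<and> tend W w \<and> w \<le> \<epsilon> \<and>
        (\<forall>z. \<bar>\<Psi> z * \<phi> (gap z) - H' z\<bar> \<le> W z)"
      using tend_off_diag[OF ccH] tend_off_diag[OF ccW[of n]] close by blast
  qed
qed

text \<open>Only the difference \<open>H1 - H2\<close> needs to be of second order at the diagonal: there the part of
  \<open>H1\<close> beyond \<open>s l\<close> is compensated by \<open>H2\<close>.\<close>

lemma compensated_integrable_J:
  assumes "cc_fun (U \<times> U) H1" "cc_fun (U \<times> U) H2" "\<And>z. \<bar>H1 z - H2 z\<bar> \<le> C * (gap z)\<^sup>2" "t > 0"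
  shows "integrable J (\<lambda>z. H1 z - indicator {..t} (gap z) * H2 z)"
proof -
  have "integrable J (\<lambda>z. H1 z - H2 z)"
    by (rule second_order_integrable_J[OF cc_fun_diff[OF assms(1,2)] assms(3)])
  moreover have "integrable J (\<lambda>z. H2 z * indicator {t<..} (gap z))"
    by (rule far_integrable_J[OF assms(2,4)]) (auto simp: indicator_def)
  ultimately have "integrable J (\<lambda>z. (H1 z - H2 z) + H2 z * indicator {t<..} (gap z))"
    by (rule Bochner_Integration.integrable_add)
  moreover have "(\<lambda>z. (H1 z - H2 z) + H2 z * indicator {t<..} (gap z)) = (\<lambda>z. H1 z - indicator {..t} (gap z) * H2 z)"
    by (auto simp: indicator_def)
  ultimately show ?thesis by simp
qed

text \<open>Both indicators are expressed by thresholds away from the diagonal: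
  \<open>{..<s}\<close> as the complement of \<open>{s..}\<close>, and \<open>{s..t}\<close> as
  \<open>{s..}\<close> without \<open>{t<..}\<close>. Only \<open>L\<close> then carries a
  contribution of the diagonal.\<close>

lemma truncated_tend:
  assumes cc: "cc_fun (U \<times> U) H1" "cc_fun (U \<times> U) H2" and L: "tend H1 L" and s: "s > 0" "s \<le> t"
    and null: "AE z in J. gap z = s \<longrightarrow> H1 z = 0 \<and> H2 z = 0" "AE z in J. gap z = t \<longrightarrow> H2 z = 0"
  shows "Lim at_top (\<lambda>\<beta>. \<beta> * ((\<integral>z. indicator {..<s} (gap z) * H1 z \<partial>sig \<beta>) + (\<integral>z. indicator {s..t} (gap z) * H2 z \<partial>sig \<beta>)))
    = L - 2 * (\<integral>z. indicator {s..} (gap z) * (H1 z - indicator {..t} (gap z) * H2 z) \<partial>J)"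
proof -
  have t: "t > 0" using s by simp
  have ind: "\<bar>indicator A r\<bar> \<le> (1::real)" for A :: "real set" and r by (simp add: indicator_def)
  have T1: "tend (\<lambda>z. H1 z * indicator {s..} (gap z)) (2 * (\<integral>z. H1 z * indicator {s..} (gap z) \<partial>J))"
    using null(1) by (intro threshold_tend[OF cc(1) s(1)]) (auto elim: eventually_mono)
  have T2: "tend (\<lambda>z. H2 z * indicator {s..} (gap z)) (2 * (\<integral>z. H2 z * indicator {s..} (gap z) \<partial>J))"
    using null(1) by (intro threshold_tend[OF cc(2) s(1)]) (auto elim: eventually_mono)
  have T3: "tend (\<lambda>z. H2 z * indicator {t<..} (gap z)) (2 * (\<integral>z. H2 z * indicator {t<..} (gap z) \<partial>J))"
    using null(2) by (intro threshold_tend[OF cc(2) t]) auto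
  have i1: "integrable J (\<lambda>z. H1 z * indicator {s..} (gap z))" and i2: "integrable J (\<lambda>z. H2 z * indicator {s..} (gap z))"
    by (rule far_integrable_J[OF _ s(1)]; use cc ind in auto)+
  have i3: "integrable J (\<lambda>z. H2 z * indicator {t<..} (gap z))"
    by (rule far_integrable_J[OF _ t]; use cc ind in auto)
  have T12: "tend (\<lambda>z. H1 z - H1 z * indicator {s..} (gap z)) (L - 2 * (\<integral>z. H1 z * indicator {s..} (gap z) \<partial>J))"
    by (rule tend_diff[OF L T1])
  have T23: "tend (\<lambda>z. H2 z * indicator {s..} (gap z) - H2 z * indicator {t<..} (gap z))
      (2 * (\<integral>z. H2 z * indicator {s..} (gap z) \<partial>J) - 2 * (\<integral>z. H2 z * indicator {t<..} (gap z) \<partial>J))"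
    by (rule tend_diff[OF T2 T3])
  have e1: "(\<lambda>z. H1 z - H1 z * indicator {s..} (gap z)) = (\<lambda>z. indicator {..<s} (gap z) * H1 z)"
    by (auto simp: indicator_def)
  have e2: "(\<lambda>z. H2 z * indicator {s..} (gap z) - H2 z * indicator {t<..} (gap z)) = (\<lambda>z. indicator {s..t} (gap z) * H2 z)"
    using s by (auto simp: indicator_def)
  note A = T12[unfolded e1] and B = T23[unfolded e2]
  have lim: "((\<lambda>\<beta>. \<beta> * (\<integral>z. indicator {..<s} (gap z) * H1 z \<partial>sig \<beta>) + \<beta> * (\<integral>z. indicator {s..t} (gap z) * H2 z \<partial>sig \<beta>)) \<longlongrightarrow>
      (L - 2 * (\<integral>z. H1 z * indicator {s..} (gap z) \<partial>J)) +
      (2 * (\<integral>z. H2 z * indicator {s..} (gap z) \<partial>J) - 2 * (\<integral>z. H2 z * indicator {t<..} (gap z) \<partial>J))) at_top"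
    using A B unfolding tend_def by (intro tendsto_add) auto
  have "(\<integral>z. indicator {s..} (gap z) * (H1 z - indicator {..t} (gap z) * H2 z) \<partial>J) =
      (\<integral>z. H1 z * indicator {s..} (gap z) - (H2 z * indicator {s..} (gap z) - H2 z * indicator {t<..} (gap z)) \<partial>J)"
    using s by (intro Bochner_Integration.integral_cong) (auto simp: indicator_def)
  then have eq: "L - 2 * (\<integral>z. indicator {s..} (gap z) * (H1 z - indicator {..t} (gap z) * H2 z) \<partial>J) =
      (L - 2 * (\<integral>z. H1 z * indicator {s..} (gap z) \<partial>J)) +
      (2 * (\<integral>z. H2 z * indicator {s..} (gap z) \<partial>J) - 2 * (\<integral>z. H2 z * indicator {t<..} (gap z) \<partial>J))"
    using i1 i2 i3 by simp
  show ?thesis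
    unfolding distrib_left eq by (rule tendsto_Lim[OF trivial_limit_at_top_linorder lim])
qed

text \<open>Dominated convergence in the formula for fixed \<open>s\<close>: the integrand
  \<open>G\<close> is integrable because \<open>H2\<close> compensates \<open>H1\<close> near the
  diagonal, and \<open>J\<close> has no mass where the gap is 0.\<close>

lemma truncated_limit:
  assumes cc: "cc_fun (U \<times> U) H1" "cc_fun (U \<times> U) H2" and L: "tend H1 L"
    and close: "\<And>z. \<bar>H1 z - H2 z\<bar> \<le> C * (gap z)\<^sup>2"
    and s: "\<And>l. s l > 0" "s \<longlonglongrightarrow> 0" and t: "t > 0"
    and null: "eventually (\<lambda>l. AE z in J. gap z = s l \<longrightarrow> H1 z = 0 \<and> H2 z = 0) sequentially"
      "AE z in J. gap z = t \<longrightarrow> H2 z = 0"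
  shows "(\<lambda>l. Lim at_top (\<lambda>\<beta>. \<beta> * ((\<integral>z. indicator {..<s l} (gap z) * H1 z \<partial>sig \<beta>) + (\<integral>z. indicator {s l..t} (gap z) * H2 z \<partial>sig \<beta>))))
    \<longlonglongrightarrow> L - 2 * (\<integral>z. H1 z - indicator {..t} (gap z) * H2 z \<partial>J)"
proof -
  define G where "G z = H1 z - indicator {..t} (gap z) * H2 z" for z
  have iG: "integrable J G" unfolding G_def by (rule compensated_integrable_J[OF cc close t])
  have "(\<lambda>l. \<integral>z. indicator {s l..} (gap z) * G z \<partial>J) \<longlonglongrightarrow> integral\<^sup>L J G"
  proof (rule integral_dominated_convergence)
    show "integrable J (\<lambda>z. \<bar>G z\<bar>)" using iG by simp
    show "G \<in> borel_measurable J" using iG by simp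
    have "(\<lambda>z. indicator {s l..} (gap z)) \<in> borel_measurable J" for l
      by (intro borel_measurable_J measurable_compose[OF gap_measurable]) simp
    then show "(\<lambda>z. indicator {s l..} (gap z) * G z) \<in> borel_measurable J" for l
      using iG by (intro borel_measurable_times) auto
    show "AE z in J. norm (indicator {s l..} (gap z) * G z) \<le> \<bar>G z\<bar>" for l
      by (intro AE_I2) (simp add: indicator_def)
    show "AE z in J. (\<lambda>l. indicator {s l..} (gap z) * G z) \<longlonglongrightarrow> G z"
      using AE_J_gap_pos
    proof eventually_elim
      case (elim z)
      have "eventually (\<lambda>l. s l < gap z) sequentially" using order_tendstoD(2)[OF s(2)] elim by blast
      then have "eventually (\<lambda>l. indicator {s l..} (gap z) * G z = G z) sequentially"
        by (rule eventually_mono) (simp add: indicator_def)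
      then show ?case by (rule tendsto_eventually)
    qed
  qed
  then have "(\<lambda>l. L - 2 * (\<integral>z. indicator {s l..} (gap z) * G z \<partial>J)) \<longlonglongrightarrow> L - 2 * integral\<^sup>L J G"
    by (intro tendsto_intros)
  moreover have "eventually (\<lambda>l. L - 2 * (\<integral>z. indicator {s l..} (gap z) * G z \<partial>J) =
      Lim at_top (\<lambda>\<beta>. \<beta> * ((\<integral>z. indicator {..<s l} (gap z) * H1 z \<partial>sig \<beta>) + (\<integral>z. indicator {s l..t} (gap z) * H2 z \<partial>sig \<beta>)))) sequentially"
    using null(1) order_tendstoD(2)[OF s(2) t]
    by eventually_elim (simp add: G_def truncated_tend[OF cc L s(1) less_imp_le _ null(2)])
  ultimately show ?thesis unfolding G_def by (rule Lim_transform_eventually)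
qed

text \<open>Since \<open>t k\<close> stays at or above \<delta>, the indicators converge at every
  point, also where the gap equals \<delta>, a set that \<open>J\<close> may charge.\<close>

lemma compensator_limit:
  assumes cc: "cc_fun (U \<times> U) H1" "cc_fun (U \<times> U) H2"
    and close: "\<And>z. \<bar>H1 z - H2 z\<bar> \<le> C * (gap z)\<^sup>2"
    and t: "\<And>k. t k \<ge> \<delta>" "t \<longlonglongrightarrow> \<delta>" and d: "\<delta> > 0"
  shows "(\<lambda>k. \<integral>z. H1 z - indicator {..t k} (gap z) * H2 z \<partial>J) \<longlonglongrightarrow> (\<integral>z. H1 z - indicator {..\<delta>} (gap z) * H2 z \<partial>J)"
proof (rule integral_dominated_convergence)
  have tp: "t k > 0" for k using t(1)[of k] d by linarith
  show "(\<lambda>z. H1 z - indicator {..t k} (gap z) * H2 z) \<in> borel_measurable J" for k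
    using compensated_integrable_J[OF cc close tp[of k]] by simp
  show "(\<lambda>z. H1 z - indicator {..\<delta>} (gap z) * H2 z) \<in> borel_measurable J"
    using compensated_integrable_J[OF cc close d] by simp
  have "integrable J (\<lambda>z. H1 z - H2 z)"
    by (rule second_order_integrable_J[OF cc_fun_diff[OF cc] close])
  moreover have "integrable J (\<lambda>z. H2 z * indicator {\<delta><..} (gap z))"
    by (rule far_integrable_J[OF cc(2) d]) (auto simp: indicator_def)
  ultimately show "integrable J (\<lambda>z. \<bar>H1 z - H2 z\<bar> + \<bar>H2 z * indicator {\<delta><..} (gap z)\<bar>)"
    by (intro Bochner_Integration.integrable_add integrable_abs)
  show "AE z in J. norm (H1 z - indicator {..t k} (gap z) * H2 z) \<le> \<bar>H1 z - H2 z\<bar> + \<bar>H2 z * indicator {\<delta><..} (gap z)\<bar>" for k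
    using t(1)[of k] by (intro AE_I2) (auto simp: indicator_def)
  show "AE z in J. (\<lambda>k. H1 z - indicator {..t k} (gap z) * H2 z) \<longlonglongrightarrow> H1 z - indicator {..\<delta>} (gap z) * H2 z"
  proof (intro AE_I2)
    fix z
    show "(\<lambda>k. H1 z - indicator {..t k} (gap z) * H2 z) \<longlonglongrightarrow> H1 z - indicator {..\<delta>} (gap z) * H2 z"
    proof (cases "gap z \<le> \<delta>")
      case True
      then have "gap z \<le> t k" for k using t(1)[of k] by linarith
      then show ?thesis using True by (simp add: indicator_def)
    next
      case False
      then have "eventually (\<lambda>k. t k < gap z) sequentially" using order_tendstoD(2)[OF t(2), of "gap z"] by simp
      then have "eventually (\<lambda>k. H1 z - indicator {..t k} (gap z) * H2 z = H1 z - indicator {..\<delta>} (gap z) * H2 z) sequentially"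
        by (rule eventually_mono) (use False in \<open>simp add: indicator_def\<close>)
      then show ?thesis by (rule tendsto_eventually)
    qed
  qed
qed

end

section \<open>Remainders of the chain rule\<close>

lemma test_fun_bounded:
  assumes "open S" "test_fun S f"
  obtains B where "B \<ge> 0" "\<And>x. \<bar>f x\<bar> \<le> B"
proof -
  have "compact (f ` tsupp f)"
    using assms test_fun_continuous[OF assms] by (intro compact_continuous_image) (auto simp: test_fun_def)
  from compact_imp_bounded[OF this] obtain B where B: "\<And>x. x \<in> tsupp f \<Longrightarrow> \<bar>f x\<bar> \<le> B"
    unfolding bounded_iff by auto
  show ?thesis
  proof (rule that[of "\<bar>B\<bar>"])
    show "\<bar>f x\<bar> \<le> \<bar>B\<bar>" for x using B[of x] not_in_tsupp[of x f] by (cases "x \<in> tsupp f") auto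
  qed simp
qed

lemma sum_Basis_cart: "(\<Sum>c\<in>(Basis :: (real ^ 'm) set). f c) = (\<Sum>i\<in>UNIV. f (axis i 1))"
proof -
  have eq: "(Basis :: (real ^ 'm) set) = (\<lambda>i. axis i 1) ` UNIV" by (auto simp: Basis_vec_def)
  have inj: "inj (\<lambda>i::'m. axis i (1::real))" by (auto simp: inj_on_def axis_eq_axis)
  show ?thesis unfolding eq by (subst sum.reindex[OF inj]) (simp add: o_def)
qed

lemma axis_Basis: "axis i (1::real) \<in> Basis"
  by (simp add: axis_in_Basis_iff)

lemma smooth_on_cart:
  fixes a :: "'m::finite \<Rightarrow> 'a::euclidean_space \<Rightarrow> real"
  assumes "\<And>i. smooth_on S (a i)" "c \<in> Basis"
  shows "smooth_on S (\<lambda>x. (\<chi> j. a j x) \<bullet> c)"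
proof -
  obtain i where "c = axis i 1" using assms(2) by (auto simp: Basis_vec_def)
  then show ?thesis using assms(1)[of i] by (simp add: inner_axis)
qed

lemma smooth_on_compose_cart:
  fixes a :: "'m::finite \<Rightarrow> 'a::euclidean_space \<Rightarrow> real"
  assumes "open S" "smooth_on UNIV \<Phi>" "\<And>i. smooth_on S (a i)"
  shows "smooth_on S (\<lambda>x. \<Phi> (\<chi> j. a j x))"
  by (rule smooth_on_compose[OF assms(1,2) smooth_on_cart[OF assms(3)]]) auto

lemma pd_compose_cart:
  fixes a :: "'m::finite \<Rightarrow> 'a::euclidean_space \<Rightarrow> real"
  assumes "smooth_on UNIV \<Phi>" "\<And>i. smooth_on UNIV (a i)" "b \<in> Basis"
  shows "pd b (\<lambda>x. \<Phi> (\<chi> j. a j x)) x = (\<Sum>i\<in>UNIV. pd (axis i 1) \<Phi> (\<chi> j. a j x) * pd b (a i) x)"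
proof -
  have "pd b (\<lambda>x. \<Phi> (\<chi> j. a j x)) x = (\<Sum>c\<in>Basis. pd c \<Phi> (\<chi> j. a j x) * pd b (\<lambda>x. (\<chi> j. a j x) \<bullet> c) x)"
    by (rule pd_compose[OF smooth_on_differentiable[OF assms(1) UNIV_I]
          smooth_on_differentiable[OF smooth_on_cart[where a = a, OF assms(2)] UNIV_I] assms(3)])
  then show ?thesis by (simp add: sum_Basis_cart inner_axis)
qed

definition chain_remainder :: "(real ^ 'm \<Rightarrow> real) \<Rightarrow> ('m::finite \<Rightarrow> 'a \<Rightarrow> real) \<Rightarrow> 'a \<Rightarrow> 'a \<Rightarrow> real" where
  "chain_remainder \<Phi> a x y = \<Phi> (\<chi> j. a j y) - \<Phi> (\<chi> j. a j x) -
     (\<Sum>i\<in>UNIV. pd (axis i 1) \<Phi> (\<chi> j. a j y) * (a i y - a i x))"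

text \<open>The \<open>a i\<close> are Lipschitz on \<open>K\<close>, so both bounds are pulled back
  from estimates for \<Phi> on the compact image of \<open>K\<close>. Exchanging \<open>x\<close>
  and \<open>y\<close> and subtracting produces precisely the trapezoidal error.\<close>

lemma chain_remainder_estimates:
  fixes a :: "'m::finite \<Rightarrow> 'a::euclidean_space \<Rightarrow> real"
  assumes "smooth_on UNIV \<Phi>" "\<And>i. smooth_on UNIV (a i)" "compact K"
  obtains C where "C \<ge> 0" "\<And>x y. x \<in> K \<Longrightarrow> y \<in> K \<Longrightarrow> \<bar>chain_remainder \<Phi> a x y\<bar> \<le> C * (norm (y - x))\<^sup>2"
    "\<And>x y. x \<in> K \<Longrightarrow> y \<in> K \<Longrightarrow> \<bar>chain_remainder \<Phi> a x y - chain_remainder \<Phi> a y x\<bar> \<le> C * norm (y - x) ^ 3"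
proof -
  define A where "A x = (\<chi> j. a j x)" for x
  have "\<exists>L. L \<ge> 0 \<and> (\<forall>x\<in>K. \<forall>y\<in>K. \<bar>a i y - a i x\<bar> \<le> L * norm (y - x))" for i
    using smooth_on_lipschitz[OF assms(2,3)] by metis
  then obtain L where L: "\<And>i. L i \<ge> 0" "\<And>i x y. x \<in> K \<Longrightarrow> y \<in> K \<Longrightarrow> \<bar>a i y - a i x\<bar> \<le> L i * norm (y - x)" by metis
  define l where "l = (\<Sum>i\<in>UNIV. L i)"
  have l0: "l \<ge> 0" using L(1) by (simp add: l_def sum_nonneg)
  have Al: "norm (A y - A x) \<le> l * norm (y - x)" if "x \<in> K" "y \<in> K" for x y
  proof -
    have "norm (A y - A x) \<le> (\<Sum>i\<in>UNIV. \<bar>(A y - A x) $ i\<bar>)" by (rule norm_le_l1_cart)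
    also have "\<dots> \<le> (\<Sum>i\<in>UNIV. L i * norm (y - x))" using L(2)[OF that] by (intro sum_mono) (simp add: A_def)
    finally show ?thesis by (simp add: l_def sum_distrib_right)
  qed
  have "continuous_on K (a i)" for i using continuous_on_subset[OF smooth_on_continuous[OF assms(2)]] by simp
  then have "continuous_on K A" unfolding A_def[abs_def] by (intro continuous_on_vec_lambda)
  then have cAK: "compact (A ` K)" using assms(3) by (rule compact_continuous_image)
  obtain C1 where C1: "C1 \<ge> 0" "\<And>x y. x \<in> A ` K \<Longrightarrow> y \<in> A ` K \<Longrightarrow>
    \<bar>\<Phi> y - \<Phi> x - (\<Sum>b\<in>Basis. ((y - x) \<bullet> b) * pd b \<Phi> y)\<bar> \<le> C1 * (norm (y - x))\<^sup>2"
    by (rule smooth_on_taylor1[OF assms(1) cAK]) blast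
  obtain C2 where C2: "C2 \<ge> 0" "\<And>x y. x \<in> A ` K \<Longrightarrow> y \<in> A ` K \<Longrightarrow>
    \<bar>2 * (\<Phi> y - \<Phi> x) - (\<Sum>b\<in>Basis. ((y - x) \<bullet> b) * (pd b \<Phi> x + pd b \<Phi> y))\<bar> \<le> C2 * norm (y - x) ^ 3"
    by (rule smooth_on_trapezoid[OF assms(1) cAK]) blast
  have e1: "chain_remainder \<Phi> a x y = \<Phi> (A y) - \<Phi> (A x) - (\<Sum>b\<in>Basis. ((A y - A x) \<bullet> b) * pd b \<Phi> (A y))" for x y
    by (simp add: chain_remainder_def A_def sum_Basis_cart inner_diff_left inner_axis mult.commute)
  have e2: "chain_remainder \<Phi> a x y - chain_remainder \<Phi> a y x =
      2 * (\<Phi> (A y) - \<Phi> (A x)) - (\<Sum>b\<in>Basis. ((A y - A x) \<bullet> b) * (pd b \<Phi> (A x) + pd b \<Phi> (A y)))" for x y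
  proof -
    have n: "(\<Sum>b\<in>Basis. ((A x - A y) \<bullet> b) * pd b \<Phi> (A x)) = - (\<Sum>b\<in>Basis. ((A y - A x) \<bullet> b) * pd b \<Phi> (A x))"
      unfolding sum_negf[symmetric] by (rule sum.cong) (simp_all add: inner_diff_left algebra_simps)
    show ?thesis unfolding e1 n by (simp add: distrib_left sum.distrib)
  qed
  show ?thesis
  proof (rule that[of "C1 * l\<^sup>2 + C2 * l ^ 3"])
    show "0 \<le> C1 * l\<^sup>2 + C2 * l ^ 3" using C1(1) C2(1) l0 by simp
    fix x y assume xy: "x \<in> K" "y \<in> K"
    have "\<bar>chain_remainder \<Phi> a x y\<bar> \<le> C1 * (norm (A y - A x))\<^sup>2" unfolding e1 using C1(2) xy by blast
    also have "\<dots> \<le> C1 * (l * norm (y - x))\<^sup>2" using Al[OF xy] C1(1) by (intro mult_left_mono power_mono) auto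
    also have "\<dots> = C1 * l\<^sup>2 * (norm (y - x))\<^sup>2" by (simp add: power_mult_distrib)
    also have "\<dots> \<le> (C1 * l\<^sup>2 + C2 * l ^ 3) * (norm (y - x))\<^sup>2" using C2(1) l0 by (intro mult_right_mono) auto
    finally show "\<bar>chain_remainder \<Phi> a x y\<bar> \<le> (C1 * l\<^sup>2 + C2 * l ^ 3) * (norm (y - x))\<^sup>2" .
    have "\<bar>chain_remainder \<Phi> a x y - chain_remainder \<Phi> a y x\<bar> \<le> C2 * norm (A y - A x) ^ 3" unfolding e2 using C2(2) xy by blast
    also have "\<dots> \<le> C2 * (l * norm (y - x)) ^ 3" using Al[OF xy] C2(1) by (intro mult_left_mono power_mono) auto
    also have "\<dots> = C2 * l ^ 3 * norm (y - x) ^ 3" by (simp add: power_mult_distrib)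
    also have "\<dots> \<le> (C1 * l\<^sup>2 + C2 * l ^ 3) * norm (y - x) ^ 3" using C1(1) l0 by (intro mult_right_mono) auto
    finally show "\<bar>chain_remainder \<Phi> a x y - chain_remainder \<Phi> a y x\<bar> \<le> (C1 * l\<^sup>2 + C2 * l ^ 3) * norm (y - x) ^ 3" .
  qed
qed

section \<open>Localisation\<close>

lemma compact_union_cball:
  fixes T :: "'a::euclidean_space set"
  assumes "compact T"
  shows "compact (\<Union>y\<in>T. cball y d)"
proof -
  have "compact {x + y |x y. x \<in> T \<and> y \<in> cball 0 d}" using assms by (intro compact_sums) auto
  moreover have "{x + y |x y. x \<in> T \<and> y \<in> cball 0 d} = (\<Union>y\<in>T. cball y d)"
  proof (intro set_eqI iffI)
    fix z assume "z \<in> (\<Union>y\<in>T. cball y d)"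
    then obtain y where "y \<in> T" "dist y z \<le> d" by auto
    then show "z \<in> {x + y |x y. x \<in> T \<and> y \<in> cball 0 d}"
      by (intro CollectI exI[of _ y] exI[of _ "z - y"]) (auto simp: dist_norm norm_minus_commute)
  next
    fix z assume "z \<in> {x + y |x y. x \<in> T \<and> y \<in> cball 0 d}"
    then obtain x y where "z = x + y" "x \<in> T" "norm y \<le> d" by auto
    then show "z \<in> (\<Union>y\<in>T. cball y d)" by (intro UN_I[of x]) (auto simp: dist_norm)
  qed
  ultimately show ?thesis by simp
qed

lemma eventually_compact_subset:
  assumes "incseq V" "\<And>l. open (V l)" "compact K" "K \<subseteq> (\<Union>l. V l)"
  shows "eventually (\<lambda>l. K \<subseteq> V l) sequentially"
proof -
  obtain C where C: "finite C" "K \<subseteq> (\<Union>l\<in>C. V l)"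
    using compactE_image[OF assms(3), of UNIV V] assms(2,4) by metis
  show ?thesis
  proof (rule eventually_sequentiallyI[of "Max (insert 0 C)"])
    fix l assume l: "Max (insert 0 C) \<le> l"
    show "K \<subseteq> V l"
    proof
      fix x assume "x \<in> K"
      then obtain m where m: "m \<in> C" "x \<in> V m" using C by auto
      then have "m \<le> l" using l Max_ge[of "insert 0 C" m] C(1) by auto
      then show "x \<in> V l" using m assms(1) by (auto simp: incseq_def)
    qed
  qed
qed

lemma lim_cong_eventually: "eventually (\<lambda>l. f l = g l) sequentially \<Longrightarrow> lim f = lim g"
  unfolding lim_def by (simp add: tendsto_cong)

text \<open>Once \<open>vs l\<close> is below \<open>d\<close>, a pair in \<open>Lam\<close> whose
  second point is in the support of \<open>g\<close> has both points in \<open>W\<close>. The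
  integrands agree for large \<open>l\<close>, so the values of \<open>lim\<close> agree whether or
  not the limits exist.\<close>

lemma muc0_local:
  assumes vs: "vs \<longlonglongrightarrow> 0" and T: "compact (tsupp g)" and W: "open W" "tsupp g \<subseteq> W"
    and eq: "\<And>x. x \<in> W \<Longrightarrow> \<phi> x = \<phi>' x \<and> \<psi> x = \<psi>' x"
  shows "muc0 sig Om vs \<phi> \<psi> g = muc0 sig Om vs \<phi>' \<psi>' g"
proof -
  obtain d where d: "d > 0" "(\<Union>y\<in>tsupp g. cball y d) \<subseteq> W"
    using compact_subset_open_imp_cball_epsilon_subset[OF T W] by auto
  have "eventually (\<lambda>l. vs l < d) sequentially" using order_tendstoD(2)[OF vs d(1)] .
  then show ?thesis unfolding muc0_def
  proof (intro lim_cong_eventually, eventually_elim)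
    case (elim l)
    have "indicator (Lam (Om l) (vs l)) z * ((\<phi> (snd z) - \<phi> (fst z)) * (\<psi> (snd z) - \<psi> (fst z)) * g (snd z)) =
        indicator (Lam (Om l) (vs l)) z * ((\<phi>' (snd z) - \<phi>' (fst z)) * (\<psi>' (snd z) - \<psi>' (fst z)) * g (snd z))" for z
    proof (cases "g (snd z) = 0 \<or> z \<notin> Lam (Om l) (vs l)")
      case False
      then have y: "snd z \<in> tsupp g" using not_in_tsupp by blast
      have "norm (fst z - snd z) < d" using False elim by (auto simp: Lam_def split: prod.splits)
      then have "fst z \<in> cball (snd z) d" by (simp add: dist_norm norm_minus_commute)
      then have "fst z \<in> W" "snd z \<in> W" using d y W(2) by blast+
      then show ?thesis using eq by simp
    qed auto
    then show ?case by presburger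
  qed
qed

text \<open>The \<open>Lam\<close> part is local for large \<open>l\<close>. In the
  \<open>Gam\<close> part \<open>u\<close> enters only through its derivatives at the second point,
  so this part is local despite jumps of size up to \<open>ds k\<close>.\<close>

lemma Ecd_local:
  assumes vs: "vs \<longlonglongrightarrow> 0" and T: "compact (tsupp v)" and W: "open W" "tsupp v \<subseteq> W"
    and eq: "\<And>x. x \<in> W \<Longrightarrow> u x = u' x"
  shows "Ecd sig Om vs ds u v = Ecd sig Om vs ds u' v"
proof -
  obtain d where d: "d > 0" "(\<Union>y\<in>tsupp v. cball y d) \<subseteq> W"
    using compact_subset_open_imp_cball_epsilon_subset[OF T W] by auto
  have ev: "eventually (\<lambda>l. vs l < d) sequentially" using order_tendstoD(2)[OF vs d(1)] .
  have 2: "indicator (Gam (Om l) (vs l)) z * ((\<Sum>b\<in>Basis. ((snd z - fst z) \<bullet> b) * pd b u (snd z)) *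
           indicator {w. norm (fst w - snd w) \<le> ds k} z * v (snd z)) =
      indicator (Gam (Om l) (vs l)) z * ((\<Sum>b\<in>Basis. ((snd z - fst z) \<bullet> b) * pd b u' (snd z)) *
           indicator {w. norm (fst w - snd w) \<le> ds k} z * v (snd z))" for l k z
  proof (cases "v (snd z) = 0")
    case False
    then have "snd z \<in> W" using not_in_tsupp W(2) by blast
    then have "pd b u (snd z) = pd b u' (snd z)" for b by (intro pd_cong[OF W(1) eq])
    then show ?thesis by simp
  qed simp
  have 1: "indicator (Lam (Om l) (vs l)) z * ((u (snd z) - u (fst z)) * v (snd z)) =
        indicator (Lam (Om l) (vs l)) z * ((u' (snd z) - u' (fst z)) * v (snd z))" if "vs l < d" for z l
  proof (cases "v (snd z) = 0 \<or> z \<notin> Lam (Om l) (vs l)")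
    case False
    then have y: "snd z \<in> tsupp v" using not_in_tsupp by blast
    have "norm (fst z - snd z) < d" using False that by (auto simp: Lam_def split: prod.splits)
    then have "fst z \<in> cball (snd z) d" by (simp add: dist_norm norm_minus_commute)
    then have "fst z \<in> W" "snd z \<in> W" using d y W(2) by blast+
    then show ?thesis using eq by simp
  qed auto
  show ?thesis unfolding Ecd_def
  proof (rule arg_cong[where f = lim], rule ext, rule lim_cong_eventually)
    fix k
    show "eventually (\<lambda>l. Lim at_top (\<lambda>\<beta>::real. \<beta> *
     ((\<integral>z. indicator (Lam (Om l) (vs l)) z * ((u (snd z) - u (fst z)) * v (snd z)) \<partial>sig \<beta>) +
      (\<integral>z. indicator (Gam (Om l) (vs l)) z *
          ((\<Sum>b\<in>Basis. ((snd z - fst z) \<bullet> b) * pd b u (snd z)) *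
           indicator {w. norm (fst w - snd w) \<le> ds k} z * v (snd z)) \<partial>sig \<beta>))) =
      Lim at_top (\<lambda>\<beta>::real. \<beta> *
     ((\<integral>z. indicator (Lam (Om l) (vs l)) z * ((u' (snd z) - u' (fst z)) * v (snd z)) \<partial>sig \<beta>) +
      (\<integral>z. indicator (Gam (Om l) (vs l)) z *
          ((\<Sum>b\<in>Basis. ((snd z - fst z) \<bullet> b) * pd b u' (snd z)) *
           indicator {w. norm (fst w - snd w) \<le> ds k} z * v (snd z)) \<partial>sig \<beta>)))) sequentially"
      using ev by eventually_elim (simp only: 1 2)
  qed
qed

text \<open>The infimum over an empty frontier is infinite, whereas \<open>infdist\<close> to the
  empty set is 0; this case is therefore split off.\<close>

lemma Udelta_iff:
  "x \<in> Udelta U \<delta> \<longleftrightarrow> x \<in> U \<and> (frontier U = {} \<or> \<delta> < infdist x (frontier U))"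
proof (cases "frontier U = {}")
  case True
  then show ?thesis by (simp add: Udelta_def top_ereal_def)
next
  case False
  have "ereal \<delta> < (INF y\<in>frontier U. ereal (dist x y)) \<longleftrightarrow> \<delta> < infdist x (frontier U)"
  proof
    assume "ereal \<delta> < (INF y\<in>frontier U. ereal (dist x y))"
    then obtain r where r: "ereal \<delta> < ereal r" "ereal r < (INF y\<in>frontier U. ereal (dist x y))"
      using ereal_dense2 by blast
    have "r \<le> dist x y" if "y \<in> frontier U" for y
      using r(2) that less_INF_D by fastforce
    then have "r \<le> infdist x (frontier U)" unfolding infdist_notempty[OF False] using False by (intro cINF_greatest)
    then show "\<delta> < infdist x (frontier U)" using r(1) by simp
  next
    assume a: "\<delta> < infdist x (frontier U)"
    have "ereal (infdist x (frontier U)) \<le> (INF y\<in>frontier U. ereal (dist x y))"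
      by (intro INF_greatest) (simp add: infdist_le)
    then show "ereal \<delta> < (INF y\<in>frontier U. ereal (dist x y))" using a by (meson less_ereal.simps(1) less_le_trans)
  qed
  then show ?thesis using False by (simp add: Udelta_def)
qed

lemma Udelta_subset: "Udelta U \<delta> \<subseteq> U"
  by (auto simp: Udelta_def)

lemma open_Udelta:
  assumes "open U"
  shows "open (Udelta U \<delta>)"
proof (cases "frontier U = {}")
  case True
  then have "Udelta U \<delta> = U" by (auto simp: Udelta_iff)
  then show ?thesis using assms by simp
next
  case False
  then have "Udelta U \<delta> = U \<inter> {x. \<delta> < infdist x (frontier U)}" by (auto simp: Udelta_iff)
  moreover have "open {x. \<delta> < infdist x (frontier U)}" by (intro open_Collect_less continuous_intros)
  ultimately show ?thesis using assms by (simp add: open_Int)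
qed

text \<open>The distance to the frontier attains a minimum on \<open>T\<close>, strictly above
  \<delta>, and a segment from \<open>T\<close> that leaves \<open>U\<close> must cross the
  frontier. The room between \<delta> and \<open>d\<close> is for the cutoffs \<open>ds k\<close>,
  which may exceed \<delta>.\<close>

lemma Udelta_enlarge:
  assumes "compact T" "T \<subseteq> Udelta U \<delta>"
  obtains d where "d > \<delta>" "(\<Union>y\<in>T. cball y d) \<subseteq> U"
proof (cases "frontier U = {} \<or> T = {}")
  case True
  then show ?thesis
  proof
    assume "frontier U = {}"
    then have "U = {} \<or> U = UNIV" by (simp add: frontier_eq_empty)
    then show ?thesis using assms(2) Udelta_subset[of U \<delta>] by (intro that[of "\<delta> + 1"]) auto
  qed (use that[of "\<delta> + 1"] in auto)
next
  case False
  have "continuous_on T (\<lambda>x. infdist x (frontier U))" by (intro continuous_intros)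
  then obtain x0 where x0: "x0 \<in> T" "\<And>x. x \<in> T \<Longrightarrow> infdist x0 (frontier U) \<le> infdist x (frontier U)"
    using continuous_attains_inf[OF assms(1)] False by blast
  have "\<delta> < infdist x0 (frontier U)" using x0(1) assms(2) False by (auto simp: Udelta_iff)
  then obtain d where d: "\<delta> < d" "d < infdist x0 (frontier U)" using dense by blast
  have "(\<Union>y\<in>T. cball y d) \<subseteq> U"
  proof
    fix z assume "z \<in> (\<Union>y\<in>T. cball y d)"
    then obtain y where y: "y \<in> T" "dist y z \<le> d" by auto
    show "z \<in> U"
    proof (rule ccontr)
      assume "z \<notin> U"
      have "y \<in> U" using y(1) assms(2) Udelta_subset by blast
      have "closed_segment y z \<inter> frontier U \<noteq> {}"
        using \<open>z \<notin> U\<close> \<open>y \<in> U\<close> by (intro connected_Int_frontier) auto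
      then obtain p where p: "p \<in> closed_segment y z" "p \<in> frontier U" by auto
      have "infdist y (frontier U) \<le> dist y p" by (rule infdist_le[OF p(2)])
      also have "\<dots> \<le> dist y z" using dist_in_closed_segment[OF p(1)] by (simp add: dist_commute)
      finally show False using y x0(2)[OF y(1)] d(2) by simp
    qed
  qed
  then show ?thesis using that d(1) by blast
qed

section \<open>The iterated limits in closed form\<close>

locale jump_limit_cutoffs = jump_limit +
  fixes \<delta> :: real and Om :: "nat \<Rightarrow> 'a set" and vs ds :: "nat \<Rightarrow> real"
  assumes \<delta>_pos: "\<delta> > 0" and cutoffs: "admissible_cutoffs U J \<delta> Om vs ds"
begin

lemma open_Om: "open (Om l)" and incseq_Om: "incseq Om" and Union_Om: "(\<Union>l. Om l) = U"
  and vs_pos: "vs l > 0" and vs_lim: "vs \<longlonglongrightarrow> 0"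
  and null_frontier: "emeasure J (frontier (Gam (Om l) (vs l))) = 0"
  and ds_ge: "ds k \<ge> \<delta>" and ds_lim: "ds \<longlonglongrightarrow> \<delta>"
  and null_ds: "emeasure J {z. norm (fst z - snd z) = ds k} = 0"
  using cutoffs unfolding admissible_cutoffs_def by auto

lemma eventually_subset_Om: "compact K \<Longrightarrow> K \<subseteq> U \<Longrightarrow> eventually (\<lambda>l. K \<subseteq> Om l) sequentially"
  by (rule eventually_compact_subset[OF incseq_Om open_Om]) (auto simp: Union_Om)

lemma AE_gap_ds: "AE z in J. gap z \<noteq> ds k"
proof (rule AE_I)
  have "closed {z::'a \<times> 'a. gap z = ds k}" by (intro closed_Collect_eq continuous_intros)
  then show "{z::'a \<times> 'a. norm (fst z - snd z) = ds k} \<in> sets J" by (simp add: sets_J gap_def)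
qed (auto simp: null_ds gap_def)

lemma AE_not_frontier: "AE z in J. z \<notin> frontier (Gam (Om l) (vs l))"
  using null_frontier[of l] by (intro AE_not_in null_setsI) (auto simp: sets_J)

text \<open>Makes the null frontier of \<open>Gam\<close> usable for thresholds in the gap: a pair
  at gap exactly \<open>s\<close> is in \<open>Gam\<close>, but moving one component towards the
  other leaves it at once.\<close>

lemma gap_eq_in_frontier:
  assumes "gap z = s" "s > 0" "fst z \<in> O'" "snd z \<in> O'"
  shows "z \<in> frontier (Gam O' s)"
proof -
  obtain x y where z: "z = (x, y)" by (cases z)
  have zG: "z \<in> Gam O' s" using assms by (simp add: Gam_def z gap_def)
  have "z \<notin> interior (Gam O' s)"
  proof
    assume "z \<in> interior (Gam O' s)"
    then obtain e where e: "e > 0" "ball z e \<subseteq> Gam O' s"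
      unfolding mem_interior by blast
    \<comment> \<open>Moving the first component by the fraction \<open>t\<close> covers the
      distance \<open>t * s\<close>, which has to stay below \<open>e\<close>.\<close>
    define t where "t = min (1/2) (e / (2 * s))"
    have t: "0 < t" "t < 1" "t * s < e" using e(1) assms(2) by (auto simp: t_def min_def field_simps)
    define w where "w = (x + t *\<^sub>R (y - x), y)"
    have "dist z w = t * s"
      using assms(1) t by (simp add: z w_def dist_Pair_Pair dist_norm gap_def norm_minus_commute)
    then have "w \<in> Gam O' s" using e(2) t(3) by auto
    moreover have "x + t *\<^sub>R (y - x) - y = (1 - t) *\<^sub>R (x - y)" by (simp add: algebra_simps)
    then have "norm (x + t *\<^sub>R (y - x) - y) = (1 - t) * s" using t assms(1) by (simp add: z gap_def)
    ultimately show False using t assms(2) by (simp add: Gam_def w_def)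
  qed
  then show ?thesis using zG closure_subset[of "Gam O' s"] by (auto simp: frontier_def)
qed

lemma eventually_admissible:
  assumes T: "compact T" and d: "d > 0" and sub: "(\<Union>y\<in>T. cball y d) \<subseteq> U"
  shows "eventually (\<lambda>l. vs l < d \<and> (\<Union>y\<in>T. cball y d) \<subseteq> Om l) sequentially"
  using order_tendstoD(2)[OF vs_lim d] eventually_subset_Om[OF compact_union_cball[OF T] sub]
  by eventually_elim auto

lemma AE_gap_vs:
  assumes "vs l < d" "(\<Union>y\<in>T. cball y d) \<subseteq> Om l"
  shows "AE z in J. gap z = vs l \<longrightarrow> snd z \<notin> T"
  using AE_not_frontier[of l]
proof eventually_elim
  case (elim z)
  show ?case
  proof (intro impI notI)
    assume g: "gap z = vs l" and y: "snd z \<in> T"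
    have "snd z \<in> cball (snd z) d" "fst z \<in> cball (snd z) d"
      using g assms(1) vs_pos[of l] by (auto simp: gap_def dist_norm norm_minus_commute)
    then have "fst z \<in> Om l" "snd z \<in> Om l" using y assms(2) by blast+
    then show False using gap_eq_in_frontier[OF g vs_pos] elim by blast
  qed
qed

lemma cutoff_eq_1:
  assumes "snd z \<in> T" "gap z \<le> d" "\<And>x. x \<in> (\<Union>y\<in>T. cball y d) \<Longrightarrow> \<kappa> x = (1::real)"
  shows "\<kappa> (fst z) = 1" "fst z \<in> (\<Union>y\<in>T. cball y d)" "snd z \<in> (\<Union>y\<in>T. cball y d)"
proof -
  show m: "fst z \<in> (\<Union>y\<in>T. cball y d)"
    using assms(1,2) by (intro UN_I[of "snd z"]) (auto simp: gap_def dist_norm norm_minus_commute)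
  show "snd z \<in> (\<Union>y\<in>T. cball y d)"
    using assms(1) order_trans[OF gap_nonneg assms(2)] by (intro UN_I[of "snd z"]) auto
  show "\<kappa> (fst z) = 1" by (rule assms(3)[OF m])
qed

text \<open>If the second point is in \<open>T\<close> and the gap is below \<open>vs l < d\<close>,
  both points lie in \<open>Om l\<close> and \<kappa> is 1 at the first. The sharp domain gives way
  to a threshold in the gap and a factor \<kappa>.\<close>

lemma Lam_integrand:
  assumes "vs l < d" "(\<Union>y\<in>T. cball y d) \<subseteq> Om l" "\<And>y. y \<notin> T \<Longrightarrow> v y = 0"
    and "\<And>x. x \<in> (\<Union>y\<in>T. cball y d) \<Longrightarrow> \<kappa> x = (1::real)"
  shows "indicator (Lam (Om l) (vs l)) z * (F * v (snd z)) = indicator {..<vs l} (gap z) * (F * v (snd z) * \<kappa> (fst z))"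
proof (cases "snd z \<in> T \<and> gap z < vs l")
  case True
  then have "gap z \<le> d" using assms(1) by simp
  note c = cutoff_eq_1[where \<kappa> = \<kappa>, OF conjunct1[OF True] this assms(4)]
  have "z \<in> Lam (Om l) (vs l)"
    using subsetD[OF assms(2) c(2)] subsetD[OF assms(2) c(3)] True by (auto simp: Lam_def gap_def split: prod.splits)
  then show ?thesis using True c(1) by simp
next
  case False
  then consider "snd z \<notin> T" | "\<not> gap z < vs l" by blast
  then show ?thesis
  proof cases
    case 2
    then have "z \<notin> Lam (Om l) (vs l)" by (auto simp: Lam_def gap_def split: prod.splits)
    then show ?thesis using 2 by simp
  qed (simp add: assms(3))
qed

lemma Gam_integrand:
  assumes "t \<le> d" "(\<Union>y\<in>T. cball y d) \<subseteq> Om l" "\<And>y. y \<notin> T \<Longrightarrow> v y = 0"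
    and "\<And>x. x \<in> (\<Union>y\<in>T. cball y d) \<Longrightarrow> \<kappa> x = (1::real)"
  shows "indicator (Gam (Om l) (vs l)) z * (F * indicator {w. norm (fst w - snd w) \<le> t} z * v (snd z))
    = indicator {vs l..t} (gap z) * (F * v (snd z) * \<kappa> (fst z))"
proof (cases "snd z \<in> T \<and> gap z \<le> t")
  case True
  then have "gap z \<le> d" using assms(1) by simp
  note c = cutoff_eq_1[where \<kappa> = \<kappa>, OF conjunct1[OF True] this assms(4)]
  note k = c(1) and subsetD[OF assms(2) c(2)] subsetD[OF assms(2) c(3)]
  then have "z \<in> Gam (Om l) (vs l) \<longleftrightarrow> vs l \<le> gap z" by (auto simp: Gam_def gap_def split: prod.splits)
  then show ?thesis using True k by (auto simp: indicator_def gap_def)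
next
  case False
  then consider "snd z \<notin> T" | "\<not> gap z \<le> t" by blast
  then show ?thesis by cases (simp_all add: assms(3) gap_def)
qed

text \<open>Expanding leaves four products. The term \<open>\<phi>(y) \<psi>(y) g(y)\<close> has no
  factor in \<open>x\<close>; \<kappa> supplies a compactly supported one.\<close>

lemma carre_product_sum:
  assumes "test_fun U \<phi>" "test_fun U \<psi>" "test_fun U g" "test_fun U \<kappa>"
  shows "product_sum U U (\<lambda>z. (\<phi> (snd z) - \<phi> (fst z)) * (\<psi> (snd z) - \<psi> (fst z)) * g (snd z) * \<kappa> (fst z))"
proof -
  note sm = test_fun_def[of U \<phi>] test_fun_def[of U \<psi>]
  note m = test_fun_mult[OF open_U]
  have 1: "product_sum U U (\<lambda>z. \<kappa> (fst z) * (g (snd z) * \<phi> (snd z) * \<psi> (snd z)))"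
    and 2: "product_sum U U (\<lambda>z. (\<kappa> (fst z) * \<phi> (fst z)) * (g (snd z) * \<psi> (snd z)))"
    and 3: "product_sum U U (\<lambda>z. (\<kappa> (fst z) * \<psi> (fst z)) * (g (snd z) * \<phi> (snd z)))"
    and 4: "product_sum U U (\<lambda>z. (\<kappa> (fst z) * \<phi> (fst z) * \<psi> (fst z)) * g (snd z))"
    using assms by (auto intro!: product_sum_mult m simp: sm)
  have "product_sum U U (\<lambda>z. ((\<kappa> (fst z) * (g (snd z) * \<phi> (snd z) * \<psi> (snd z)) + (\<kappa> (fst z) * \<phi> (fst z) * \<psi> (fst z)) * g (snd z))
     - (\<kappa> (fst z) * \<phi> (fst z)) * (g (snd z) * \<psi> (snd z))) - (\<kappa> (fst z) * \<psi> (fst z)) * (g (snd z) * \<phi> (snd z)))"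
    by (intro product_sum_diff[OF open_U open_U] product_sum_add 1 2 3 4)
  then show ?thesis by (simp add: algebra_simps)
qed

lemma test_fun_lipschitz:
  assumes "test_fun U f" "compact K"
  obtains C where "C \<ge> 0" "\<And>x y. x \<in> K \<Longrightarrow> y \<in> K \<Longrightarrow> \<bar>f y - f x\<bar> \<le> C * norm (y - x)"
  by (rule smooth_on_lipschitz[OF test_fun_smooth[OF open_U assms(1)] assms(2)]) blast

text \<open>The integrand is of second order and so already integrable under \<open>J\<close>;
  \<open>truncated_limit\<close> is applied with the compensator 0 and the arbitrary threshold
  1.\<close>

lemma muc0_formula:
  assumes \<phi>: "test_fun U \<phi>" and \<psi>: "test_fun U \<psi>" and g: "test_fun U g" and \<kappa>: "test_fun U \<kappa>"
    and T: "compact T" and d: "d > 0" and sub: "(\<Union>y\<in>T. cball y d) \<subseteq> U" and gT: "\<And>y. y \<notin> T \<Longrightarrow> g y = 0"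
    and \<kappa>1: "\<And>x. x \<in> (\<Union>y\<in>T. cball y d) \<Longrightarrow> \<kappa> x = 1"
  defines "H \<equiv> \<lambda>z. (\<phi> (snd z) - \<phi> (fst z)) * (\<psi> (snd z) - \<psi> (fst z)) * g (snd z) * \<kappa> (fst z)"
  obtains L where "tend H L" "integrable J H" "muc0 sig Om vs \<phi> \<psi> g = L - 2 * integral\<^sup>L J H"
proof -
  have ps: "product_sum U U H" unfolding H_def by (rule carre_product_sum[OF \<phi> \<psi> g \<kappa>])
  have cc: "cc_fun (U \<times> U) H" by (rule product_sum_cc_fun[OF open_U open_U ps])
  obtain L where L: "tend H L" by (rule product_sum_tend[OF ps]) (auto simp: H_def)
  define K where "K = tsupp \<kappa> \<union> tsupp g"
  have K: "compact K" using \<kappa> g by (auto simp: K_def test_fun_def)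
  obtain C1 where C1: "C1 \<ge> 0" "\<And>x y. x \<in> K \<Longrightarrow> y \<in> K \<Longrightarrow> \<bar>\<phi> y - \<phi> x\<bar> \<le> C1 * norm (y - x)"
    by (rule test_fun_lipschitz[OF \<phi> K]) blast
  obtain C2 where C2: "C2 \<ge> 0" "\<And>x y. x \<in> K \<Longrightarrow> y \<in> K \<Longrightarrow> \<bar>\<psi> y - \<psi> x\<bar> \<le> C2 * norm (y - x)"
    by (rule test_fun_lipschitz[OF \<psi> K]) blast
  obtain B1 where B1: "B1 \<ge> 0" "\<And>x. \<bar>g x\<bar> \<le> B1" by (rule test_fun_bounded[OF open_U g]) blast
  obtain B2 where B2: "B2 \<ge> 0" "\<And>x. \<bar>\<kappa> x\<bar> \<le> B2" by (rule test_fun_bounded[OF open_U \<kappa>]) blast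
  have close: "\<bar>H z - 0\<bar> \<le> (C1 * C2 * B1 * B2) * (gap z)\<^sup>2" for z
  proof (cases "g (snd z) = 0 \<or> \<kappa> (fst z) = 0")
    case False
    then have k: "fst z \<in> K" "snd z \<in> K" using not_in_tsupp by (auto simp: K_def)
    have n: "norm (snd z - fst z) = gap z" by (simp add: gap_def norm_minus_commute)
    have "\<bar>H z\<bar> \<le> (C1 * gap z) * (C2 * gap z) * B1 * B2"
      unfolding H_def abs_mult using C1(2)[OF k] C2(2)[OF k] B1 B2 C1(1) C2(1) gap_nonneg[of z]
      by (intro mult_mono mult_nonneg_nonneg) (auto simp: n)
    then show ?thesis by (simp add: power2_eq_square mult_ac)
  qed (use C1 C2 B1 B2 in \<open>auto simp: H_def\<close>)
  have iH: "integrable J H" by (rule second_order_integrable_J[OF cc, of "C1 * C2 * B1 * B2"]) (use close in simp)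
  have ev: "eventually (\<lambda>l. vs l < d \<and> (\<Union>y\<in>T. cball y d) \<subseteq> Om l) sequentially"
    by (rule eventually_admissible[OF T d sub])
  have cc0: "cc_fun (U \<times> U) (\<lambda>z::'a\<times>'a. 0)" by (rule cc_funI[of "{}"]) auto
  have "(\<lambda>l. Lim at_top (\<lambda>\<beta>. \<beta> * ((\<integral>z. indicator {..<vs l} (gap z) * H z \<partial>sig \<beta>) + (\<integral>z. indicator {vs l..1} (gap z) * 0 \<partial>sig \<beta>))))
    \<longlonglongrightarrow> L - 2 * (\<integral>z. H z - indicator {..1} (gap z) * 0 \<partial>J)"
  proof (rule truncated_limit[OF cc cc0 L close vs_pos vs_lim])
    show "eventually (\<lambda>l. AE z in J. gap z = vs l \<longrightarrow> H z = 0 \<and> (0::real) = 0) sequentially"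
      using ev
    proof eventually_elim
      case (elim l)
      have "AE z in J. gap z = vs l \<longrightarrow> snd z \<notin> T" using elim by (intro AE_gap_vs) auto
      then show ?case by eventually_elim (auto simp: H_def gT)
    qed
  qed auto
  then have lim: "(\<lambda>l. Lim at_top (\<lambda>\<beta>. \<beta> * (\<integral>z. indicator {..<vs l} (gap z) * H z \<partial>sig \<beta>))) \<longlonglongrightarrow> L - 2 * integral\<^sup>L J H"
    by simp
  have "muc0 sig Om vs \<phi> \<psi> g = lim (\<lambda>l. Lim at_top (\<lambda>\<beta>. \<beta> * (\<integral>z. indicator {..<vs l} (gap z) * H z \<partial>sig \<beta>)))"
    unfolding muc0_def
  proof (rule lim_cong_eventually)
    show "eventually (\<lambda>l. Lim at_top (\<lambda>\<beta>::real. \<beta> *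
     (\<integral>z. indicator (Lam (Om l) (vs l)) z *
         ((\<phi> (snd z) - \<phi> (fst z)) * (\<psi> (snd z) - \<psi> (fst z)) * g (snd z)) \<partial>sig \<beta>)) =
      Lim at_top (\<lambda>\<beta>. \<beta> * (\<integral>z. indicator {..<vs l} (gap z) * H z \<partial>sig \<beta>))) sequentially"
      using ev
    proof eventually_elim
      case (elim l)
      have "indicator (Lam (Om l) (vs l)) z * ((\<phi> (snd z) - \<phi> (fst z)) * (\<psi> (snd z) - \<psi> (fst z)) * g (snd z)) =
          indicator {..<vs l} (gap z) * H z" for z
        unfolding H_def by (rule Lam_integrand[OF _ _ gT \<kappa>1]) (use elim in auto)
      then show ?case by (simp only:)
    qed
  qed
  also have "\<dots> = L - 2 * integral\<^sup>L J H" by (rule limI[OF lim])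
  finally show ?thesis using that L iH by blast
qed

lemma Ecd_product_sum:
  assumes "test_fun U u" "test_fun U v" "test_fun U \<kappa>"
  shows "product_sum U U (\<lambda>z. (u (snd z) - u (fst z)) * v (snd z) * \<kappa> (fst z))"
proof -
  note m = test_fun_mult[OF open_U]
  have 1: "product_sum U U (\<lambda>z. \<kappa> (fst z) * (v (snd z) * u (snd z)))"
    and 2: "product_sum U U (\<lambda>z. (\<kappa> (fst z) * u (fst z)) * v (snd z))"
    using assms by (auto intro!: product_sum_mult m simp: test_fun_def[of U u])
  from product_sum_diff[OF open_U open_U 1 2] show ?thesis by (simp add: algebra_simps)
qed

lemma Ecd_compensator_cc_fun:
  assumes "test_fun U u" "test_fun U v" "test_fun U \<kappa>"
  shows "cc_fun (U \<times> U) (\<lambda>z. (\<Sum>b\<in>Basis. ((snd z - fst z) \<bullet> b) * pd b u (snd z)) * v (snd z) * \<kappa> (fst z))"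
proof -
  have "product_sum U U (\<lambda>z. (\<kappa> (fst z) * (v (snd z) * pd b u (snd z))) * ((snd z - fst z) \<bullet> b))" if b: "b \<in> Basis" for b
  proof (rule product_sum_polynomial_mult[OF real_polynomial_function.intros(1) open_U open_U])
    show "bounded_linear (\<lambda>z::'a\<times>'a. (snd z - fst z) \<bullet> b)"
      by (intro bounded_linear_inner_left_comp bounded_linear_sub bounded_linear_fst bounded_linear_snd)
    have "smooth_on U (pd b u)" using assms(1) b by (intro smooth_on_pd) (auto simp: test_fun_def)
    then show "product_sum U U (\<lambda>z. \<kappa> (fst z) * (v (snd z) * pd b u (snd z)))"
      by (intro product_sum_mult assms test_fun_mult[OF open_U])
  qed
  then have "product_sum U U (\<lambda>z. \<Sum>b\<in>Basis. (\<kappa> (fst z) * (v (snd z) * pd b u (snd z))) * ((snd z - fst z) \<bullet> b))"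
    by (rule product_sum_sum)
  from product_sum_cc_fun[OF open_U open_U this] show ?thesis
    by (simp add: sum_distrib_left sum_distrib_right mult_ac)
qed

text \<open>The increment of \<open>u\<close> is only of first order, but by Taylor's formula it
  differs from its compensator by a term of second order. Since \<open>d > \<delta>\<close>, the
  jumps up to \<open>ds k\<close> are within reach of the cutoff \<kappa> for all large
  \<open>k\<close>, which is all that the outer limit sees.\<close>

lemma Ecd_formula:
  assumes u: "test_fun U u" and v: "test_fun U v" and \<kappa>: "test_fun U \<kappa>"
    and T: "compact T" and d: "d > \<delta>" and sub: "(\<Union>y\<in>T. cball y d) \<subseteq> U" and vT: "\<And>y. y \<notin> T \<Longrightarrow> v y = 0"
    and \<kappa>1: "\<And>x. x \<in> (\<Union>y\<in>T. cball y d) \<Longrightarrow> \<kappa> x = 1"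
  defines "H1 \<equiv> \<lambda>z. (u (snd z) - u (fst z)) * v (snd z) * \<kappa> (fst z)"
    and "H2 \<equiv> \<lambda>z. (\<Sum>b\<in>Basis. ((snd z - fst z) \<bullet> b) * pd b u (snd z)) * v (snd z) * \<kappa> (fst z)"
  obtains L where "tend H1 L" "integrable J (\<lambda>z. H1 z - indicator {..\<delta>} (gap z) * H2 z)"
    "Ecd sig Om vs ds u v = L - 2 * (\<integral>z. H1 z - indicator {..\<delta>} (gap z) * H2 z \<partial>J)"
proof -
  have d0: "d > 0" using d \<delta>_pos by simp
  have ps: "product_sum U U H1" unfolding H1_def by (rule Ecd_product_sum[OF u v \<kappa>])
  have cc: "cc_fun (U \<times> U) H1" by (rule product_sum_cc_fun[OF open_U open_U ps])
  have cc2: "cc_fun (U \<times> U) H2" unfolding H2_def by (rule Ecd_compensator_cc_fun[OF u v \<kappa>])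
  obtain L where L: "tend H1 L" by (rule product_sum_tend[OF ps]) (auto simp: H1_def)
  define K where "K = tsupp \<kappa> \<union> tsupp v"
  have K: "compact K" using \<kappa> v by (auto simp: K_def test_fun_def)
  obtain C where C: "C \<ge> 0" "\<And>x y. x \<in> K \<Longrightarrow> y \<in> K \<Longrightarrow>
    \<bar>u y - u x - (\<Sum>b\<in>Basis. ((y - x) \<bullet> b) * pd b u y)\<bar> \<le> C * (norm (y - x))\<^sup>2"
    by (rule smooth_on_taylor1[OF test_fun_smooth[OF open_U u] K]) blast
  obtain B1 where B1: "B1 \<ge> 0" "\<And>x. \<bar>v x\<bar> \<le> B1" by (rule test_fun_bounded[OF open_U v]) blast
  obtain B2 where B2: "B2 \<ge> 0" "\<And>x. \<bar>\<kappa> x\<bar> \<le> B2" by (rule test_fun_bounded[OF open_U \<kappa>]) blast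
  have close: "\<bar>H1 z - H2 z\<bar> \<le> (C * B1 * B2) * (gap z)\<^sup>2" for z
  proof (cases "v (snd z) = 0 \<or> \<kappa> (fst z) = 0")
    case False
    then have k: "fst z \<in> K" "snd z \<in> K" using not_in_tsupp by (auto simp: K_def)
    have n: "norm (snd z - fst z) = gap z" by (simp add: gap_def norm_minus_commute)
    have "\<bar>H1 z - H2 z\<bar> = \<bar>u (snd z) - u (fst z) - (\<Sum>b\<in>Basis. ((snd z - fst z) \<bullet> b) * pd b u (snd z))\<bar> * \<bar>v (snd z)\<bar> * \<bar>\<kappa> (fst z)\<bar>"
      unfolding H1_def H2_def abs_mult[symmetric] by (simp only: left_diff_distrib)
    also have "\<dots> \<le> (C * (gap z)\<^sup>2) * B1 * B2"
      using C(2)[OF k] B1 B2 C(1) by (intro mult_mono mult_nonneg_nonneg) (auto simp: n)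
    finally show ?thesis by (simp add: mult_ac)
  qed (use C B1 B2 in \<open>auto simp: H1_def H2_def\<close>)
  have ev: "eventually (\<lambda>l. vs l < d \<and> (\<Union>y\<in>T. cball y d) \<subseteq> Om l) sequentially"
    by (rule eventually_admissible[OF T d0 sub])
  have lim: "(\<lambda>l. Lim at_top (\<lambda>\<beta>. \<beta> * ((\<integral>z. indicator {..<vs l} (gap z) * H1 z \<partial>sig \<beta>) + (\<integral>z. indicator {vs l..ds k} (gap z) * H2 z \<partial>sig \<beta>))))
    \<longlonglongrightarrow> L - 2 * (\<integral>z. H1 z - indicator {..ds k} (gap z) * H2 z \<partial>J)" for k
  proof (rule truncated_limit[OF cc cc2 L close vs_pos vs_lim])
    show "ds k > 0" using ds_ge[of k] \<delta>_pos by linarith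
    show "eventually (\<lambda>l. AE z in J. gap z = vs l \<longrightarrow> H1 z = 0 \<and> H2 z = 0) sequentially"
      using ev
    proof eventually_elim
      case (elim l)
      have "AE z in J. gap z = vs l \<longrightarrow> snd z \<notin> T" using elim by (intro AE_gap_vs) auto
      then show ?case by eventually_elim (auto simp: H1_def H2_def vT)
    qed
    show "AE z in J. gap z = ds k \<longrightarrow> H2 z = 0" using AE_gap_ds[of k] by eventually_elim simp
  qed
  define R where "R k = L - 2 * (\<integral>z. H1 z - indicator {..ds k} (gap z) * H2 z \<partial>J)" for k
  have "Ecd sig Om vs ds u v = lim R"
    unfolding Ecd_def
  proof (rule lim_cong_eventually)
    show "eventually (\<lambda>k. lim (\<lambda>l. Lim at_top (\<lambda>\<beta>::real. \<beta> *
     ((\<integral>z. indicator (Lam (Om l) (vs l)) z * ((u (snd z) - u (fst z)) * v (snd z)) \<partial>sig \<beta>) +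
      (\<integral>z. indicator (Gam (Om l) (vs l)) z *
          ((\<Sum>b\<in>Basis. ((snd z - fst z) \<bullet> b) * pd b u (snd z)) *
           indicator {w. norm (fst w - snd w) \<le> ds k} z * v (snd z)) \<partial>sig \<beta>)))) = R k) sequentially"
      using order_tendstoD(2)[OF ds_lim d]
    proof eventually_elim
      case (elim k)
      have "lim (\<lambda>l. Lim at_top (\<lambda>\<beta>::real. \<beta> *
         ((\<integral>z. indicator (Lam (Om l) (vs l)) z * ((u (snd z) - u (fst z)) * v (snd z)) \<partial>sig \<beta>) +
          (\<integral>z. indicator (Gam (Om l) (vs l)) z *
              ((\<Sum>b\<in>Basis. ((snd z - fst z) \<bullet> b) * pd b u (snd z)) *
               indicator {w. norm (fst w - snd w) \<le> ds k} z * v (snd z)) \<partial>sig \<beta>)))) =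
        lim (\<lambda>l. Lim at_top (\<lambda>\<beta>. \<beta> * ((\<integral>z. indicator {..<vs l} (gap z) * H1 z \<partial>sig \<beta>) + (\<integral>z. indicator {vs l..ds k} (gap z) * H2 z \<partial>sig \<beta>))))"
        using ev
      proof (intro lim_cong_eventually, eventually_elim)
        case (elim l)
        have e1: "indicator (Lam (Om l) (vs l)) z * ((u (snd z) - u (fst z)) * v (snd z)) = indicator {..<vs l} (gap z) * H1 z" for z
          unfolding H1_def by (rule Lam_integrand[OF _ _ vT \<kappa>1]) (use elim in auto)
        have e2: "indicator (Gam (Om l) (vs l)) z *
              ((\<Sum>b\<in>Basis. ((snd z - fst z) \<bullet> b) * pd b u (snd z)) *
               indicator {w. norm (fst w - snd w) \<le> ds k} z * v (snd z)) = indicator {vs l..ds k} (gap z) * H2 z" for z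
          unfolding H2_def by (rule Gam_integrand[OF _ _ vT \<kappa>1]) (use elim \<open>ds k < d\<close> in auto)
        show ?case by (simp only: e1 e2)
      qed
      also have "\<dots> = R k" unfolding R_def by (rule limI[OF lim])
      finally show ?case .
    qed
  qed
  also have "R \<longlonglongrightarrow> L - 2 * (\<integral>z. H1 z - indicator {..\<delta>} (gap z) * H2 z \<partial>J)"
    unfolding R_def[abs_def] by (intro tendsto_intros compensator_limit[OF cc cc2 close ds_ge ds_lim \<delta>_pos])
  then have "lim R = L - 2 * (\<integral>z. H1 z - indicator {..\<delta>} (gap z) * H2 z \<partial>J)" by (rule limI)
  finally show ?thesis using that L compensated_integrable_J[OF cc cc2 close \<delta>_pos] by blast
qed

end

section \<open>The chain rule for test functions and its defect\<close>

definition chain_defect ::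
  "(real ^ 'm \<Rightarrow> real) \<Rightarrow> ('m::finite \<Rightarrow> 'a \<Rightarrow> real) \<Rightarrow> ('a \<Rightarrow> real) \<Rightarrow> ('a \<Rightarrow> real) \<Rightarrow> 'a \<times> 'a \<Rightarrow> real" where
  "chain_defect \<Phi> a h \<kappa> z = \<kappa> (fst z) * h (snd z) * chain_remainder \<Phi> a (fst z) (snd z)"

context jump_limit_cutoffs begin

text \<open>The integrands of the two sides differ by the increment of \<open>v\<close> times the
  chain remainder, first order times second order, and a cubic term has no contribution from the
  diagonal.\<close>

lemma muc0_chain_rule:
  fixes \<Phi> :: "real ^ 'm \<Rightarrow> real"
  assumes \<Phi>: "smooth_on UNIV \<Phi>" and a: "\<And>i. test_fun U (a i)" and v: "test_fun U v" and g: "test_fun U g"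
    and W: "open W" "tsupp g \<subseteq> W" and p: "\<And>x. x \<in> W \<Longrightarrow> p x = \<Phi> (\<chi> j. a j x)"
  shows "muc0 sig Om vs p v g = (\<Sum>i\<in>UNIV. muc0 sig Om vs (a i) v (\<lambda>x. pd (axis i 1) \<Phi> (\<chi> j. a j x) * g x))"
proof -
  define T where "T = tsupp g"
  have T: "compact T" "T \<subseteq> U" using g by (auto simp: T_def test_fun_def)
  obtain d where d: "d > 0" "(\<Union>y\<in>T. cball y d) \<subseteq> U"
    using compact_subset_open_imp_cball_epsilon_subset[OF T(1) open_U T(2)] by auto
  obtain \<kappa> where \<kappa>: "test_fun U \<kappa>" "\<And>x. x \<in> (\<Union>y\<in>T. cball y d) \<Longrightarrow> \<kappa> x = 1"
    using exists_cutoff[OF open_U compact_union_cball[OF T(1)] d(2)] by (metis subsetD)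
  define K where "K = tsupp \<kappa> \<union> T"
  have K: "compact K" "K \<subseteq> U" using \<kappa>(1) T by (auto simp: K_def test_fun_def)
  obtain \<eta> W2 where \<eta>: "test_fun U \<eta>" "open W2" "K \<subseteq> W2" "\<And>y. y \<in> W2 \<Longrightarrow> \<eta> y = 1"
    using exists_cutoff[OF open_U K] by metis
  have sa: "smooth_on UNIV (a i)" for i by (rule test_fun_smooth[OF open_U a])
  have s\<Phi>a: "smooth_on UNIV (\<lambda>x. \<Phi> (\<chi> j. a j x))" by (rule smooth_on_compose_cart[OF open_UNIV \<Phi> sa])
  \<comment> \<open>\<Phi> need not vanish at 0, so the composition may fail to have compact
    support. The factor \<eta>, equal to 1 near all points that count, turns it into a test
    function.\<close>
  define q where "q x = \<eta> x * \<Phi> (\<chi> j. a j x)" for x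
  have tq: "test_fun U q" unfolding q_def by (rule test_fun_mult[OF open_U \<eta>(1) smooth_on_subset[OF s\<Phi>a]]) simp
  define g' where "g' i x = pd (axis i 1) \<Phi> (\<chi> j. a j x) * g x" for i x
  have tg': "test_fun U (g' i)" for i
  proof -
    have "smooth_on UNIV (\<lambda>x. pd (axis i 1) \<Phi> (\<chi> j. a j x))"
      by (rule smooth_on_compose_cart[OF open_UNIV smooth_on_pd[OF \<Phi> axis_Basis] sa])
    then have "test_fun U (\<lambda>x. g x * pd (axis i 1) \<Phi> (\<chi> j. a j x))"
      by (rule test_fun_mult[OF open_U g smooth_on_subset]) simp
    then show ?thesis by (simp add: g'_def[abs_def] mult.commute)
  qed
  have pq: "muc0 sig Om vs p v g = muc0 sig Om vs q v g"
  proof (rule muc0_local[OF vs_lim])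
    show "compact (tsupp g)" "open (W \<inter> W2)" "tsupp g \<subseteq> W \<inter> W2"
      using T W \<eta>(2,3) by (auto simp: T_def K_def)
  qed (simp add: q_def p \<eta>(4))
  have gT: "g y = 0" if "y \<notin> T" for y using that not_in_tsupp by (auto simp: T_def)
  then have g'T: "g' i y = 0" if "y \<notin> T" for i y using that by (simp add: g'_def)
  define Hq where "Hq z = (q (snd z) - q (fst z)) * (v (snd z) - v (fst z)) * g (snd z) * \<kappa> (fst z)" for z
  define Hi where "Hi i z = (a i (snd z) - a i (fst z)) * (v (snd z) - v (fst z)) * g' i (snd z) * \<kappa> (fst z)" for i z
  obtain L where L: "tend Hq L" "integrable J Hq" "muc0 sig Om vs q v g = L - 2 * integral\<^sup>L J Hq"
    unfolding Hq_def by (rule muc0_formula[OF tq v g \<kappa>(1) T(1) d gT \<kappa>(2)]) blast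
  have "\<exists>l. tend (Hi i) l \<and> integrable J (Hi i) \<and> muc0 sig Om vs (a i) v (g' i) = l - 2 * integral\<^sup>L J (Hi i)" for i
  proof -
    obtain m where "tend (Hi i) m" "integrable J (Hi i)" "muc0 sig Om vs (a i) v (g' i) = m - 2 * integral\<^sup>L J (Hi i)"
      unfolding Hi_def by (rule muc0_formula[where \<phi> = "a i" and g = "g' i", OF a v tg' \<kappa>(1) T(1) d g'T \<kappa>(2)]) blast
    then show ?thesis by blast
  qed
  then obtain l where l: "\<And>i. tend (Hi i) (l i)" "\<And>i. integrable J (Hi i)"
    "\<And>i. muc0 sig Om vs (a i) v (g' i) = l i - 2 * integral\<^sup>L J (Hi i)" by metis
  define H where "H z = Hq z - (\<Sum>i\<in>UNIV. Hi i z)" for z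
  have tH: "tend H (L - (\<Sum>i\<in>UNIV. l i))" unfolding H_def by (intro tend_diff tend_sum L l)
  have iH: "integrable J H" unfolding H_def using L(2) l(2) by (intro Bochner_Integration.integrable_diff Bochner_Integration.integrable_sum) auto
  have psH: "product_sum U U H"
    unfolding H_def Hq_def Hi_def
    by (intro product_sum_diff[OF open_U open_U] product_sum_sum carre_product_sum tq v g \<kappa>(1) a tg')
  have ccH: "cc_fun (U \<times> U) H" by (rule product_sum_cc_fun[OF open_U open_U psH])
  have Heq: "H z = \<kappa> (fst z) * g (snd z) * (v (snd z) - v (fst z)) * chain_remainder \<Phi> a (fst z) (snd z)" for z
  proof (cases "\<kappa> (fst z) = 0 \<or> g (snd z) = 0")
    case False
    then have "fst z \<in> K" "snd z \<in> K" using not_in_tsupp gT by (auto simp: K_def)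
    then have "\<eta> (fst z) = 1" "\<eta> (snd z) = 1" using \<eta>(3,4) by auto
    then show ?thesis
      by (simp add: H_def Hq_def Hi_def q_def g'_def chain_remainder_def sum_distrib_left sum_distrib_right algebra_simps)
  qed (auto simp: H_def Hq_def Hi_def g'_def)
  obtain C where C: "C \<ge> 0" "\<And>x y. x \<in> K \<Longrightarrow> y \<in> K \<Longrightarrow> \<bar>chain_remainder \<Phi> a x y\<bar> \<le> C * (norm (y - x))\<^sup>2"
    by (rule chain_remainder_estimates[where a = a, OF \<Phi> sa K(1)]) blast
  obtain C2 where C2: "C2 \<ge> 0" "\<And>x y. x \<in> K \<Longrightarrow> y \<in> K \<Longrightarrow> \<bar>v y - v x\<bar> \<le> C2 * norm (y - x)"
    by (rule test_fun_lipschitz[OF v K(1)]) blast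
  obtain B1 where B1: "B1 \<ge> 0" "\<And>x. \<bar>g x\<bar> \<le> B1" by (rule test_fun_bounded[OF open_U g]) blast
  obtain B2 where B2: "B2 \<ge> 0" "\<And>x. \<bar>\<kappa> x\<bar> \<le> B2" by (rule test_fun_bounded[OF open_U \<kappa>(1)]) blast
  have "tend H (2 * integral\<^sup>L J H)"
  proof (rule third_order_tend[OF ccH _ _ iH])
    show "0 \<le> B2 * B1 * C2 * C" using B1 B2 C C2 by simp
    show "\<bar>H z\<bar> \<le> (B2 * B1 * C2 * C) * gap z ^ 3" for z
    proof (cases "\<kappa> (fst z) = 0 \<or> g (snd z) = 0")
      case False
      then have k: "fst z \<in> K" "snd z \<in> K" using not_in_tsupp gT by (auto simp: K_def)
      have n: "norm (snd z - fst z) = gap z" by (simp add: gap_def norm_minus_commute)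
      have "\<bar>H z\<bar> \<le> B2 * B1 * (C2 * gap z) * (C * (gap z)\<^sup>2)"
        unfolding Heq abs_mult using C(2)[OF k] C2(2)[OF k] B1 B2 C(1) C2(1) gap_nonneg[of z]
        by (intro mult_mono mult_nonneg_nonneg) (auto simp: n)
      then show ?thesis by (simp add: power2_eq_square power3_eq_cube mult_ac)
    qed (use B1 B2 C C2 gap_nonneg[of z] in \<open>auto simp: Heq\<close>)
  qed
  \<comment> \<open>The unknown numbers \<open>L\<close> and \<open>l i\<close> enter only in this
    combination, which is now a \<open>J\<close>-integral and cancels the integrals in the
    formulas.\<close>
  from tend_unique[OF tH this]
  have "L - (\<Sum>i\<in>UNIV. l i) = 2 * (integral\<^sup>L J Hq - (\<Sum>i\<in>UNIV. integral\<^sup>L J (Hi i)))"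
    unfolding H_def using L(2) l(2) by (simp add: Bochner_Integration.integral_sum)
  then show ?thesis
    unfolding pq L(3) g'_def[symmetric] l(3) by (simp add: sum_subtractf sum_distrib_left)
qed

text \<open>The compensators cancel exactly, by the chain rule for derivatives at the second point,
  so the defect does not involve \<delta>. It is only of second order; its limit \<open>A\<close>
  therefore stays unevaluated here.\<close>

lemma Ecd_chain_rule:
  fixes \<Phi> :: "real ^ 'm \<Rightarrow> real"
  assumes \<Phi>: "smooth_on UNIV \<Phi>" and a: "\<And>i. test_fun U (a i)" and h: "test_fun U h" and \<kappa>: "test_fun U \<kappa>"
    and d: "d > \<delta>" and sub: "(\<Union>y\<in>tsupp h. cball y d) \<subseteq> U"
    and \<kappa>1: "\<And>x. x \<in> (\<Union>y\<in>tsupp h. cball y d) \<Longrightarrow> \<kappa> x = 1"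
    and W: "open W" "tsupp h \<subseteq> W" and p: "\<And>x. x \<in> W \<Longrightarrow> p x = \<Phi> (\<chi> j. a j x)"
  obtains A where "tend (chain_defect \<Phi> a h \<kappa>) A" "integrable J (chain_defect \<Phi> a h \<kappa>)"
    "product_sum U U (chain_defect \<Phi> a h \<kappa>)"
    "Ecd sig Om vs ds p h - (\<Sum>i\<in>UNIV. Ecd sig Om vs ds (a i) (\<lambda>x. pd (axis i 1) \<Phi> (\<chi> j. a j x) * h x))
      = A - 2 * integral\<^sup>L J (chain_defect \<Phi> a h \<kappa>)"
proof -
  define T where "T = tsupp h"
  have T: "compact T" "T \<subseteq> U" using h by (auto simp: T_def test_fun_def)
  define K where "K = tsupp \<kappa> \<union> T"
  have K: "compact K" "K \<subseteq> U" using \<kappa> T by (auto simp: K_def test_fun_def)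
  obtain \<eta> W2 where \<eta>: "test_fun U \<eta>" "open W2" "K \<subseteq> W2" "\<And>y. y \<in> W2 \<Longrightarrow> \<eta> y = 1"
    using exists_cutoff[OF open_U K] by metis
  have sa: "smooth_on UNIV (a i)" for i by (rule test_fun_smooth[OF open_U a])
  have s\<Phi>a: "smooth_on UNIV (\<lambda>x. \<Phi> (\<chi> j. a j x))" by (rule smooth_on_compose_cart[OF open_UNIV \<Phi> sa])
  define q where "q x = \<eta> x * \<Phi> (\<chi> j. a j x)" for x
  have tq: "test_fun U q" unfolding q_def by (rule test_fun_mult[OF open_U \<eta>(1) smooth_on_subset[OF s\<Phi>a]]) simp
  define h' where "h' i x = pd (axis i 1) \<Phi> (\<chi> j. a j x) * h x" for i x
  have th': "test_fun U (h' i)" for i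
  proof -
    have "smooth_on UNIV (\<lambda>x. pd (axis i 1) \<Phi> (\<chi> j. a j x))"
      by (rule smooth_on_compose_cart[OF open_UNIV smooth_on_pd[OF \<Phi> axis_Basis] sa])
    then have "test_fun U (\<lambda>x. h x * pd (axis i 1) \<Phi> (\<chi> j. a j x))"
      by (rule test_fun_mult[OF open_U h smooth_on_subset]) simp
    then show ?thesis by (simp add: h'_def[abs_def] mult.commute)
  qed
  have pq: "Ecd sig Om vs ds p h = Ecd sig Om vs ds q h"
  proof (rule Ecd_local[OF vs_lim])
    show "compact (tsupp h)" "open (W \<inter> W2)" "tsupp h \<subseteq> W \<inter> W2"
      using T W \<eta>(2,3) by (auto simp: T_def K_def)
  qed (simp add: q_def p \<eta>(4))
  have hT: "h y = 0" if "y \<notin> T" for y using that not_in_tsupp by (auto simp: T_def)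
  then have h'T: "h' i y = 0" if "y \<notin> T" for i y using that by (simp add: h'_def)
  note sub' = sub[folded T_def] and \<kappa>1' = \<kappa>1[folded T_def]
  define H1q where "H1q z = (q (snd z) - q (fst z)) * h (snd z) * \<kappa> (fst z)" for z
  define H2q where "H2q z = (\<Sum>b\<in>Basis. ((snd z - fst z) \<bullet> b) * pd b q (snd z)) * h (snd z) * \<kappa> (fst z)" for z
  define H1 where "H1 i z = (a i (snd z) - a i (fst z)) * h' i (snd z) * \<kappa> (fst z)" for i z
  define H2 where "H2 i z = (\<Sum>b\<in>Basis. ((snd z - fst z) \<bullet> b) * pd b (a i) (snd z)) * h' i (snd z) * \<kappa> (fst z)" for i z
  obtain L where L: "tend H1q L" "integrable J (\<lambda>z. H1q z - indicator {..\<delta>} (gap z) * H2q z)"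
    "Ecd sig Om vs ds q h = L - 2 * (\<integral>z. H1q z - indicator {..\<delta>} (gap z) * H2q z \<partial>J)"
    unfolding H1q_def H2q_def by (rule Ecd_formula[OF tq h \<kappa> T(1) d sub' hT \<kappa>1']) blast
  have "\<exists>l. tend (H1 i) l \<and> integrable J (\<lambda>z. H1 i z - indicator {..\<delta>} (gap z) * H2 i z) \<and>
    Ecd sig Om vs ds (a i) (h' i) = l - 2 * (\<integral>z. H1 i z - indicator {..\<delta>} (gap z) * H2 i z \<partial>J)" for i
  proof -
    obtain m where "tend (H1 i) m" "integrable J (\<lambda>z. H1 i z - indicator {..\<delta>} (gap z) * H2 i z)"
      "Ecd sig Om vs ds (a i) (h' i) = m - 2 * (\<integral>z. H1 i z - indicator {..\<delta>} (gap z) * H2 i z \<partial>J)"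
      unfolding H1_def H2_def by (rule Ecd_formula[where u = "a i" and v = "h' i", OF a th' \<kappa> T(1) d sub' h'T \<kappa>1']) blast
    then show ?thesis by blast
  qed
  then obtain l where l: "\<And>i. tend (H1 i) (l i)" "\<And>i. integrable J (\<lambda>z. H1 i z - indicator {..\<delta>} (gap z) * H2 i z)"
    "\<And>i. Ecd sig Om vs ds (a i) (h' i) = l i - 2 * (\<integral>z. H1 i z - indicator {..\<delta>} (gap z) * H2 i z \<partial>J)" by metis
  have H1: "chain_defect \<Phi> a h \<kappa> = (\<lambda>z. H1q z - (\<Sum>i\<in>UNIV. H1 i z))"
  proof
    fix z
    show "chain_defect \<Phi> a h \<kappa> z = H1q z - (\<Sum>i\<in>UNIV. H1 i z)"
    proof (cases "\<kappa> (fst z) = 0 \<or> h (snd z) = 0")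
      case False
      then have "fst z \<in> K" "snd z \<in> K" using not_in_tsupp hT by (auto simp: K_def)
      then have "\<eta> (fst z) = 1" "\<eta> (snd z) = 1" using \<eta>(3,4) by auto
      then show ?thesis
        by (simp add: chain_defect_def H1q_def H1_def q_def h'_def chain_remainder_def sum_distrib_left sum_distrib_right algebra_simps)
    qed (auto simp: chain_defect_def H1q_def H1_def h'_def)
  qed
  \<comment> \<open>Where \<open>h\<close> does not vanish, \<eta> is 1 in a whole neighbourhood, so
    it does not affect the derivatives of \<open>q\<close>.\<close>
  have H2: "H2q z = (\<Sum>i\<in>UNIV. H2 i z)" for z
  proof (cases "h (snd z) = 0")
    case False
    then have y: "snd z \<in> W2" using hT \<eta>(3) by (auto simp: K_def)
    have "pd b q (snd z) = (\<Sum>i\<in>UNIV. pd (axis i 1) \<Phi> (\<chi> j. a j (snd z)) * pd b (a i) (snd z))" if "b \<in> Basis" for b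
    proof -
      have "pd b q (snd z) = pd b (\<lambda>x. \<Phi> (\<chi> j. a j x)) (snd z)"
        by (rule pd_cong[OF \<eta>(2) _ y]) (simp add: q_def \<eta>(4))
      then show ?thesis using pd_compose_cart[OF \<Phi> sa that] by simp
    qed
    then have "H2q z = (\<Sum>b\<in>Basis. \<Sum>i\<in>UNIV. ((snd z - fst z) \<bullet> b) * pd b (a i) (snd z) * h' i (snd z) * \<kappa> (fst z))"
      unfolding H2q_def by (simp add: h'_def sum_distrib_left sum_distrib_right mult_ac)
    also have "\<dots> = (\<Sum>i\<in>UNIV. H2 i z)"
      unfolding H2_def by (subst sum.swap) (simp add: sum_distrib_right)
    finally show ?thesis .
  qed (auto simp: H2q_def H2_def h'_def)
  have eq: "(\<lambda>z. (H1q z - indicator {..\<delta>} (gap z) * H2q z) - (\<Sum>i\<in>UNIV. H1 i z - indicator {..\<delta>} (gap z) * H2 i z)) = chain_defect \<Phi> a h \<kappa>"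
    unfolding H1 H2 by (simp add: sum_subtractf sum_distrib_left)
  show ?thesis
  proof (rule that)
    show "tend (chain_defect \<Phi> a h \<kappa>) (L - (\<Sum>i\<in>UNIV. l i))" unfolding H1 by (intro tend_diff tend_sum L l)
    show "integrable J (chain_defect \<Phi> a h \<kappa>)"
      unfolding eq[symmetric]
      by (rule Bochner_Integration.integrable_diff[OF L(2) Bochner_Integration.integrable_sum[OF l(2)]])
    show "product_sum U U (chain_defect \<Phi> a h \<kappa>)"
      unfolding H1 H1q_def H1_def
      by (intro product_sum_diff[OF open_U open_U] product_sum_sum Ecd_product_sum tq h \<kappa> a th')
    have "integral\<^sup>L J (chain_defect \<Phi> a h \<kappa>) = (\<integral>z. H1q z - indicator {..\<delta>} (gap z) * H2q z \<partial>J) -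
        (\<Sum>i\<in>UNIV. \<integral>z. H1 i z - indicator {..\<delta>} (gap z) * H2 i z \<partial>J)"
    proof -
      have "(\<integral>z. Rq z - (\<Sum>i\<in>UNIV. R i z) \<partial>J) = integral\<^sup>L J Rq - (\<Sum>i\<in>UNIV. integral\<^sup>L J (R i))"
        if "integrable J Rq" "\<And>i. integrable J (R i)" for Rq and R :: "'m \<Rightarrow> 'a \<times> 'a \<Rightarrow> real"
        using that by simp
      from this[of _ "\<lambda>i z. H1 i z - indicator {..\<delta>} (gap z) * H2 i z", OF L(2) l(2)] show ?thesis unfolding eq .
    qed
    then show "Ecd sig Om vs ds p h - (\<Sum>i\<in>UNIV. Ecd sig Om vs ds (a i) (\<lambda>x. pd (axis i 1) \<Phi> (\<chi> j. a j x) * h x))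
      = L - (\<Sum>i\<in>UNIV. l i) - 2 * integral\<^sup>L J (chain_defect \<Phi> a h \<kappa>)"
      unfolding pq L(3) h'_def[symmetric] l(3) by (simp add: sum_subtractf sum_distrib_left)
  qed
qed

text \<open>The difference is \<open>\<kappa>(x) h(y)\<close> times the antisymmetric part of the
  remainder, which is cubic, plus a remainder times increments of \<open>h\<close> and \<kappa>,
  second order times first order.\<close>

lemma chain_defect_swap_estimate:
  fixes \<Phi> :: "real ^ 'm \<Rightarrow> real"
  assumes \<Phi>: "smooth_on UNIV \<Phi>" and a: "\<And>i. test_fun U (a i)" and h: "test_fun U h" and \<kappa>: "test_fun U \<kappa>"
  obtains C where "C \<ge> 0" "\<And>z. \<bar>chain_defect \<Phi> a h \<kappa> z - chain_defect \<Phi> a h \<kappa> (snd z, fst z)\<bar> \<le> C * gap z ^ 3"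
proof -
  define K where "K = tsupp \<kappa> \<union> tsupp h"
  have K: "compact K" using \<kappa> h by (auto simp: K_def test_fun_def)
  obtain C where C: "C \<ge> 0" "\<And>x y. x \<in> K \<Longrightarrow> y \<in> K \<Longrightarrow> \<bar>chain_remainder \<Phi> a x y\<bar> \<le> C * (norm (y - x))\<^sup>2"
    "\<And>x y. x \<in> K \<Longrightarrow> y \<in> K \<Longrightarrow> \<bar>chain_remainder \<Phi> a x y - chain_remainder \<Phi> a y x\<bar> \<le> C * norm (y - x) ^ 3"
    by (rule chain_remainder_estimates[where a = a, OF \<Phi> test_fun_smooth[OF open_U a] K]) blast
  obtain C1 where C1: "C1 \<ge> 0" "\<And>x y. x \<in> K \<Longrightarrow> y \<in> K \<Longrightarrow> \<bar>h y - h x\<bar> \<le> C1 * norm (y - x)"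
    by (rule test_fun_lipschitz[OF h K]) blast
  obtain C2 where C2: "C2 \<ge> 0" "\<And>x y. x \<in> K \<Longrightarrow> y \<in> K \<Longrightarrow> \<bar>\<kappa> y - \<kappa> x\<bar> \<le> C2 * norm (y - x)"
    by (rule test_fun_lipschitz[OF \<kappa> K]) blast
  obtain B1 where B1: "B1 \<ge> 0" "\<And>x. \<bar>h x\<bar> \<le> B1" by (rule test_fun_bounded[OF open_U h]) blast
  obtain B2 where B2: "B2 \<ge> 0" "\<And>x. \<bar>\<kappa> x\<bar> \<le> B2" by (rule test_fun_bounded[OF open_U \<kappa>]) blast
  define C' where "C' = B2 * B1 * C + C * (B2 * C1 + B1 * C2)"
  show ?thesis
  proof (rule that[of C'])
    show C'0: "C' \<ge> 0" using B1 B2 C C1 C2 by (simp add: C'_def)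
    fix z :: "'a \<times> 'a"
    obtain x y where z: "z = (x, y)" by (cases z)
    define r where "r = gap z"
    have r: "r \<ge> 0" "norm (y - x) = r" "norm (x - y) = r" by (simp_all add: r_def z gap_def norm_minus_commute)
    show "\<bar>chain_defect \<Phi> a h \<kappa> z - chain_defect \<Phi> a h \<kappa> (snd z, fst z)\<bar> \<le> C' * gap z ^ 3"
    proof (cases "x \<in> K \<and> y \<in> K")
      case True
      then have x: "x \<in> K" and y: "y \<in> K" by auto
      define P where "P = chain_remainder \<Phi> a x y"
      define Q where "Q = chain_remainder \<Phi> a y x"
      have "chain_defect \<Phi> a h \<kappa> z - chain_defect \<Phi> a h \<kappa> (snd z, fst z) =
          \<kappa> x * h y * (P - Q) + Q * (\<kappa> x * (h y - h x) + h x * (\<kappa> x - \<kappa> y))"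
        by (simp add: chain_defect_def z P_def Q_def algebra_simps)
      also have "\<bar>\<dots>\<bar> \<le> \<bar>\<kappa> x\<bar> * \<bar>h y\<bar> * \<bar>P - Q\<bar> + \<bar>Q\<bar> * (\<bar>\<kappa> x\<bar> * \<bar>h y - h x\<bar> + \<bar>h x\<bar> * \<bar>\<kappa> x - \<kappa> y\<bar>)"
        unfolding abs_mult[symmetric]
        by (rule order_trans[OF abs_triangle_ineq add_left_mono]) (auto simp: abs_mult intro!: mult_left_mono abs_triangle_ineq[THEN order_trans])
      also have "\<dots> \<le> B2 * B1 * (C * r ^ 3) + (C * r\<^sup>2) * (B2 * (C1 * r) + B1 * (C2 * r))"
        using C(1) C(3)[OF x y] C(2)[OF y x] C1(1) C1(2)[OF x y] C2(1) C2(2)[OF y x] B1 B2 r(1)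
        by (intro add_mono mult_mono add_nonneg_nonneg mult_nonneg_nonneg) (auto simp: P_def Q_def r(2,3))
      also have "\<dots> = C' * r ^ 3" by (simp add: C'_def power2_eq_square power3_eq_cube algebra_simps)
      finally show ?thesis by (simp add: r_def)
    next
      case False
      \<comment> \<open>\<open>K\<close> contains both supports, so at a point outside it
        \<open>h\<close> and \<kappa> vanish together, and with them one factor of each of the two
        terms.\<close>
      then have "h y = 0 \<and> \<kappa> y = 0 \<or> h x = 0 \<and> \<kappa> x = 0" using not_in_tsupp by (auto simp: K_def)
      then have "chain_defect \<Phi> a h \<kappa> z - chain_defect \<Phi> a h \<kappa> (snd z, fst z) = 0"
        by (auto simp: chain_defect_def z)
      then show ?thesis using C'0 gap_nonneg[of z] by simp
    qed
  qed
qed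

text \<open>\<open>SOME\<close> becomes meaningful once a triple exists, which a cutoff on the
  closure of some \<open>Om l\<close> provides; locality then makes the chosen triple
  irrelevant.\<close>

lemma muc_eq:
  assumes u: "smooth_on U u" and v: "smooth_on U v" and g: "test_fun U g"
    and W: "open W" "tsupp g \<subseteq> W" and eq: "\<And>x. x \<in> W \<Longrightarrow> u' x = u x \<and> v' x = v x"
  shows "muc U sig Om vs u v g = muc0 sig Om vs u' v' g"
proof -
  have T: "compact (tsupp g)" "tsupp g \<subseteq> U" using g by (auto simp: test_fun_def)
  define P where "P = (\<lambda>(l, ul, vl). test_fun U ul \<and> test_fun U vl \<and> (\<forall>x\<in>Om l. ul x = u x \<and> vl x = v x) \<and> tsupp g \<subseteq> Om l)"
  obtain l where l: "tsupp g \<subseteq> Om l"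
    using eventually_subset_Om[OF T] by (meson eventually_happens sequentially_bot)
  have cl: "compact (closure (Om l))" "closure (Om l) \<subseteq> U" using cutoffs unfolding admissible_cutoffs_def by auto
  obtain \<eta> W2 where \<eta>: "test_fun U \<eta>" "closure (Om l) \<subseteq> W2" "\<And>y. y \<in> W2 \<Longrightarrow> \<eta> y = 1"
    using exists_cutoff[OF open_U cl] by metis
  have "\<eta> x = 1" if "x \<in> Om l" for x using that \<eta>(2,3) closure_subset by blast
  then have "P (l, \<lambda>x. \<eta> x * u x, \<lambda>x. \<eta> x * v x)"
    using l test_fun_mult[OF open_U \<eta>(1)] u v by (auto simp: P_def)
  then have "P (Eps P)" by (rule someI)
  moreover obtain l0 ul vl where X: "Eps P = (l0, ul, vl)" by (cases "Eps P")
  ultimately have *: "\<forall>x\<in>Om l0. ul x = u x \<and> vl x = v x" "tsupp g \<subseteq> Om l0" by (auto simp: P_def)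
  have "muc U sig Om vs u v g = muc0 sig Om vs ul vl g"
    unfolding muc_def P_def[symmetric] X by simp
  also have "\<dots> = muc0 sig Om vs u' v' g"
    using * W eq by (intro muc0_local[OF vs_lim T(1), of "W \<inter> Om l0"]) (auto simp: open_Om)
  finally show ?thesis .
qed

end

lemma lim_eventually_const: "eventually (\<lambda>l. f l = c) sequentially \<Longrightarrow> lim f = (c::real)"
  by (intro limI tendsto_eventually)

text \<open>A witness for \<open>SOME\<close> needs a whole exhaustion with cutoffs. Along any
  admissible sequence the values are eventually constant, because the compact support of
  \<open>f\<close> is absorbed by the sets \<open>V l\<close>.\<close>

lemma Ld_eq:
  assumes U: "open U" and vs: "vs \<longlonglongrightarrow> 0" and u: "smooth_on (Udelta U \<delta>) u" and v: "smooth_on (Udelta U \<delta>) v"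
    and f: "test_fun (Udelta U \<delta>) f" and W: "open W" "tsupp f \<subseteq> W"
    and eq: "\<And>x. x \<in> W \<Longrightarrow> u' x = u x \<and> v' x = v x"
  shows "Ld U \<delta> sig sigh Om vs ds u v f = L0 sig sigh Om vs ds u' v' f"
proof -
  define D where "D = Udelta U \<delta>"
  have D: "open D" unfolding D_def by (rule open_Udelta[OF U])
  have T: "compact (tsupp f)" "tsupp f \<subseteq> D" using f by (auto simp: test_fun_def D_def)
  define P where "P = (\<lambda>(V, ul, vl).
            (\<forall>l. open (V l) \<and> compact (closure (V l)) \<and> closure (V l) \<subseteq> Udelta U \<delta>) \<and>
            incseq V \<and> (\<Union>l::nat. V l) = Udelta U \<delta> \<and>
            (\<forall>l. test_fun (Udelta U \<delta>) (ul l) \<and> test_fun (Udelta U \<delta>) (vl l) \<and>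
                 (\<forall>x\<in>V l. ul l x = u x \<and> vl l x = v x)))"
  obtain C where C: "\<And>n. compact (C n)" "\<And>n. C n \<subseteq> D" "\<And>n. C n \<subseteq> interior (C (Suc n))" "\<Union>(range C) = D"
    using open_Union_compact_subsets[OF D] by metis
  have "\<exists>\<eta>. test_fun D \<eta> \<and> (\<forall>x\<in>C n. \<eta> x = 1)" for n
    using exists_cutoff[OF D C(1,2)] by (metis subsetD)
  then obtain \<eta> where \<eta>: "\<And>n. test_fun D (\<eta> n)" "\<And>n x. x \<in> C n \<Longrightarrow> \<eta> n x = 1" by metis
  \<comment> \<open>Interiors of a compact exhaustion are relatively compact and increase to the
    whole set, and the cutoffs for the compact sets are 1 on them.\<close>
  define V where "V n = interior (C n)" for n
  have VC: "V n \<subseteq> C n" for n by (simp add: V_def interior_subset)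
  have clV: "closure (V n) \<subseteq> C n" for n by (rule closure_minimal[OF VC compact_imp_closed[OF C(1)]])
  have "compact (closure (V n))" for n
    using compact_Int_closed[OF C(1)[of n] closed_closure[of "V n"]] clV[of n] by (simp add: Int_absorb1)
  moreover have "incseq V"
    using interior_mono[OF order_trans[OF C(3) interior_subset]] by (intro incseq_SucI) (simp add: V_def)
  moreover have "(\<Union>l. V l) = D"
  proof
    show "(\<Union>l. V l) \<subseteq> D" using VC C(2) by blast
    show "D \<subseteq> (\<Union>l. V l)" using C(3,4) unfolding V_def by blast
  qed
  moreover have "open (V l)" "closure (V l) \<subseteq> D" for l
    using clV[of l] C(2)[of l] by (auto simp: V_def)
  moreover have "test_fun D (\<lambda>x. \<eta> l x * u x)" "test_fun D (\<lambda>x. \<eta> l x * v x)" for l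
    using test_fun_mult[OF D \<eta>(1)] u v unfolding D_def by blast+
  moreover have "\<eta> l x * u x = u x" "\<eta> l x * v x = v x" if "x \<in> V l" for l x
    using \<eta>(2)[OF subsetD[OF VC that]] by simp_all
  ultimately have "P (V, \<lambda>n x. \<eta> n x * u x, \<lambda>n x. \<eta> n x * v x)"
    unfolding P_def D_def[symmetric] prod.case by blast
  then have "P (Eps P)" by (rule someI)
  moreover obtain V' ul vl where X: "Eps P = (V', ul, vl)" by (cases "Eps P")
  ultimately have V': "\<And>l. open (V' l)" "incseq V'" "(\<Union>l. V' l) = D"
    and uvl: "\<And>l x. x \<in> V' l \<Longrightarrow> ul l x = u x \<and> vl l x = v x" by (auto simp: P_def D_def)
  have ev: "eventually (\<lambda>l. tsupp f \<subseteq> V' l) sequentially"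
    by (rule eventually_compact_subset[OF V'(2,1) T(1)]) (simp add: T(2) V'(3))
  have "Ld U \<delta> sig sigh Om vs ds u v f = lim (\<lambda>l. L0 sig sigh Om vs ds (ul l) (vl l) f)"
    unfolding Ld_def P_def[symmetric] X by simp
  also have "\<dots> = L0 sig sigh Om vs ds u' v' f"
  proof (rule lim_eventually_const)
    show "eventually (\<lambda>l. L0 sig sigh Om vs ds (ul l) (vl l) f = L0 sig sigh Om vs ds u' v' f) sequentially"
      using ev
    proof eventually_elim
      case (elim l)
      have e: "(\<lambda>x. vl l x * f x) = (\<lambda>x. v' x * f x)"
      proof
        fix x
        show "vl l x * f x = v' x * f x"
        proof (cases "x \<in> tsupp f")
          case True
          then have "x \<in> V' l" "x \<in> W" using elim W(2) by blast+
          then show ?thesis using uvl eq by simp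
        qed (simp add: not_in_tsupp)
      qed
      have s: "tsupp (\<lambda>x. v' x * f x) \<subseteq> tsupp f" by (rule tsupp_mult_right)
      have c: "compact (tsupp (\<lambda>x. v' x * f x))"
        using compact_Int_closed[OF T(1) closed_tsupp[of "\<lambda>x. v' x * f x"]] s by (simp add: Int_absorb1)
      have "Ecd sg Om vs ds (ul l) (\<lambda>x. v' x * f x) = Ecd sg Om vs ds u' (\<lambda>x. v' x * f x)" for sg
        by (rule Ecd_local[OF vs c open_Int[OF V'(1)[of l] W(1)]]) (use s elim W(2) uvl eq in auto)
      then show ?case by (simp add: L0_def e)
    qed
  qed
  finally show ?thesis .
qed

section \<open>The two product rules\<close>

lemma test_fun_cc_fun: "open U \<Longrightarrow> test_fun U a \<Longrightarrow> cc_fun U a"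
  using test_fun_continuous by (auto simp: test_fun_def cc_fun_def)

section \<open>Kernels and reflected co-kernels\<close>

context
  fixes U :: "'a::euclidean_space set" and M :: "'a measure"
    and E :: "('a \<Rightarrow> real) \<Rightarrow> ('a \<Rightarrow> real) \<Rightarrow> real"
    and G Gh :: "real \<Rightarrow> ('a \<Rightarrow> real) \<Rightarrow> ('a \<Rightarrow> real)"
    and sig sigh :: "real \<Rightarrow> ('a \<times> 'a) measure"
    and J :: "('a \<times> 'a) measure"
    and \<delta> :: real and Om :: "nat \<Rightarrow> 'a set" and vs ds :: "nat \<Rightarrow> real"
  assumes U: "open U" and M: "radon_full_support U M"
    and cases: "case1 U M E G Gh \<or> case2 U M E G Gh"
    and sig: "resolvent_kernels U M G sig" and sigh: "resolvent_kernels U M Gh sigh"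
    and J: "jumping_measure U E J" and \<delta>: "\<delta> > 0" and cutoffs: "admissible_cutoffs U J \<delta> Om vs ds"
begin

lemma kernel_integral:
  assumes "resolvent_kernels U M G' sg" "\<beta> > 0" "test_fun U a" "test_fun U b"
  shows "(\<integral>z. a (fst z) * b (snd z) \<partial>sg \<beta>) = \<beta> * ip M (G' \<beta> a) b"
  using assms test_fun_cc_fun[OF U] ip_cmult[of M \<beta> "G' \<beta> a" b] unfolding resolvent_kernels_def by metis

lemma sigh_swap:
  assumes "\<beta> > 0" "test_fun U a" "test_fun U b"
  shows "(\<integral>z. a (fst z) * b (snd z) \<partial>sigh \<beta>) = (\<integral>z. b (fst z) * a (snd z) \<partial>sig \<beta>)"
  using kernel_integral[OF sigh assms] kernel_integral[OF sig assms(1,3,2)]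
    resolvent_duality[OF cases assms(1) test_fun_L2[OF U M assms(3)] test_fun_L2[OF U M assms(2)]]
  by (simp add: ip_commute)

lemma kernel_form_limit:
  assumes "test_fun U a" "test_fun U b"
  shows "((\<lambda>\<beta>. \<beta> * (ip M a b - (\<integral>z. a (fst z) * b (snd z) \<partial>sig \<beta>))) \<longlongrightarrow> E a b) at_top"
  using resolvent_limit[OF U M cases assms]
proof (rule Lim_transform_eventually)
  show "eventually (\<lambda>\<beta>. \<beta> * (ip M a b - \<beta> * ip M (G \<beta> a) b) =
      \<beta> * (ip M a b - (\<integral>z. a (fst z) * b (snd z) \<partial>sig \<beta>))) at_top"
    using eventually_gt_at_top[of 0] by eventually_elim (simp add: kernel_integral[OF sig _ assms])
qed

text \<open>Near the support of \<open>b\<close> the function \<open>a\<close> is constantly 0, so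
  the representation of the form applies; the killing term and the part with both factors at the
  same point vanish.\<close>

lemma jump_disjoint:
  assumes "test_fun U a" "test_fun U b" "tsupp a \<inter> tsupp b = {}"
  shows "E a b = - 2 * (\<integral>z. a (fst z) * b (snd z) \<partial>J)"
proof -
  obtain K where K: "\<And>u v. test_fun U u \<Longrightarrow> test_fun U v \<Longrightarrow> const_near u (tsupp v) \<Longrightarrow>
       E u v = (\<integral>z. 2 * (u (snd z) - u (fst z)) * v (snd z) \<partial>J) + (\<integral>x. u x * v x \<partial>K)"
    using J unfolding jumping_measure_def by blast
  have ab: "a x * b x = 0" for x
    using assms(3) not_in_tsupp[of x a] not_in_tsupp[of x b] by auto
  have "const_near a (tsupp b)"
    unfolding const_near_def using assms(3) closed_tsupp[of a]
    by (intro exI[of _ "- tsupp a"] exI[of _ 0]) (auto simp: not_in_tsupp)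
  from K[OF assms(1,2) this]
  have "E a b = (\<integral>z. 2 * (a (snd z) - a (fst z)) * b (snd z) \<partial>J)" unfolding ab by simp
  also have "(\<lambda>z. 2 * (a (snd z) - a (fst z)) * b (snd z)) = (\<lambda>z. - 2 * (a (fst z) * b (snd z)))"
    using ab by (auto simp: algebra_simps)
  finally show ?thesis by (simp only: integral_mult_right_zero)
qed

lemma forward_limit: "jump_limit_cutoffs U M sig J E \<delta> Om vs ds"
proof (unfold_locales)
  show "radon_on U M" by (rule radon_full_support_radon_on[OF U M])
  show "radon_on (U \<times> U) (sig \<beta>)" if "\<beta> > 0" for \<beta> using sig that unfolding resolvent_kernels_def by blast
  show "radon_on (U \<times> U - diag U) J" using J unfolding jumping_measure_def by blast
qed (use U \<delta> cutoffs kernel_form_limit jump_disjoint in auto)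

definition flip :: "'a \<times> 'a \<Rightarrow> 'a \<times> 'a" where
  "flip z = (snd z, fst z)"

lemma flip_flip: "flip (flip z) = z"
  by (simp add: flip_def)

lemma flip_vimage: "flip -` A = flip ` A"
proof (intro set_eqI iffI)
  fix z assume "z \<in> flip -` A"
  then show "z \<in> flip ` A" by (intro image_eqI[of z flip "flip z"]) (simp_all add: flip_flip)
qed (auto simp: flip_flip)

lemma continuous_on_flip: "continuous_on S flip"
  unfolding flip_def[abs_def] by (intro continuous_intros)

lemma measurable_flip: "flip \<in> measurable J borel"
proof -
  have "sets J = sets borel" using J unfolding jumping_measure_def radon_on_def by blast
  then show ?thesis
    using borel_measurable_continuous_onI[OF continuous_on_flip] by (simp cong: measurable_cong_sets)
qed

lemma frontier_flip: "frontier (flip ` S) = flip ` frontier S"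
proof -
  have lin: "linear flip" unfolding flip_def by (intro linearI) auto
  have inj: "inj flip" by (metis flip_flip injI)
  have bij: "bij flip" by (metis flip_flip bij_betw_def inj surjI)
  show ?thesis
    unfolding frontier_closures
    by (simp add: closure_injective_linear_image[OF lin inj] bij_image_Compl_eq[OF bij, symmetric] image_Int[OF inj])
qed

lemma emeasure_distr_flip: "A \<in> sets borel \<Longrightarrow> emeasure (distr J borel flip) A = emeasure J (flip ` A)"
proof -
  assume A: "A \<in> sets borel"
  have "sets J = sets borel" using J unfolding jumping_measure_def radon_on_def by blast
  then have "space J = UNIV" using sets_eq_imp_space_eq[of J borel] by simp
  then show ?thesis using emeasure_distr[OF measurable_flip A] by (simp add: flip_vimage)
qed

text \<open>By duality the co-kernels evaluate swapped products, so the transposed form and the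
  reflected jumping measure satisfy the same axioms. The cutoffs stay admissible because
  \<open>Gam\<close> and the level sets of the gap are symmetric.\<close>

lemma backward_limit: "jump_limit_cutoffs U M sigh (distr J borel flip) (\<lambda>a b. E b a) \<delta> Om vs ds"
proof (unfold_locales)
  have rJ: "radon_on (U \<times> U - diag U) J" using J unfolding jumping_measure_def by blast
  show "radon_on U M" by (rule radon_full_support_radon_on[OF U M])
  show "radon_on (U \<times> U) (sigh \<beta>)" if "\<beta> > 0" for \<beta> using sigh that unfolding resolvent_kernels_def by blast
  show "((\<lambda>\<beta>. \<beta> * (ip M a b - (\<integral>z. a (fst z) * b (snd z) \<partial>sigh \<beta>))) \<longlongrightarrow> E b a) at_top"
    if "test_fun U a" "test_fun U b" for a b
    using kernel_form_limit[OF that(2,1)]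
  proof (rule Lim_transform_eventually)
    show "eventually (\<lambda>\<beta>. \<beta> * (ip M b a - (\<integral>z. b (fst z) * a (snd z) \<partial>sig \<beta>)) =
        \<beta> * (ip M a b - (\<integral>z. a (fst z) * b (snd z) \<partial>sigh \<beta>))) at_top"
      using eventually_gt_at_top[of 0] by eventually_elim (simp add: sigh_swap[OF _ that] ip_commute[of M a b])
  qed
  show "E b a = - 2 * (\<integral>z. a (fst z) * b (snd z) \<partial>distr J borel flip)"
    if "test_fun U a" "test_fun U b" "tsupp a \<inter> tsupp b = {}" for a b
  proof -
    have c: "continuous_on UNIV a" "continuous_on UNIV b" using test_fun_continuous[OF U] that by auto
    have "continuous_on UNIV (\<lambda>z::'a\<times>'a. a (fst z) * b (snd z))"
      by (rule continuous_on_mult[OF continuous_on_compose2[OF c(1) continuous_on_fst[OF continuous_on_id]]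
            continuous_on_compose2[OF c(2) continuous_on_snd[OF continuous_on_id]]]) auto
    from integral_distr[OF measurable_flip borel_measurable_continuous_onI[OF this]]
    have "(\<integral>z. a (fst z) * b (snd z) \<partial>distr J borel flip) = (\<integral>z. b (fst z) * a (snd z) \<partial>J)"
      by (simp add: flip_def mult.commute)
    then show ?thesis using jump_disjoint[OF that(2,1)] that(3) by (simp add: Int_commute)
  qed
  have op: "open (U \<times> U)" using U by (intro open_Times)
  have dS: "- (U \<times> U - diag U) = - (U \<times> U) \<union> {z. fst z = snd z}" by (auto simp: diag_def)
  have "closed {z::'a\<times>'a. fst z = snd z}" by (intro closed_Collect_eq continuous_intros)
  then have mS: "- (U \<times> U - diag U) \<in> sets borel"
    unfolding dS by (rule sets.Un[OF borel_comp[OF borel_open[OF op]] borel_closed])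
  have fS: "flip ` (- (U \<times> U - diag U)) = - (U \<times> U - diag U)" and fS': "flip ` (U \<times> U - diag U) = U \<times> U - diag U"
    unfolding flip_vimage[symmetric] by (auto simp: flip_def diag_def)
  show "radon_on (U \<times> U - diag U) (distr J borel flip)"
    unfolding radon_on_def
  proof (intro conjI allI impI)
    show "emeasure (distr J borel flip) (- (U \<times> U - diag U)) = 0"
      unfolding emeasure_distr_flip[OF mS] fS using rJ unfolding radon_on_def by blast
    fix K :: "('a \<times> 'a) set" assume K: "compact K \<and> K \<subseteq> U \<times> U - diag U"
    then have "compact (flip ` K)" using compact_continuous_image[OF continuous_on_flip] by blast
    moreover have "flip ` K \<subseteq> U \<times> U - diag U" using K fS' by blast
    ultimately show "emeasure (distr J borel flip) K < \<infinity>"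
      using rJ K by (simp add: emeasure_distr_flip borel_compact radon_on_def)
  qed simp
  have "flip ` frontier (Gam O' s) = frontier (Gam O' s)" for O' and s :: real
  proof -
    have "flip ` Gam O' s = Gam O' s"
      unfolding flip_vimage[symmetric] by (auto simp: flip_def Gam_def norm_minus_commute)
    then show ?thesis using frontier_flip[of "Gam O' s"] by simp
  qed
  moreover have "flip ` {z. norm (fst z - snd z) = r} = {z. norm (fst z - snd z) = r}" for r
    unfolding flip_vimage[symmetric] by (auto simp: flip_def norm_minus_commute)
  moreover have "{z::'a\<times>'a. norm (fst z - snd z) = r} \<in> sets borel" for r
    by (intro borel_closed closed_Collect_eq continuous_intros)
  ultimately show "admissible_cutoffs U (distr J borel flip) \<delta> Om vs ds"
    using cutoffs unfolding admissible_cutoffs_def by (simp add: emeasure_distr_flip)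
qed (use U \<delta> in auto)

text \<open>Duality of the resolvents gives the reflection for a single product, and linearity
  extends it. This level suffices for the limits; the measures themselves are not
  identified.\<close>

lemma product_sum_flip_integral:
  assumes "\<beta> > 0" "product_sum U U H"
  shows "integral\<^sup>L (sigh \<beta>) H = (\<integral>z. H (flip z) \<partial>sig \<beta>)"
proof -
  interpret A: jump_limit_cutoffs U M sig J E \<delta> Om vs ds by (rule forward_limit)
  interpret B: jump_limit_cutoffs U M sigh "distr J borel flip" "\<lambda>a b. E b a" \<delta> Om vs ds by (rule backward_limit)
  show ?thesis
    using assms(2)
  proof (induction rule: product_sum.induct)
    case (product_sum_add_mult H a b)
    have ps: "product_sum U U (\<lambda>z. a (fst z) * b (snd z))" and ps': "product_sum U U (\<lambda>z. b (fst z) * a (snd z))"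
      by (rule product_sum_mult product_sum_add_mult)+
    have i: "integrable (sigh \<beta>) H" "integrable (sigh \<beta>) (\<lambda>z. a (fst z) * b (snd z))"
      by (rule B.cc_fun_integrable_sig[OF product_sum_cc_fun[OF U U] assms(1)] ps product_sum_add_mult(1))+
    have j: "integrable (sig \<beta>) (\<lambda>z. H (flip z))" "integrable (sig \<beta>) (\<lambda>z. b (fst z) * a (snd z))"
      unfolding flip_def
      by (rule A.cc_fun_integrable_sig[OF product_sum_cc_fun[OF U U] assms(1)] ps' product_sum_swap product_sum_add_mult(1))+
    have "(\<integral>z. H z + a (fst z) * b (snd z) \<partial>sigh \<beta>) = (\<integral>z. H (flip z) \<partial>sig \<beta>) + (\<integral>z. b (fst z) * a (snd z) \<partial>sig \<beta>)"
      using i product_sum_add_mult.IH sigh_swap[OF assms(1) product_sum_add_mult(2,3)] by simp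
    also have "\<dots> = (\<integral>z. H (flip z) + b (fst z) * a (snd z) \<partial>sig \<beta>)" using j by simp
    finally show ?case by (simp add: flip_def mult.commute)
  qed simp
qed

text \<open>The second-order remainder in the chain rule for \<open>Ecd\<close> is the same for the kernels and the co-kernels,
  because exchanging the variables changes it only by a term of third order.\<close>

lemma Ecd_antisymmetric_chain_rule:
  fixes \<Phi> :: "real ^ 'm \<Rightarrow> real"
  assumes \<Phi>: "smooth_on UNIV \<Phi>" and a: "\<And>i. test_fun U (a i)" and h: "test_fun U h"
    and sub: "tsupp h \<subseteq> Udelta U \<delta>"
    and W: "open W" "tsupp h \<subseteq> W" and p: "\<And>x. x \<in> W \<Longrightarrow> p x = \<Phi> (\<chi> j. a j x)"
  shows "Ecd sig Om vs ds p h - Ecd sigh Om vs ds p h =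
    (\<Sum>i\<in>UNIV. Ecd sig Om vs ds (a i) (\<lambda>x. pd (axis i 1) \<Phi> (\<chi> j. a j x) * h x) -
      Ecd sigh Om vs ds (a i) (\<lambda>x. pd (axis i 1) \<Phi> (\<chi> j. a j x) * h x))"
proof -
  interpret A: jump_limit_cutoffs U M sig J E \<delta> Om vs ds by (rule forward_limit)
  interpret B: jump_limit_cutoffs U M sigh "distr J borel flip" "\<lambda>a b. E b a" \<delta> Om vs ds by (rule backward_limit)
  have T: "compact (tsupp h)" using h by (simp add: test_fun_def)
  obtain d where d: "d > \<delta>" "(\<Union>y\<in>tsupp h. cball y d) \<subseteq> U" using Udelta_enlarge[OF T sub] .
  obtain \<kappa> where \<kappa>: "test_fun U \<kappa>" "\<And>x. x \<in> (\<Union>y\<in>tsupp h. cball y d) \<Longrightarrow> \<kappa> x = 1"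
    using exists_cutoff[OF U compact_union_cball[OF T] d(2)] by (metis subsetD)
  define H where "H = chain_defect \<Phi> a h \<kappa>"
  obtain L where L: "A.tend H L" "integrable J H" "product_sum U U H"
    "Ecd sig Om vs ds p h - (\<Sum>i\<in>UNIV. Ecd sig Om vs ds (a i) (\<lambda>x. pd (axis i 1) \<Phi> (\<chi> j. a j x) * h x)) = L - 2 * integral\<^sup>L J H"
    unfolding H_def by (rule A.Ecd_chain_rule[where a = a, OF \<Phi> a h \<kappa>(1) d \<kappa>(2) W p]) blast
  obtain L' where L': "B.tend H L'" "integrable (distr J borel flip) H"
    "Ecd sigh Om vs ds p h - (\<Sum>i\<in>UNIV. Ecd sigh Om vs ds (a i) (\<lambda>x. pd (axis i 1) \<Phi> (\<chi> j. a j x) * h x)) = L' - 2 * integral\<^sup>L (distr J borel flip) H"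
    unfolding H_def by (rule B.Ecd_chain_rule[where a = a, OF \<Phi> a h \<kappa>(1) d \<kappa>(2) W p]) blast
  have ps': "product_sum U U (\<lambda>z. H (flip z))" unfolding flip_def by (rule product_sum_swap[OF L(3)])
  have mH: "H \<in> borel_measurable borel"
    by (rule A.cc_fun_borel[OF product_sum_cc_fun[OF U U L(3)]])
  have Jf: "integral\<^sup>L (distr J borel flip) H = (\<integral>z. H (flip z) \<partial>J)"
    by (rule integral_distr[OF measurable_flip mH])
  have iJf: "integrable J (\<lambda>z. H (flip z))" by (rule integrable_distr[OF measurable_flip L'(2)])
  \<comment> \<open>Reflection carries the limit for the co-kernels over to the kernels, so that
    \<open>L\<close> and \<open>L'\<close> become limits along one family of measures.\<close>
  have t': "A.tend (\<lambda>z. H (flip z)) L'"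
    unfolding A.tend_def
  proof
    show "\<forall>\<beta>>0. integrable (sig \<beta>) (\<lambda>z. H (flip z))"
      using A.cc_fun_integrable_sig[OF product_sum_cc_fun[OF U U ps']] by blast
    show "((\<lambda>\<beta>. \<beta> * (\<integral>z. H (flip z) \<partial>sig \<beta>)) \<longlongrightarrow> L') at_top"
      by (rule A.tend_cong_lim[OF _ conjunct2[OF L'(1)[unfolded B.tend_def]]])
         (simp add: product_sum_flip_integral[OF _ L(3)])
  qed
  obtain C where C: "C \<ge> 0" "\<And>z. \<bar>H z - H (flip z)\<bar> \<le> C * gap z ^ 3"
    unfolding H_def flip_def by (rule A.chain_defect_swap_estimate[where a = a, OF \<Phi> a h \<kappa>(1)]) blast
  \<comment> \<open>Neither \<open>L\<close> nor \<open>L'\<close> need be an integral against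
    \<open>J\<close>, but their difference is, because the difference of the integrands is
    cubic.\<close>
  have "A.tend (\<lambda>z. H z - H (flip z)) (2 * (\<integral>z. H z - H (flip z) \<partial>J))"
    using L(2) iJf
    by (intro A.third_order_tend[OF product_sum_cc_fun[OF U U product_sum_diff[OF U U L(3) ps']] C(2,1)]) auto
  from A.tend_unique[OF A.tend_diff[OF L(1) t'] this]
  have "L - L' = 2 * integral\<^sup>L J H - 2 * (\<integral>z. H (flip z) \<partial>J)" using L(2) iJf by simp
  then show ?thesis using L(4) L'(3) Jf by (simp add: sum_subtractf)
qed

section \<open>The rules for smooth functions\<close>

lemma muc_product_rule:
  fixes \<Phi> :: "real ^ 'm \<Rightarrow> real"
  assumes \<Phi>: "smooth_on UNIV \<Phi>" and u: "\<And>i. smooth_on U (u i)" and v: "smooth_on U v" and g: "test_fun U g"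
  shows "muc U sig Om vs (\<lambda>x. \<Phi> (\<chi> j. u j x)) v g =
    (\<Sum>i\<in>UNIV. muc U sig Om vs (u i) v (\<lambda>x. pd (axis i 1) \<Phi> (\<chi> j. u j x) * g x))"
proof -
  interpret A: jump_limit_cutoffs U M sig J E \<delta> Om vs ds by (rule forward_limit)
  have T: "compact (tsupp g)" "tsupp g \<subseteq> U" using g by (auto simp: test_fun_def)
  obtain \<eta> W where \<eta>: "test_fun U \<eta>" "open W" "tsupp g \<subseteq> W" "\<And>y. y \<in> W \<Longrightarrow> \<eta> y = 1"
    using exists_cutoff[OF U T] by metis
  define a where "a i x = \<eta> x * u i x" for i x
  define b where "b x = \<eta> x * v x" for x
  define g' where "g' i x = pd (axis i 1) \<Phi> (\<chi> j. u j x) * g x" for i x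
  have ta: "test_fun U (a i)" for i unfolding a_def by (rule test_fun_mult[OF U \<eta>(1) u])
  have tb: "test_fun U b" unfolding b_def by (rule test_fun_mult[OF U \<eta>(1) v])
  have tg': "test_fun U (g' i)" for i
    using test_fun_mult[OF U g smooth_on_compose_cart[OF U smooth_on_pd[OF \<Phi> axis_Basis] u]]
    by (simp add: g'_def[abs_def] mult.commute)
  have g'a: "g' i = (\<lambda>x. pd (axis i 1) \<Phi> (\<chi> j. a j x) * g x)" for i
  proof
    fix x
    show "g' i x = pd (axis i 1) \<Phi> (\<chi> j. a j x) * g x"
    proof (cases "x \<in> tsupp g")
      case True
      then have "\<eta> x = 1" using \<eta>(3,4) by blast
      then show ?thesis by (simp add: g'_def a_def)
    qed (simp add: g'_def not_in_tsupp)
  qed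
  have "muc U sig Om vs (\<lambda>x. \<Phi> (\<chi> j. u j x)) v g = muc0 sig Om vs (\<lambda>x. \<Phi> (\<chi> j. u j x)) b g"
    by (rule A.muc_eq[OF smooth_on_compose_cart[OF U \<Phi> u] v g \<eta>(2,3)]) (simp add: b_def \<eta>(4))
  also have "\<dots> = (\<Sum>i\<in>UNIV. muc0 sig Om vs (a i) b (g' i))"
    unfolding g'a by (rule A.muc0_chain_rule[OF \<Phi> ta tb g \<eta>(2,3)]) (simp add: a_def \<eta>(4))
  also have "\<dots> = (\<Sum>i\<in>UNIV. muc U sig Om vs (u i) v (g' i))"
  proof (rule sum.cong[OF refl])
    fix i
    have "tsupp (g' i) \<subseteq> W" using tsupp_mult_right[of "\<lambda>x. pd (axis i 1) \<Phi> (\<chi> j. u j x)" g] \<eta>(3) unfolding g'_def by blast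
    then show "muc0 sig Om vs (a i) b (g' i) = muc U sig Om vs (u i) v (g' i)"
      by (intro A.muc_eq[OF u v tg' \<eta>(2), symmetric]) (simp_all add: a_def b_def \<eta>(4))
  qed
  finally show ?thesis unfolding g'_def[abs_def] .
qed

lemma Ld_product_rule:
  fixes \<Phi> :: "real ^ 'm \<Rightarrow> real"
  assumes \<Phi>: "smooth_on UNIV \<Phi>" and u: "\<And>i. smooth_on (Udelta U \<delta>) (u i)" and v: "smooth_on (Udelta U \<delta>) v"
    and w: "smooth_on (Udelta U \<delta>) w" and f: "test_fun (Udelta U \<delta>) f"
  shows "Ld U \<delta> sig sigh Om vs ds (\<lambda>x. \<Phi> (\<chi> j. u j x)) (\<lambda>x. v x * w x) f =
    (\<Sum>i\<in>UNIV. Ld U \<delta> sig sigh Om vs ds (u i) v (\<lambda>x. pd (axis i 1) \<Phi> (\<chi> j. u j x) * w x * f x))"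
proof -
  interpret A: jump_limit_cutoffs U M sig J E \<delta> Om vs ds by (rule forward_limit)
  have D: "open (Udelta U \<delta>)" by (rule open_Udelta[OF U])
  note tm = test_fun_mult[OF D] and tU = test_fun_subset[OF Udelta_subset D U]
  have T: "compact (tsupp f)" "tsupp f \<subseteq> Udelta U \<delta>" using f by (auto simp: test_fun_def)
  obtain \<eta> W where \<eta>: "test_fun (Udelta U \<delta>) \<eta>" "open W" "tsupp f \<subseteq> W" "\<And>y. y \<in> W \<Longrightarrow> \<eta> y = 1"
    using exists_cutoff[OF D T] by metis
  define a where "a i x = \<eta> x * u i x" for i x
  define b where "b x = \<eta> x * v x" for x
  define c where "c x = \<eta> x * (v x * w x)" for x
  define h where "h x = c x * f x" for x
  define f' where "f' i x = pd (axis i 1) \<Phi> (\<chi> j. u j x) * w x * f x" for i x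
  have ta: "test_fun U (a i)" for i unfolding a_def by (rule tU[OF tm[OF \<eta>(1) u]])
  have vw: "smooth_on (Udelta U \<delta>) (\<lambda>x. v x * w x)" by (rule smooth_on_mult[OF D v w])
  have "test_fun (Udelta U \<delta>) c" unfolding c_def by (rule tm[OF \<eta>(1) vw])
  then have th: "test_fun U h" unfolding h_def by (rule tU[OF tm]) (use f in \<open>simp add: test_fun_def\<close>)
  have hf: "tsupp h \<subseteq> tsupp f" unfolding h_def by (rule tsupp_mult_right)
  have tf': "test_fun (Udelta U \<delta>) (f' i)" for i
    using tm[OF f smooth_on_mult[OF D smooth_on_compose_cart[OF D smooth_on_pd[OF \<Phi> axis_Basis] u] w]]
    by (simp add: f'_def[abs_def] mult_ac)
  \<comment> \<open>Where \<eta> is 1, \<open>v\<close> times \<open>\<Phi>_i w f\<close> equals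
    \<open>\<Phi>_i\<close> times \<open>h = v w f\<close>. In this way \<open>w\<close> moves from
    the second argument into the test function, and both sides of the rule refer to the same
    \<open>h\<close>.\<close>
  have bf': "(\<lambda>x. b x * f' i x) = (\<lambda>x. pd (axis i 1) \<Phi> (\<chi> j. a j x) * h x)" for i
  proof
    fix x
    show "b x * f' i x = pd (axis i 1) \<Phi> (\<chi> j. a j x) * h x"
    proof (cases "x \<in> tsupp f")
      case True
      then have "\<eta> x = 1" using \<eta>(3,4) by blast
      then show ?thesis by (simp add: f'_def a_def b_def c_def h_def)
    qed (simp add: f'_def h_def not_in_tsupp)
  qed
  have "Ld U \<delta> sig sigh Om vs ds (\<lambda>x. \<Phi> (\<chi> j. u j x)) (\<lambda>x. v x * w x) f =
      L0 sig sigh Om vs ds (\<lambda>x. \<Phi> (\<chi> j. u j x)) c f"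
    by (rule Ld_eq[OF U A.vs_lim smooth_on_compose_cart[OF D \<Phi> u] vw f \<eta>(2,3)]) (simp add: c_def \<eta>(4))
  also have "\<dots> = (\<Sum>i\<in>UNIV. L0 sig sigh Om vs ds (a i) b (f' i))"
    unfolding L0_def bf' h_def[symmetric] sum_divide_distrib[symmetric]
    by (subst Ecd_antisymmetric_chain_rule[OF \<Phi> ta th _ \<eta>(2)])
       (use hf T(2) \<eta>(3) in \<open>auto simp: a_def \<eta>(4)\<close>)
  also have "\<dots> = (\<Sum>i\<in>UNIV. Ld U \<delta> sig sigh Om vs ds (u i) v (f' i))"
  proof (rule sum.cong[OF refl])
    fix i
    have "tsupp (f' i) \<subseteq> W"
      using tsupp_mult_right[of "\<lambda>x. pd (axis i 1) \<Phi> (\<chi> j. u j x) * w x" f] \<eta>(3) unfolding f'_def by blast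
    then show "L0 sig sigh Om vs ds (a i) b (f' i) = Ld U \<delta> sig sigh Om vs ds (u i) v (f' i)"
      by (intro Ld_eq[OF U A.vs_lim u v tf' \<eta>(2), symmetric]) (simp_all add: a_def b_def \<eta>(4))
  qed
  finally show ?thesis unfolding f'_def[abs_def] .
qed

end

theorem theorem2p6:
  fixes U :: "'a::euclidean_space set" and M :: "'a measure"
    and E :: "('a \<Rightarrow> real) \<Rightarrow> ('a \<Rightarrow> real) \<Rightarrow> real"
    and G Gh :: "real \<Rightarrow> ('a \<Rightarrow> real) \<Rightarrow> ('a \<Rightarrow> real)"
    and sig sigh :: "real \<Rightarrow> ('a \<times> 'a) measure"
    and J :: "('a \<times> 'a) measure"
    and \<delta> :: real and Om :: "nat \<Rightarrow> 'a set" and vs ds :: "nat \<Rightarrow> real"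
    and \<Phi> :: "real ^ 'm \<Rightarrow> real"
  assumes "open U"
    and "radon_full_support U M"
    and "case1 U M E G Gh \<or> case2 U M E G Gh"
    and "resolvent_kernels U M G sig"
    and "resolvent_kernels U M Gh sigh"
    and "jumping_measure U E J"
    and "\<delta> > 0" and "Udelta U \<delta> \<noteq> {}"
    and "admissible_cutoffs U J \<delta> Om vs ds"
    and "smooth_on UNIV \<Phi>"
  shows "(\<forall>u :: 'm \<Rightarrow> 'a \<Rightarrow> real. \<forall>v.
            (\<forall>i. smooth_on U (u i)) \<longrightarrow> smooth_on U v \<longrightarrow>
            (\<forall>g. test_fun U g \<longrightarrow>
               muc U sig Om vs (\<lambda>x. \<Phi> (\<chi> j. u j x)) v g =
               (\<Sum>i\<in>UNIV. muc U sig Om vs (u i) v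
                   (\<lambda>x. pd (axis i 1) \<Phi> (\<chi> j. u j x) * g x)))) \<and>
         (\<forall>u :: 'm \<Rightarrow> 'a \<Rightarrow> real. \<forall>v w f.
            (\<forall>i. smooth_on (Udelta U \<delta>) (u i)) \<longrightarrow> smooth_on (Udelta U \<delta>) v \<longrightarrow>
            smooth_on (Udelta U \<delta>) w \<longrightarrow> test_fun (Udelta U \<delta>) f \<longrightarrow>
            Ld U \<delta> sig sigh Om vs ds (\<lambda>x. \<Phi> (\<chi> j. u j x)) (\<lambda>x. v x * w x) f =
            (\<Sum>i\<in>UNIV. Ld U \<delta> sig sigh Om vs ds (u i) v
                (\<lambda>x. pd (axis i 1) \<Phi> (\<chi> j. u j x) * w x * f x)))"
  using muc_product_rule[OF assms(1-7,9,10)] Ld_product_rule[OF assms(1-7,9,10)] by blast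

end
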